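(* Let $G=(V,E)$ be a random power law graph on $n$ vertices with average degree $\nu>1$ and exponent $\beta>3$. With high probability over the randomness of $G$, every distance labeling scheme for $G$ that recovers all pairwise distances exactly has total length at least $\tilde\Omega(n^{3/2})$. In particular, with high probability every 2-hop cover of $G$ stores at least $\tilde\Omega(n^{3/2})$ landmarks in total.
   Context: Random power law graph: for $x_{\min}>0$, $\beta>2$, let $f(t)=Zt^{-\beta}$ on $[x_{\min},\infty)$, $Z=(\beta-1)x_{\min}^{\beta-1}$, with mean $\nu$ (the average degree). Each vertex gets an independent weight $p_x\sim f$; given the weights, each pair of distinct vertices $x,y$ is an edge independently with probability $\min\{p_xp_y/\mathrm{vol}(V),1\}$, $\mathrm{vol}(V)=\sum_xp_x$. A distance labeling scheme assigns to each vertex $v$ a binary string $\mathcal L(v)$ such that a decoding rule fixed in advance (not depending on $G$) computes $\mathrm{dist}_G(x,y)$ from $\mathcal L(x),\mathcal L(y)$ alone; its total length is $\sum_v|\mathcal L(v)|$. A 2-hop cover is a landmark labeling $\{L(v)\}$ (landmarks stored with their distances) with $\min_{z\in L(x)\cap L(y)}(\mathrm{dist}(x,z)+\mathrm{dist}(z,y))=\mathrm{dist}(x,y)$ for all pairs in the same connected component; its number of landmarks is $\sum_v|L(v)|$. $\tilde\Omega$ hides polylogarithmic factors; "with high probability" means with probability tending to $1$ as $n\to\infty$. *)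

theory Defs
  imports "HOL-Probability.Probability"
begin

text \<open>Normalising constant Z = (beta - 1) xmin^(beta-1) and the power law density
  f(t) = Z t^(-beta) on [xmin, infinity).\<close>
definition pl_density :: "real \<Rightarrow> real \<Rightarrow> real \<Rightarrow> real" where
  "pl_density xmin \<beta> t =
     (if xmin \<le> t then (\<beta> - 1) * xmin powr (\<beta> - 1) * t powr (- \<beta>) else 0)"

definition pl_weight_dist :: "real \<Rightarrow> real \<Rightarrow> real measure" where
  "pl_weight_dist xmin \<beta> = density lborel (\<lambda>t. ennreal (pl_density xmin \<beta> t))"

text \<open>Mean of the weight distribution, i.e. the average degree nu.\<close>
definition pl_mean :: "real \<Rightarrow> real \<Rightarrow> real" where
  "pl_mean xmin \<beta> = (LINT t|lborel. t * pl_density xmin \<beta> t)"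

definition pl_weights :: "real \<Rightarrow> real \<Rightarrow> nat \<Rightarrow> (nat \<Rightarrow> real) measure" where
  "pl_weights xmin \<beta> n = PiM {0..<n} (\<lambda>_. pl_weight_dist xmin \<beta>)"

text \<open>Vertex set is {0..<n}. A graph outcome is an edge indicator on unordered pairs,
  encoded as (i,j) with i < j < n.\<close>
definition vertex_pairs :: "nat \<Rightarrow> (nat \<times> nat) set" where
  "vertex_pairs n = {(i, j). i < j \<and> j < n}"

definition rpl_edges :: "nat \<Rightarrow> (nat \<Rightarrow> real) \<Rightarrow> (nat \<times> nat \<Rightarrow> bool) pmf" where
  "rpl_edges n w = Pi_pmf (vertex_pairs n) False
     (\<lambda>(i, j). bernoulli_pmf (min (w i * w j / (\<Sum>x<n. w x)) 1))"

definition adj :: "nat \<Rightarrow> (nat \<times> nat \<Rightarrow> bool) \<Rightarrow> nat \<Rightarrow> nat \<Rightarrow> bool" where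
  "adj n e x y \<longleftrightarrow> x < n \<and> y < n \<and> x \<noteq> y \<and> e (min x y, max x y)"

definition rpl_prob :: "real \<Rightarrow> real \<Rightarrow> nat \<Rightarrow> ((nat \<times> nat \<Rightarrow> bool) \<Rightarrow> bool) \<Rightarrow> real" where
  "rpl_prob xmin \<beta> n A =
     (\<integral>w. measure_pmf.prob (rpl_edges n w) {e. A e} \<partial>pl_weights xmin \<beta> n)"

definition is_walk :: "(nat \<Rightarrow> nat \<Rightarrow> bool) \<Rightarrow> nat list \<Rightarrow> bool" where
  "is_walk G xs \<longleftrightarrow> xs \<noteq> [] \<and> (\<forall>i. Suc i < length xs \<longrightarrow> G (xs ! i) (xs ! Suc i))"

text \<open>dist_G(x,y): length of a shortest path; infinity if x and y are disconnected.\<close>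
definition gdist :: "(nat \<Rightarrow> nat \<Rightarrow> bool) \<Rightarrow> nat \<Rightarrow> nat \<Rightarrow> enat" where
  "gdist G x y = (INF xs \<in> {xs. is_walk G xs \<and> hd xs = x \<and> last xs = y}.
                    enat (length xs - 1))"

definition valid_distance_labeling ::
  "nat \<Rightarrow> (nat \<Rightarrow> nat \<Rightarrow> bool) \<Rightarrow> (bool list \<Rightarrow> bool list \<Rightarrow> enat) \<Rightarrow> (nat \<Rightarrow> bool list) \<Rightarrow> bool"
  where
  "valid_distance_labeling n G D L \<longleftrightarrow> (\<forall>x<n. \<forall>y<n. D (L x) (L y) = gdist G x y)"

definition labeling_length :: "nat \<Rightarrow> (nat \<Rightarrow> bool list) \<Rightarrow> nat" where
  "labeling_length n L = (\<Sum>v<n. length (L v))"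

definition two_hop_cover :: "nat \<Rightarrow> (nat \<Rightarrow> nat \<Rightarrow> bool) \<Rightarrow> (nat \<Rightarrow> nat set) \<Rightarrow> bool" where
  "two_hop_cover n G L \<longleftrightarrow>
     (\<forall>v<n. L v \<subseteq> {0..<n}) \<and>
     (\<forall>x<n. \<forall>y<n. gdist G x y \<noteq> \<infinity> \<longrightarrow>
        L x \<inter> L y \<noteq> {} \<and>
        Min ((\<lambda>z. gdist G x z + gdist G z y) ` (L x \<inter> L y)) = gdist G x y)"

definition num_landmarks :: "nat \<Rightarrow> (nat \<Rightarrow> nat set) \<Rightarrow> nat" where
  "num_landmarks n L = (\<Sum>v<n. card (L v))"

end

theory Submission
  imports Defs "HOL-Real_Asymp.Real_Asymp"
begin

text \<open>Fix weights that are typical for the power law. The vertices whose weight is about a large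
  power \<open>L\<close> of \<open>ln n\<close> form a set \<open>H\<close> of \<open>n / polylog\<close> vertices, and with
  high probability the ball of a suitable common radius \<open>r\<close> around most of them has
  \<open>\<surd>n / polylog\<close> elements, while only a \<open>1 / polylog\<close> fraction of the pairs in \<open>H\<close>
  is within distance \<open>2 r + 1\<close>. Take a random \<open>S \<subseteq> H\<close> of about \<open>\<surd>n\<close> vertices
  (up to polylogarithmic factors), and call a vertex at distance \<open>r\<close> from exactly one element of \<open>S\<close>,
  and further away from the others, private to this element. Edges between private vertices of different
  owners are independent of the balls of radius \<open>r\<close>, and they must be absent whenever the owners
  are further apart than \<open>2 r + 1\<close>. There are \<open>n\<^sup>2 / polylog\<close> such pairs, each present with
  probability at least about \<open>1 / n\<close>, so no prescribed distance matrix on \<open>S\<close> occurs with probability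
  more than \<open>exp (- n / polylog)\<close>. A union bound shows that the labels of \<open>S\<close> have
  total length \<open>n / polylog\<close>, and averaging over \<open>S\<close> gives \<open>n\<^sup>3\<^sup>/\<^sup>2 / polylog\<close> for all labels.

  Only vertices of moderate weight are used inside the paths from \<open>S\<close> to the private vertices:
  this keeps second moments finite, although the third moment of the weights need not exist.

  The union bound only uses that there are at most \<open>n\<^bsup>O(j)\<^esup>\<close> labels of length \<open>j\<close>. This also holds
  if a label is a set of \<open>j\<close> landmarks with their distances, which gives the bound for 2-hop covers.\<close>

section \<open>Finite probability spaces\<close>

text \<open>The branching factor of the search is \<open>\<mu>\<close>, the ratio of the sum of
  squared weights to the sum of weights. By Cauchy-Schwarz it is at least the average weight, so a
  mean above 1 makes balls grow exponentially, and \<beta> > 3 keeps it below \<open>ln n\<close>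
  with high probability. The radius \<open>r\<close> is the last one for which
  \<open>\<mu> ^ r\<close> stays below sqrt n over a fixed power of \<open>ln n\<close>: far layers
  are then almost as large as possible, while \<open>2 * r + 1\<close> steps still reach only a
  small part of \<open>H\<close>. High starting weights are forced by the error budget. From a
  vertex of bounded weight the search dies out with probability bounded away from 0, whereas
  Markov's inequality needs a failure probability tending to 0 to make half of \<open>H\<close>
  typical with high probability. From weight \<open>L\<close> each step has relative error and
  failure probability 1/polylog, and all O(ln n) steps together lose at most a factor of 2. Only
  powers of \<open>ln n\<close> are tracked; their exponents are settled together in
  \<open>prob_short_labeling_good_weights\<close>.\<close>

lemma expectation_finite:
  fixes f :: "'a \<Rightarrow> real"
  assumes "finite (set_pmf M)"
  shows "measure_pmf.expectation M f = (\<Sum>a\<in>set_pmf M. pmf M a * f a)"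
  by (subst integral_measure_pmf[OF assms]) auto

lemma expectation_mono_finite:
  fixes f g :: "'a \<Rightarrow> real"
  assumes "finite (set_pmf M)" "\<And>a. a \<in> set_pmf M \<Longrightarrow> f a \<le> g a"
  shows "measure_pmf.expectation M f \<le> measure_pmf.expectation M g"
  using assms by (auto simp: expectation_finite intro!: sum_mono mult_left_mono)

lemma expectation_sum_finite:
  fixes f :: "'b \<Rightarrow> 'a \<Rightarrow> real"
  assumes "finite (set_pmf M)"
  shows "measure_pmf.expectation M (\<lambda>a. \<Sum>i\<in>I. f i a) = (\<Sum>i\<in>I. measure_pmf.expectation M (f i))"
  using assms by (simp add: expectation_finite sum_distrib_left sum.swap[of _ I])

lemma prob_eq_expectation:
  "measure_pmf.prob M {a. P a} = measure_pmf.expectation M (\<lambda>a. of_bool (P a))"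
proof -
  have "(\<lambda>a. of_bool (P a)) = indicat_real {a. P a}" by (auto simp: indicator_def fun_eq_iff)
  then show ?thesis by simp
qed

lemma prob_mono_finite:
  assumes "finite (set_pmf M)" "\<And>a. a \<in> set_pmf M \<Longrightarrow> P a \<Longrightarrow> Q a"
  shows "measure_pmf.prob M {a. P a} \<le> measure_pmf.prob M {a. Q a}"
  unfolding prob_eq_expectation using assms by (intro expectation_mono_finite) auto

lemma expectation_nonneg_pmf:
  fixes f :: "'a \<Rightarrow> real"
  assumes "finite (set_pmf M)" "\<And>a. a \<in> set_pmf M \<Longrightarrow> 0 \<le> f a"
  shows "0 \<le> measure_pmf.expectation M f"
  using assms by (auto simp: expectation_finite intro!: sum_nonneg)

lemma markov_pmf:
  fixes f :: "'a \<Rightarrow> real"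
  assumes fin: "finite (set_pmf M)" and nn: "\<And>a. a \<in> set_pmf M \<Longrightarrow> 0 \<le> f a"
    and E: "measure_pmf.expectation M f \<le> b" and t: "0 < t"
  shows "measure_pmf.prob M {a. t \<le> f a} \<le> b / t"
proof -
  have "t * measure_pmf.prob M {a. t \<le> f a} = measure_pmf.expectation M (\<lambda>a. t * of_bool (t \<le> f a))"
    by (simp add: prob_eq_expectation)
  also have "\<dots> \<le> measure_pmf.expectation M f"
    using nn by (intro expectation_mono_finite fin) auto
  finally show ?thesis using t E by (simp add: field_simps)
qed

lemma prob_union_pmf:
  "measure_pmf.prob M {a. P a \<or> Q a} \<le> measure_pmf.prob M {a. P a} + measure_pmf.prob M {a. Q a}"
proof -
  have "{a. P a \<or> Q a} = {a. P a} \<union> {a. Q a}" by auto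
  then show ?thesis by (simp add: measure_Un_le)
qed

lemma prob_compl_pmf:
  "measure_pmf.prob M {a. \<not> P a} = 1 - measure_pmf.prob M {a. P a}"
proof -
  have "{a. \<not> P a} = UNIV - {a. P a}" by auto
  then show ?thesis using measure_pmf.prob_compl[of "{a. P a}" M] by simp
qed
 
lemma expectation_swap_finite:
  fixes f :: "'a \<Rightarrow> 'b \<Rightarrow> real"
  assumes "finite (set_pmf M)" "finite (set_pmf N)"
  shows "measure_pmf.expectation M (\<lambda>a. measure_pmf.expectation N (\<lambda>b. f a b)) =
         measure_pmf.expectation N (\<lambda>b. measure_pmf.expectation M (\<lambda>a. f a b))"
  using assms by (simp add: expectation_finite sum_distrib_left sum.swap[of _ "set_pmf M"] mult_ac)

lemma finite_set_Pi_pmf_bool: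
  fixes p :: "'a \<Rightarrow> bool pmf"
  assumes "finite A"
  shows "finite (set_pmf (Pi_pmf A d p))"
  using assms by (auto simp: set_Pi_pmf)

lemma expectation_pair_product:
  fixes f :: "'a \<Rightarrow> real" and g :: "'b \<Rightarrow> real"
  assumes "finite (set_pmf M)" "finite (set_pmf N)"
  shows "measure_pmf.expectation (pair_pmf M N) (\<lambda>(a, b). f a * g b) =
         measure_pmf.expectation M f * measure_pmf.expectation N g"
proof -
  have "measure_pmf.expectation (pair_pmf M N) (\<lambda>(a, b). f a * g b) =
     (\<Sum>z\<in>set_pmf M \<times> set_pmf N. pmf (pair_pmf M N) z * (case z of (a, b) \<Rightarrow> f a * g b))"
    using assms by (simp add: expectation_finite)
  also have "\<dots> = (\<Sum>z\<in>set_pmf M \<times> set_pmf N. case z of (a, b) \<Rightarrow> (pmf M a * f a) * (pmf N b * g b))"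
    by (intro sum.cong) (auto simp: pmf_pair)
  also have "\<dots> = measure_pmf.expectation M f * measure_pmf.expectation N g"
    using assms by (simp add: expectation_finite sum_product sum.cartesian_product)
  finally show ?thesis .
qed

text \<open>The finite counterpart of measurability with respect to the coordinates in
  \<open>X\<close>.\<close>

definition depends_only :: "'a set \<Rightarrow> (('a \<Rightarrow> 'b) \<Rightarrow> 'c) \<Rightarrow> bool" where
  "depends_only X f \<longleftrightarrow> (\<forall>e e'. (\<forall>p\<in>X. e p = e' p) \<longrightarrow> f e = f e')"

lemma depends_onlyD: "depends_only X f \<Longrightarrow> (\<And>p. p \<in> X \<Longrightarrow> e p = e' p) \<Longrightarrow> f e = f e'"
  by (auto simp: depends_only_def)

lemma depends_only_comp: "depends_only X f \<Longrightarrow> depends_only X (\<lambda>e. g (f e))"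
  unfolding depends_only_def by metis

text \<open>The product over \<open>I\<close> is a pair of independent products over
  \<open>X\<close> and \<open>I - X\<close>; \<open>f\<close> sees only the first component and
  \<open>g\<close> only the second.\<close>

lemma expectation_Pi_pmf_indep:
  fixes f g :: "('a \<Rightarrow> bool) \<Rightarrow> real" and p :: "'a \<Rightarrow> bool pmf"
  assumes fin: "finite I" and X: "X \<subseteq> I" and Y: "Y \<subseteq> I" and disj: "X \<inter> Y = {}"
    and f: "depends_only X f" and g: "depends_only Y g"
  shows "measure_pmf.expectation (Pi_pmf I d p) (\<lambda>e. f e * g e) =
         measure_pmf.expectation (Pi_pmf I d p) f * measure_pmf.expectation (Pi_pmf I d p) g"
proof -
  let ?B = "I - X"
  let ?P = "Pi_pmf X d p" and ?Q = "Pi_pmf ?B d p"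
  have finX: "finite X" and finB: "finite ?B" using fin X finite_subset by auto
  note fs = finite_set_Pi_pmf_bool[OF finX, of d p] finite_set_Pi_pmf_bool[OF finB, of d p]
  have U: "Pi_pmf I d p = map_pmf (\<lambda>(f,g) x. if x \<in> X then f x else g x) (pair_pmf ?P ?Q)"
    using Pi_pmf_union[OF finX finB, of d p] X by (simp add: Un_absorb1)
  have ff: "f (\<lambda>x. if x \<in> X then a x else b x) = f a" for a b
    by (rule depends_onlyD[OF f]) auto
  have gg: "g (\<lambda>x. if x \<in> X then a x else b x) = g b" for a b
    by (rule depends_onlyD[OF g]) (use disj in auto)
  have "measure_pmf.expectation (Pi_pmf I d p) (\<lambda>e. f e * g e) =
        measure_pmf.expectation (pair_pmf ?P ?Q) (\<lambda>(a, b). f a * g b)"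
    unfolding U by (simp add: case_prod_unfold ff gg)
  also have "\<dots> = measure_pmf.expectation ?P f * measure_pmf.expectation ?Q g"
    by (rule expectation_pair_product[OF fs])
  also have "measure_pmf.expectation ?P f = measure_pmf.expectation (Pi_pmf I d p) f"
    using expectation_pair_product[OF fs, of f "\<lambda>_. 1"] unfolding U by (simp add: case_prod_unfold ff)
  also have "measure_pmf.expectation ?Q g = measure_pmf.expectation (Pi_pmf I d p) g"
    using expectation_pair_product[OF fs, of "\<lambda>_. 1" g] unfolding U by (simp add: case_prod_unfold gg)
  finally show ?thesis .
qed

text \<open>Changing a configuration on \<open>P e\<close> does not change \<open>P e\<close>, so the configurations
  vanishing on their own set \<open>P e\<close> have disjoint fibres (the configurations that differ from them
  only there), and the mass of such a fibre is the mass of its base divided by the probability that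
  all of \<open>P e\<close> vanishes.\<close>
lemma prob_all_absent_le:
  fixes q :: "'a \<Rightarrow> real" and P :: "('a \<Rightarrow> bool) \<Rightarrow> 'a set"
  assumes fin: "finite I" and q: "\<And>i. i \<in> I \<Longrightarrow> 0 \<le> q i \<and> q i \<le> 1"
    and q_ge: "\<And>e i. i \<in> P e \<Longrightarrow> \<delta> \<le> q i" and \<delta>: "0 \<le> \<delta>" and d1: "\<delta> \<le> 1"
    and sub: "\<And>e. P e \<subseteq> I"
    and inv: "\<And>e e'. (\<And>i. i \<notin> P e \<Longrightarrow> e' i = e i) \<Longrightarrow> P e' = P e"
  shows "measure_pmf.prob (Pi_pmf I False (\<lambda>i. bernoulli_pmf (q i)))
           {e. m \<le> card (P e) \<and> (\<forall>i\<in>P e. \<not> e i)} \<le> (1 - \<delta>) ^ m"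
proof -
  let ?M = "Pi_pmf I False (\<lambda>i. bernoulli_pmf (q i))"
  define G where "G = {e \<in> set_pmf ?M. m \<le> card (P e) \<and> (\<forall>i\<in>P e. \<not> e i)}"
  define fib where "fib e = {e'. \<forall>i. i \<notin> P e \<longrightarrow> e' i = e i}" for e :: "'a \<Rightarrow> bool"
  have finM: "finite (set_pmf ?M)" by (rule finite_set_Pi_pmf_bool[OF fin])
  have finG: "finite G" unfolding G_def using finM by auto
  have mass: "pmf ?M e \<le> (1 - \<delta>) ^ m * measure_pmf.prob ?M (fib e)" if e: "e \<in> G" for e
  proof -
    have out: "\<not> e i" if "i \<notin> I" for i
      using e that set_Pi_pmf_subset[OF fin, of False "\<lambda>i. bernoulli_pmf (q i)"] by (auto simp: G_def)
    \<comment> \<open>Within the support the fibre is a box: the coordinates in \<open>P e\<close>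
      are free, all others are pinned to those of \<open>e\<close>. So its probability is a product
      over \<open>I - P e\<close>.\<close>
    define R where "R i = (if i \<in> P e then UNIV else {e i})" for i
    have "fib e \<inter> PiE_dflt I False (\<lambda>_. UNIV) = PiE_dflt I False R"
      using out sub[of e] by (fastforce simp: fib_def PiE_dflt_def R_def)
    moreover have "measure_pmf.prob ?M (fib e) = measure_pmf.prob ?M (fib e \<inter> PiE_dflt I False (\<lambda>_. UNIV))"
      by (intro measure_prob_cong_0) (auto simp: PiE_dflt_def intro!: pmf_Pi_outside[OF fin])
    ultimately have "measure_pmf.prob ?M (fib e) =
        (\<Prod>i\<in>I. measure_pmf.prob (bernoulli_pmf (q i)) (R i))"
      using measure_Pi_pmf_PiE_dflt[OF fin, of False "\<lambda>i. bernoulli_pmf (q i)" R] by simp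
    also have "\<dots> = (\<Prod>i\<in>I - P e. pmf (bernoulli_pmf (q i)) (e i))"
      unfolding prod.subset_diff[OF sub fin, of _ e]
      by (auto simp: R_def measure_pmf_single intro!: prod.cong)
    finally have f: "measure_pmf.prob ?M (fib e) = (\<Prod>i\<in>I - P e. pmf (bernoulli_pmf (q i)) (e i))" .
    have "pmf ?M e = (\<Prod>i\<in>I. pmf (bernoulli_pmf (q i)) (e i))"
      using out by (subst pmf_Pi'[OF fin]) auto
    also have "\<dots> = (\<Prod>i\<in>I - P e. pmf (bernoulli_pmf (q i)) (e i)) * (\<Prod>i\<in>P e. pmf (bernoulli_pmf (q i)) (e i))"
      by (rule prod.subset_diff[OF sub fin])
    also have "\<dots> = measure_pmf.prob ?M (fib e) * (\<Prod>i\<in>P e. pmf (bernoulli_pmf (q i)) (e i))"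
      by (simp add: f)
    also have "\<dots> \<le> measure_pmf.prob ?M (fib e) * (1 - \<delta>) ^ m"
    proof (rule mult_left_mono)
    have "(\<Prod>i\<in>P e. pmf (bernoulli_pmf (q i)) (e i)) \<le> (\<Prod>i\<in>P e. 1 - \<delta>)"
    proof (rule prod_mono)
      fix i assume i: "i \<in> P e"
      then have "\<not> e i" and iI: "i \<in> I" using e sub by (auto simp: G_def)
      then show "0 \<le> pmf (bernoulli_pmf (q i)) (e i) \<and> pmf (bernoulli_pmf (q i)) (e i) \<le> 1 - \<delta>"
        using q[OF iI] q_ge[OF i] by auto
    qed
    also have "(\<Prod>i\<in>P e. 1 - \<delta>) \<le> (1 - \<delta>) ^ m"
      using e d1 \<delta> by (auto simp: G_def intro: power_decreasing)
    finally show "(\<Prod>i\<in>P e. pmf (bernoulli_pmf (q i)) (e i)) \<le> (1 - \<delta>) ^ m" .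
    qed simp
    finally show ?thesis by (simp add: mult.commute)
  qed
  have disj: "disjoint_family_on fib G" unfolding disjoint_family_on_def
  proof (intro ballI impI)
    fix e e' assume e: "e \<in> G" and e': "e' \<in> G" and ne: "e \<noteq> e'"
    show "fib e \<inter> fib e' = {}"
    proof (rule ccontr)
      assume "fib e \<inter> fib e' \<noteq> {}"
      then obtain f where f: "f \<in> fib e" "f \<in> fib e'" by blast
      have "P f = P e" "P f = P e'" using f by (auto simp: fib_def intro!: inv)
      then have "P e = P e'" by simp
      \<comment> \<open>Off the common set both configurations agree with \<open>f\<close>; on it
        both vanish.\<close>
      then have "e i = e' i" for i
        using f e e' unfolding fib_def G_def by (cases "i \<in> P e") auto
      then show False using ne by auto
    qed
  qed
  have m1: "0 \<le> (1 - \<delta>) ^ m" using d1 by simp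
  have "measure_pmf.prob ?M {e. m \<le> card (P e) \<and> (\<forall>i\<in>P e. \<not> e i)} = measure_pmf.prob ?M G"
    by (intro measure_prob_cong_0) (auto simp: G_def set_pmf_iff)
  also have "\<dots> = (\<Sum>e\<in>G. pmf ?M e)" by (rule measure_measure_pmf_finite[OF finG])
  also have "\<dots> \<le> (\<Sum>e\<in>G. (1 - \<delta>) ^ m * measure_pmf.prob ?M (fib e))"
    by (intro sum_mono mass)
  also have "\<dots> = (1 - \<delta>) ^ m * measure_pmf.prob ?M (\<Union>e\<in>G. fib e)"
    using disj finG by (subst measure_pmf.finite_measure_finite_Union) (auto simp: sum_distrib_left)
  also have "\<dots> \<le> (1 - \<delta>) ^ m * 1" using m1 by (intro mult_left_mono) auto
  finally show ?thesis by simp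
qed

section \<open>Breadth-first search\<close>

type_synonym edge_config = "nat \<times> nat \<Rightarrow> bool"

definition fresh_nbrs :: "nat \<Rightarrow> edge_config \<Rightarrow> nat set \<Rightarrow> nat set \<Rightarrow> nat set" where
  "fresh_nbrs n e B A = {y. y \<notin> B \<and> (\<exists>u\<in>A. adj n e u y)}"

primrec bfs_ball :: "nat \<Rightarrow> edge_config \<Rightarrow> nat \<Rightarrow> nat \<Rightarrow> nat set" where
  "bfs_ball n e x 0 = {x}"
| "bfs_ball n e x (Suc i) = bfs_ball n e x i \<union> fresh_nbrs n e {} (bfs_ball n e x i)"

text \<open>The search moves inside \<open>F\<close> but avoids the whole unrestricted ball, so an
  element of layer \<open>i\<close> is at true distance \<open>i\<close> from
  \<open>x\<close>.\<close>

primrec bfs_layer :: "nat \<Rightarrow> nat set \<Rightarrow> edge_config \<Rightarrow> nat \<Rightarrow> nat \<Rightarrow> nat set" where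
  "bfs_layer n F e x 0 = {x}"
| "bfs_layer n F e x (Suc i) = F \<inter> fresh_nbrs n e (bfs_ball n e x i) (bfs_layer n F e x i)"

section \<open>Balls and walks as powers of the adjacency relation\<close>

definition adj_rel :: "nat \<Rightarrow> edge_config \<Rightarrow> nat rel" where
  "adj_rel n e = {(u, v). adj n e u v}"

lemma adj_rel_iff: "(u, v) \<in> adj_rel n e \<longleftrightarrow> adj n e u v"
  by (simp add: adj_rel_def)

lemma adj_sym: "adj n e u v \<longleftrightarrow> adj n e v u"
  by (auto simp: adj_def min.commute max.commute)

lemma adj_less: "adj n e u v \<Longrightarrow> u < n" "adj n e u v \<Longrightarrow> v < n"
  by (auto simp: adj_def)

lemma fresh_nbrs_subset: "fresh_nbrs n e B A \<subseteq> {..<n} - B"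
  by (auto simp: fresh_nbrs_def dest: adj_less)

lemma bfs_ball_mono: "i \<le> j \<Longrightarrow> bfs_ball n e x i \<subseteq> bfs_ball n e x j"
  by (induction j) (auto simp: le_Suc_eq)

lemma bfs_ball_subset: "x < n \<Longrightarrow> bfs_ball n e x i \<subseteq> {..<n}"
proof (induction i)
  case (Suc i)
  then show ?case using fresh_nbrs_subset[of n e "{}" "bfs_ball n e x i"] by auto
qed auto

lemma finite_bfs_ball: "finite (bfs_ball n e x i)"
proof (induction i)
  case (Suc i)
  have "finite (fresh_nbrs n e {} (bfs_ball n e x i))"
    by (rule finite_subset[OF fresh_nbrs_subset]) auto
  then show ?case using Suc by simp
qed simp

lemma self_in_bfs_ball: "x \<in> bfs_ball n e x i"
  by (induction i) auto

lemma bfs_layer_subset_ball: "bfs_layer n F e x i \<subseteq> bfs_ball n e x i"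
proof (induction i)
  case (Suc i)
  then have "fresh_nbrs n e B (bfs_layer n F e x i) \<subseteq> fresh_nbrs n e {} (bfs_ball n e x i)" for B
    unfolding fresh_nbrs_def by blast
  then show ?case by auto
qed simp

lemma bfs_layer_subset: "x < n \<Longrightarrow> bfs_layer n F e x i \<subseteq> {..<n}"
  using order_trans[OF bfs_layer_subset_ball bfs_ball_subset] .

text \<open>A vertex that enters the ball has a neighbour that itself entered one step earlier,
  hence lies in the last layer. With \<open>UNIV\<close> the layers are the true spheres, so ball
  volumes are bounded by sums of layer volumes.\<close>

lemma bfs_ball_Suc: "bfs_ball n e x (Suc i) = bfs_ball n e x i \<union> bfs_layer n UNIV e x (Suc i)"
proof (induction i)
  case (Suc i)
  have "y \<in> bfs_layer n UNIV e x (Suc (Suc i))"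
    if y: "y \<notin> bfs_ball n e x (Suc i)" and u: "u \<in> bfs_ball n e x (Suc i)" "adj n e u y" for u y
  proof -
    have "u \<notin> bfs_ball n e x i" using y u(2) by (auto simp: fresh_nbrs_def)
    then have "u \<in> bfs_layer n UNIV e x (Suc i)" using u(1) unfolding Suc.IH by blast
    then show ?thesis unfolding bfs_layer.simps(2)[of n UNIV e x "Suc i"] using y u(2)
      by (auto simp: fresh_nbrs_def)
  qed
  moreover have "bfs_layer n UNIV e x (Suc (Suc i)) \<subseteq> bfs_ball n e x (Suc (Suc i))"
    by (rule bfs_layer_subset_ball)
  ultimately show ?case unfolding bfs_ball.simps(2)[of n e x "Suc i"]
    by (auto simp: fresh_nbrs_def simp del: bfs_ball.simps bfs_layer.simps)
qed (auto simp: fresh_nbrs_def)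

lemma relpow_sym:
  assumes "sym R" "(x, y) \<in> R ^^ i" shows "(y, x) \<in> R ^^ i"
  using assms(2)
proof (induction i arbitrary: y)
  case (Suc i)
  then obtain z where "(x, z) \<in> R ^^ i" "(z, y) \<in> R" by auto
  then show ?case using Suc.IH assms(1) by (meson relpow_Suc_I2 symD)
qed auto

text \<open>In this form symmetry and the triangle inequality are reversal and composition of
  relational powers.\<close>

lemma in_bfs_ball_iff: "y \<in> bfs_ball n e x i \<longleftrightarrow> (\<exists>j\<le>i. (x, y) \<in> adj_rel n e ^^ j)"
proof (induction i arbitrary: y)
  case (Suc i)
  have "y \<in> bfs_ball n e x (Suc i) \<longleftrightarrow> y \<in> bfs_ball n e x i \<or> (\<exists>u\<in>bfs_ball n e x i. (u, y) \<in> adj_rel n e)"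
    by (simp add: fresh_nbrs_def adj_rel_iff)
  also have "\<dots> \<longleftrightarrow>
      (\<exists>j\<le>i. (x, y) \<in> adj_rel n e ^^ j) \<or> (\<exists>j\<le>i. (x, y) \<in> adj_rel n e ^^ Suc j)"
    unfolding Bex_def Suc.IH relpow.simps(2) relcomp_unfold by blast
  also have "\<dots> \<longleftrightarrow> (\<exists>j\<le>Suc i. (x, y) \<in> adj_rel n e ^^ j)" (is "?l \<longleftrightarrow> ?r")
  proof
    assume ?l then show ?r by (meson Suc_le_mono le_SucI)
  next
    assume ?r
    then obtain j where j: "j \<le> Suc i" "(x, y) \<in> adj_rel n e ^^ j" by blast
    show ?l
    proof (cases j)
      case 0 then show ?thesis using j by blast
    next
      case (Suc k) then show ?thesis using j by auto
    qed
  qed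
  finally show ?case .
qed auto

lemma sym_adj_rel: "sym (adj_rel n e)"
  by (auto simp: sym_def adj_rel_def adj_sym)

lemma bfs_ball_sym: "y \<in> bfs_ball n e x i \<longleftrightarrow> x \<in> bfs_ball n e y i"
  using relpow_sym[OF sym_adj_rel] unfolding in_bfs_ball_iff by metis

lemma bfs_ball_trans:
  assumes "y \<in> bfs_ball n e x i" "z \<in> bfs_ball n e y j"
  shows "z \<in> bfs_ball n e x (i + j)"
proof -
  obtain i' j' where "i' \<le> i" "(x, y) \<in> adj_rel n e ^^ i'" "j' \<le> j" "(y, z) \<in> adj_rel n e ^^ j'"
    using assms unfolding in_bfs_ball_iff by blast
  then have "i' + j' \<le> i + j \<and> (x, z) \<in> adj_rel n e ^^ (i' + j')"
    by (auto simp: relpow_add)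
  then show ?thesis unfolding in_bfs_ball_iff by blast
qed

lemma bfs_ball_adj: "adj n e u v \<Longrightarrow> v \<in> bfs_ball n e u 1"
  by (auto simp: fresh_nbrs_def)

section \<open>Graph distance in terms of balls\<close>

lemma is_walk_relpow:
  "(\<exists>xs. is_walk (adj n e) xs \<and> hd xs = x \<and> last xs = y \<and> length xs = Suc j) \<longleftrightarrow>
   (x, y) \<in> adj_rel n e ^^ j"
proof
  assume "\<exists>xs. is_walk (adj n e) xs \<and> hd xs = x \<and> last xs = y \<and> length xs = Suc j"
  then obtain xs where xs: "is_walk (adj n e) xs" "hd xs = x" "last xs = y" "length xs = Suc j" by blast
  then have "xs ! 0 = x \<and> xs ! j = y \<and> (\<forall>i<j. (xs ! i, xs ! Suc i) \<in> adj_rel n e)"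
    by (auto simp: is_walk_def adj_rel_def hd_conv_nth last_conv_nth)
  then show "(x, y) \<in> adj_rel n e ^^ j" unfolding relpow_fun_conv by blast
next
  assume "(x, y) \<in> adj_rel n e ^^ j"
  then obtain f where f: "f 0 = x" "f j = y" "\<forall>i<j. (f i, f (Suc i)) \<in> adj_rel n e"
    unfolding relpow_fun_conv by blast
  have nth: "map f [0..<Suc j] ! i = f i" if "i \<le> j" for i
    using that by (subst nth_map) (auto simp del: upt_Suc)
  have "is_walk (adj n e) (map f [0..<Suc j])" using f(3) unfolding is_walk_def adj_rel_def
    by (auto simp: nth simp del: upt_Suc)
  moreover have "hd (map f [0..<Suc j]) = x" "last (map f [0..<Suc j]) = y"
    using f nth[of 0] nth[of j] by (auto simp: hd_map simp del: upt_Suc) (auto simp: last_map)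
  ultimately show "\<exists>xs. is_walk (adj n e) xs \<and> hd xs = x \<and> last xs = y \<and> length xs = Suc j"
    by (intro exI[of _ "map f [0..<Suc j]"]) auto
qed

lemma gdist_le_iff: "gdist (adj n e) x y \<le> enat i \<longleftrightarrow> y \<in> bfs_ball n e x i"
proof -
  let ?W = "{xs. is_walk (adj n e) xs \<and> hd xs = x \<and> last xs = y}"
  have "gdist (adj n e) x y \<le> enat i \<longleftrightarrow> (\<exists>xs\<in>?W. length xs - 1 \<le> i)"
  proof
    assume le: "gdist (adj n e) x y \<le> enat i"
    \<comment> \<open>A strict bound is what allows a walk to be extracted from the infimum.\<close>
    then have "gdist (adj n e) x y < enat (Suc i)"
      by (meson enat_ord_simps(2) lessI order_le_less_trans)
    then obtain xs where "xs \<in> ?W" "enat (length xs - 1) < enat (Suc i)"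
      unfolding gdist_def INF_less_iff by blast
    then show "\<exists>xs\<in>?W. length xs - 1 \<le> i" by auto
  next
    assume "\<exists>xs\<in>?W. length xs - 1 \<le> i"
    then show "gdist (adj n e) x y \<le> enat i"
      unfolding gdist_def by (meson INF_lower2 enat_ord_simps(1))
  qed
  also have "\<dots> \<longleftrightarrow> (\<exists>j\<le>i. \<exists>xs. is_walk (adj n e) xs \<and> hd xs = x \<and> last xs = y \<and> length xs = Suc j)"
  proof
    assume "\<exists>xs\<in>?W. length xs - 1 \<le> i"
    then obtain xs where xs: "xs \<in> ?W" "length xs - 1 \<le> i" by blast
    then have "length xs = Suc (length xs - 1)" by (cases xs) (auto simp: is_walk_def)
    then show "\<exists>j\<le>i. \<exists>xs. is_walk (adj n e) xs \<and> hd xs = x \<and> last xs = y \<and> length xs = Suc j"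
      using xs by blast
  qed auto
  also have "\<dots> \<longleftrightarrow> y \<in> bfs_ball n e x i" unfolding is_walk_relpow in_bfs_ball_iff ..
  finally show ?thesis .
qed

lemma gdist_triangle: "gdist (adj n e) x z \<le> gdist (adj n e) x y + gdist (adj n e) y z"
proof (cases "gdist (adj n e) x y")
  case (enat i)
  show ?thesis
  proof (cases "gdist (adj n e) y z")
    case e2: (enat j)
    have "y \<in> bfs_ball n e x i" "z \<in> bfs_ball n e y j"
      using gdist_le_iff[of n e x y i] gdist_le_iff[of n e y z j] enat e2 by auto
    then show ?thesis using bfs_ball_trans gdist_le_iff[of n e x z "i + j"] enat e2 by auto
  qed auto
qed auto

lemma gdist_sym: "gdist (adj n e) x y = gdist (adj n e) y x"
proof (rule antisym)
  have "gdist (adj n e) x y \<le> gdist (adj n e) y x" for x y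
  proof (cases "gdist (adj n e) y x")
    case (enat i)
    then show ?thesis using gdist_le_iff[of n e x y i] gdist_le_iff[of n e y x i] bfs_ball_sym[of y n e x i]
      by auto
  qed auto
  then show "gdist (adj n e) x y \<le> gdist (adj n e) y x" "gdist (adj n e) y x \<le> gdist (adj n e) x y" by auto
qed

text \<open>Balls that pause for one step never grow again, so each radius up to \<open>i\<close>
  adds one of the \<open>n\<close> vertices. This leaves only \<open>n + 1\<close> possible
  distances, which makes the set of landmark labels finite.\<close>

lemma gdist_less:
  assumes x: "x < n" and g: "gdist (adj n e) x y = enat i"
  shows "i < n"
proof -
  have strict: "bfs_ball n e x j \<noteq> bfs_ball n e x (Suc j)" if "j < i" for j
  proof
    assume eq: "bfs_ball n e x j = bfs_ball n e x (Suc j)"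
    have "bfs_ball n e x (j + k) = bfs_ball n e x j" for k
    proof (induction k)
      case (Suc k)
      have "bfs_ball n e x (j + Suc k) = bfs_ball n e x (j + k) \<union> fresh_nbrs n e {} (bfs_ball n e x (j + k))"
        by simp
      also have "\<dots> = bfs_ball n e x (Suc j)" unfolding Suc.IH by simp
      finally show ?case unfolding eq[symmetric] .
    qed simp
    from this[of "i - j"] have "y \<in> bfs_ball n e x j"
      using that g gdist_le_iff[of n e x y i] by auto
    then show False using that g gdist_le_iff[of n e x y j] by auto
  qed
  have "j \<le> i \<Longrightarrow> Suc j \<le> card (bfs_ball n e x j)" for j
  proof (induction j)
    case (Suc j)
    have "bfs_ball n e x j \<subset> bfs_ball n e x (Suc j)"
      using strict[of j] bfs_ball_mono[of j "Suc j" n e x] Suc.prems by auto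
    then have "card (bfs_ball n e x j) < card (bfs_ball n e x (Suc j))"
      by (intro psubset_card_mono finite_bfs_ball)
    then show ?case using Suc by simp
  qed simp
  then have "Suc i \<le> card (bfs_ball n e x i)" by blast
  also have "\<dots> \<le> card {..<n}" by (intro card_mono bfs_ball_subset x) auto
  finally show ?thesis by simp
qed

text \<open>A search to depth \<open>Suc i\<close> only queries edges at vertices of the ball of
  radius \<open>i\<close>; the newest layer is seen from inside.\<close>

lemma bfs_agree:
  assumes "\<And>u v. u \<in> bfs_ball n e x i \<Longrightarrow> adj n e u v = adj n e' u v"
  shows "j \<le> Suc i \<Longrightarrow> bfs_ball n e' x j = bfs_ball n e x j \<and> bfs_layer n F e' x j = bfs_layer n F e x j"
proof (induction j)
  case (Suc j)
  then have ih: "bfs_ball n e' x j = bfs_ball n e x j" "bfs_layer n F e' x j = bfs_layer n F e x j" by auto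
  have ag: "adj n e' u v = adj n e u v" if "u \<in> bfs_ball n e x j" for u v
    using assms[of u v] bfs_ball_mono[of j i n e x] that Suc.prems by auto
  have "fresh_nbrs n e' {} (bfs_ball n e x j) = fresh_nbrs n e {} (bfs_ball n e x j)"
    using ag by (auto simp: fresh_nbrs_def)
  moreover have "fresh_nbrs n e' (bfs_ball n e x j) (bfs_layer n F e x j) =
      fresh_nbrs n e (bfs_ball n e x j) (bfs_layer n F e x j)"
    using ag bfs_layer_subset_ball[of n F e x j] unfolding fresh_nbrs_def by blast
  ultimately show ?case using ih by simp
qed simp

text \<open>The interior vertices of the path lie in \<open>F\<close>, its end only in \<open>H\<close>: for \<open>x \<in> H\<close> this makes
  the relation between \<open>x\<close> and the elements of its far layer symmetric.\<close>
definition far_layer :: "nat \<Rightarrow> nat set \<Rightarrow> nat set \<Rightarrow> edge_config \<Rightarrow> nat \<Rightarrow> nat \<Rightarrow> nat set" where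
  "far_layer n F H e x r = H \<inter> fresh_nbrs n e (bfs_ball n e x (r - 1)) (bfs_layer n F e x (r - 1))"

lemma far_layer_subset_ball: "0 < r \<Longrightarrow> far_layer n F H e x r \<subseteq> bfs_ball n e x r - bfs_ball n e x (r - 1)"
  using bfs_layer_subset_ball[of n F e x "r - 1"]
  by (cases r) (auto simp: far_layer_def fresh_nbrs_def)

text \<open>Avoidance of earlier balls is demanded of the last vertex only: a shortcut to an
  intermediate vertex would also be a shortcut to the end.\<close>

lemma in_bfs_layer_iff:
  "v \<in> bfs_layer n F e x i \<longleftrightarrow>
     (x, v) \<in> (adj_rel n e \<inter> UNIV \<times> F) ^^ i \<and> (\<forall>j<i. v \<notin> bfs_ball n e x j)"
proof (induction i arbitrary: v)
  case (Suc i)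
  show ?case
  proof
    assume v: "v \<in> bfs_layer n F e x (Suc i)"
    then obtain u where u: "u \<in> bfs_layer n F e x i" "adj n e u v" "v \<in> F" "v \<notin> bfs_ball n e x i"
      by (auto simp: fresh_nbrs_def)
    then have "(x, v) \<in> (adj_rel n e \<inter> UNIV \<times> F) ^^ Suc i"
      using Suc.IH by (auto simp: adj_rel_def)
    moreover have "\<forall>j<Suc i. v \<notin> bfs_ball n e x j"
      using u(4) bfs_ball_mono[of _ i n e x] less_Suc_eq_le by blast
    ultimately show "(x, v) \<in> (adj_rel n e \<inter> UNIV \<times> F) ^^ Suc i \<and> (\<forall>j<Suc i. v \<notin> bfs_ball n e x j)" by blast
  next
    assume a: "(x, v) \<in> (adj_rel n e \<inter> UNIV \<times> F) ^^ Suc i \<and> (\<forall>j<Suc i. v \<notin> bfs_ball n e x j)"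
    then obtain u where u: "(x, u) \<in> (adj_rel n e \<inter> UNIV \<times> F) ^^ i" "adj n e u v" "v \<in> F"
      by (auto simp: adj_rel_def)
    have "u \<notin> bfs_ball n e x j" if "j < i" for j
    proof
      assume "u \<in> bfs_ball n e x j"
      then have "v \<in> bfs_ball n e x (Suc j)" using u(2) by (auto simp: fresh_nbrs_def)
      then show False using a that by auto
    qed
    then have "u \<in> bfs_layer n F e x i" using Suc.IH u by blast
    then show "v \<in> bfs_layer n F e x (Suc i)" using a u by (auto simp: fresh_nbrs_def)
  qed
qed auto

text \<open>Both sides say that the inner vertices of a path of \<open>k + 1\<close> steps lie in
  \<open>F\<close>, once as targets and once as sources. Reversal exchanges the two
  descriptions.\<close>

lemma restricted_relpow_shift:
  "(R \<inter> UNIV \<times> F) ^^ k O R = R O (R \<inter> F \<times> UNIV) ^^ k"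
proof (induction k)
  case (Suc k)
  have "(R \<inter> UNIV \<times> F) ^^ Suc k O R = (R \<inter> UNIV \<times> F) O ((R \<inter> UNIV \<times> F) ^^ k O R)"
    by (metis O_assoc relpow.simps(2) relpow_commute)
  also have "\<dots> = ((R \<inter> UNIV \<times> F) O R) O (R \<inter> F \<times> UNIV) ^^ k"
    by (simp add: Suc.IH O_assoc)
  also have "(R \<inter> UNIV \<times> F) O R = R O (R \<inter> F \<times> UNIV)" by auto
  finally show ?case by (simp add: O_assoc relpow_commute)
qed auto

lemma converse_relpow_eq: "((R :: 'a rel) ^^ k)\<inverse> = (R\<inverse>) ^^ k"
  by (induction k) (simp_all add: converse_relcomp relpow_commute[symmetric])

lemma in_far_layer_iff:
  assumes "0 < r"
  shows "u \<in> far_layer n F H e x r \<longleftrightarrow> u \<in> H \<and> u \<notin> bfs_ball n e x (r - 1) \<and>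
    (x, u) \<in> (adj_rel n e \<inter> UNIV \<times> F) ^^ (r - 1) O adj_rel n e"
proof
  assume "u \<in> far_layer n F H e x r"
  then show "u \<in> H \<and> u \<notin> bfs_ball n e x (r - 1) \<and>
    (x, u) \<in> (adj_rel n e \<inter> UNIV \<times> F) ^^ (r - 1) O adj_rel n e"
    by (auto simp: far_layer_def fresh_nbrs_def in_bfs_layer_iff adj_rel_def)
next
  assume a: "u \<in> H \<and> u \<notin> bfs_ball n e x (r - 1) \<and>
    (x, u) \<in> (adj_rel n e \<inter> UNIV \<times> F) ^^ (r - 1) O adj_rel n e"
  then obtain v where v: "(x, v) \<in> (adj_rel n e \<inter> UNIV \<times> F) ^^ (r - 1)" "adj n e v u"
    by (auto simp: adj_rel_def)
  have "v \<notin> bfs_ball n e x j" if "j < r - 1" for j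
  proof
    assume "v \<in> bfs_ball n e x j"
    then have "u \<in> bfs_ball n e x (Suc j)" using v(2) by (auto simp: fresh_nbrs_def)
    then show False using a that bfs_ball_mono[of "Suc j" "r - 1" n e x] by auto
  qed
  then have "v \<in> bfs_layer n F e x (r - 1)" using v by (simp add: in_bfs_layer_iff)
  then show "u \<in> far_layer n F H e x r" using a v by (auto simp: far_layer_def fresh_nbrs_def)
qed

text \<open>Allows the pairs formed by a vertex and an element of its far layer to be counted from
  either end.\<close>

lemma far_layer_sym:
  assumes r: "0 < r" and xy: "x \<in> H" and u: "u \<in> far_layer n F H e x r"
  shows "x \<in> far_layer n F H e u r"
proof -
  let ?R = "adj_rel n e"
  have c: "?R\<inverse> = ?R" using sym_adj_rel by (simp add: sym_conv_converse_eq)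
  have "(u, x) \<in> ((?R \<inter> UNIV \<times> F) ^^ (r - 1) O ?R)\<inverse>"
    using u in_far_layer_iff[OF r] by blast
  also have "((?R \<inter> UNIV \<times> F) ^^ (r - 1) O ?R)\<inverse> = ?R O (?R \<inter> F \<times> UNIV) ^^ (r - 1)"
  proof -
    have "(?R \<inter> UNIV \<times> F)\<inverse> = ?R \<inter> F \<times> UNIV" using c by auto
    then show ?thesis using c by (simp add: converse_relcomp converse_relpow_eq)
  qed
  finally have "(u, x) \<in> (?R \<inter> UNIV \<times> F) ^^ (r - 1) O ?R" unfolding restricted_relpow_shift .
  then show ?thesis using xy u in_far_layer_iff[OF r] bfs_ball_sym by metis
qed

section \<open>One step of the exploration\<close>

definition touching_pairs :: "nat \<Rightarrow> nat set \<Rightarrow> (nat \<times> nat) set" where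
  "touching_pairs n X = {p \<in> vertex_pairs n. fst p \<in> X \<or> snd p \<in> X}"

definition cross_pairs :: "nat \<Rightarrow> nat set \<Rightarrow> nat set \<Rightarrow> (nat \<times> nat) set" where
  "cross_pairs n A C = {(min u v, max u v) | u v. u \<in> A \<and> v \<in> C \<and> u < n \<and> v < n \<and> u \<noteq> v}"

text \<open>The vertices whose edges have been queried when the ball and the layer of radius
  \<open>i\<close> are known. At radius 0 nothing has been queried, so truncated subtraction, which
  would give \<open>{x}\<close>, is not an option.\<close>

definition prev_ball :: "nat \<Rightarrow> edge_config \<Rightarrow> nat \<Rightarrow> nat \<Rightarrow> nat set" where
  "prev_ball n e x i = (case i of 0 \<Rightarrow> {} | Suc j \<Rightarrow> bfs_ball n e x j)"

lemma finite_vertex_pairs: "finite (vertex_pairs n)"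
  by (rule finite_subset[of _ "{..<n} \<times> {..<n}"]) (auto simp: vertex_pairs_def)

lemma touching_pairs_subset: "touching_pairs n X \<subseteq> vertex_pairs n"
  by (auto simp: touching_pairs_def)

lemma cross_pairs_subset: "cross_pairs n A C \<subseteq> vertex_pairs n"
  by (auto simp: cross_pairs_def vertex_pairs_def min_def max_def)

lemma cross_pairs_disjoint:
  "A \<inter> D = {} \<Longrightarrow> C \<inter> A = {} \<Longrightarrow> C \<inter> D = {} \<Longrightarrow> cross_pairs n A C \<inter> cross_pairs n A D = {}"
  by (auto simp: cross_pairs_def min_def max_def split: if_splits)

lemma cross_pairs_disjoint':
  "A \<inter> A' = {} \<Longrightarrow> A \<inter> C = {} \<Longrightarrow> A' \<inter> C = {} \<Longrightarrow> cross_pairs n A C \<inter> cross_pairs n A' C = {}"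
  by (auto simp: cross_pairs_def min_def max_def split: if_splits)

lemma cross_touching_disjoint:
  "X \<inter> A = {} \<Longrightarrow> X \<inter> C = {} \<Longrightarrow> touching_pairs n X \<inter> cross_pairs n A C = {}"
  by (auto simp: cross_pairs_def touching_pairs_def min_def max_def split: if_splits)

lemma adj_cong_touching:
  assumes "\<And>p. p \<in> touching_pairs n X \<Longrightarrow> e p = e' p" "u \<in> X"
  shows "adj n e u v = adj n e' u v"
proof (cases "u < n \<and> v < n \<and> u \<noteq> v")
  case True
  then have "(min u v, max u v) \<in> touching_pairs n X"
    using assms(2) by (auto simp: touching_pairs_def vertex_pairs_def min_def max_def)
  then show ?thesis using assms(1) by (simp add: adj_def)
qed (auto simp: adj_def)

lemma adj_cong_cross:
  assumes "\<And>p. p \<in> cross_pairs n A C \<Longrightarrow> e p = e' p" "u \<in> A" "v \<in> C"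
  shows "adj n e u v = adj n e' u v"
proof (cases "u < n \<and> v < n \<and> u \<noteq> v")
  case True
  then have "(min u v, max u v) \<in> cross_pairs n A C"
    using assms(2,3) by (auto simp: cross_pairs_def)
  then show ?thesis using assms(1) by (simp add: adj_def)
qed (auto simp: adj_def)

lemma prev_ball_subset: "prev_ball n e x i \<subseteq> bfs_ball n e x i"
  by (cases i) (auto simp: prev_ball_def)

lemma layer_prev_ball_disjoint: "bfs_layer n F e x i \<inter> prev_ball n e x i = {}"
  by (cases i) (auto simp: prev_ball_def fresh_nbrs_def)

text \<open>Since the event prescribes the previous ball, the set of queried pairs can be named in
  advance, although it is random.\<close>

lemma state_depends_only:
  "depends_only (touching_pairs n B0)
     (\<lambda>e. prev_ball n e x i = B0 \<and> bfs_ball n e x i = B \<and> bfs_layer n F e x i = A)"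
proof -
  have imp: "prev_ball n e' x i = B0 \<and> bfs_ball n e' x i = B \<and> bfs_layer n F e' x i = A"
    if ag: "\<And>p. p \<in> touching_pairs n B0 \<Longrightarrow> e p = e' p"
      and st: "prev_ball n e x i = B0 \<and> bfs_ball n e x i = B \<and> bfs_layer n F e x i = A" for e e'
  proof (cases i)
    case 0
    then show ?thesis using st by (auto simp: prev_ball_def)
  next
    case (Suc j)
    then have B0: "B0 = bfs_ball n e x j" using st by (simp add: prev_ball_def)
    have a: "adj n e u v = adj n e' u v" if "u \<in> bfs_ball n e x j" for u v
      by (rule adj_cong_touching[of n B0, OF ag]) (use that B0 in auto)
    have "bfs_ball n e' x j = bfs_ball n e x j" "bfs_ball n e' x (Suc j) = bfs_ball n e x (Suc j)"
      "bfs_layer n F e' x (Suc j) = bfs_layer n F e x (Suc j)"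
      using bfs_agree[of n e x j e', OF a] by (auto simp del: bfs_ball.simps bfs_layer.simps)
    then show ?thesis using st Suc by (simp add: prev_ball_def del: bfs_ball.simps bfs_layer.simps)
  qed
  show ?thesis unfolding depends_only_def
  proof (intro allI impI)
    fix e e' :: edge_config assume ag: "\<forall>p\<in>touching_pairs n B0. e p = e' p"
    show "(prev_ball n e x i = B0 \<and> bfs_ball n e x i = B \<and> bfs_layer n F e x i = A) =
      (prev_ball n e' x i = B0 \<and> bfs_ball n e' x i = B \<and> bfs_layer n F e' x i = A)"
      using imp[of e e'] imp[of e' e] ag by blast
  qed
qed

lemma fresh_nbrs_depends_only:
  "depends_only (cross_pairs n A ({..<n} - B)) (\<lambda>e. fresh_nbrs n e B A)"
  unfolding depends_only_def
proof (intro allI impI)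
  fix e e' :: edge_config assume ag: "\<forall>p\<in>cross_pairs n A ({..<n} - B). e p = e' p"
  have "adj n e u v = adj n e' u v" if "u \<in> A" "v \<notin> B" for u v
  proof (cases "v < n")
    case True
    show ?thesis by (rule adj_cong_cross[of n A "{..<n} - B"]) (use ag True that in auto)
  qed (auto simp: adj_def)
  then show "fresh_nbrs n e B A = fresh_nbrs n e' B A" unfolding fresh_nbrs_def by blast
qed

locale weighted_vertices =
  fixes n :: nat and w :: "nat \<Rightarrow> real"
  assumes n_pos: "0 < n" and w_pos: "\<And>x. x < n \<Longrightarrow> 0 < w x"
begin

definition W where "W = (\<Sum>x<n. w x)"
definition vol where "vol A = (\<Sum>x\<in>A. w x)"
definition p_edge where "p_edge u v = min (w u * w v / W) 1"
definition hits where "hits A y e \<longleftrightarrow> (\<exists>u\<in>A. adj n e u y)"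

abbreviation "\<G> \<equiv> rpl_edges n w"
abbreviation "\<E> \<equiv> measure_pmf.expectation \<G>"
abbreviation "prob\<^sub>G \<equiv> measure_pmf.prob \<G>"

definition hit_prob where "hit_prob A y = prob\<^sub>G {e. hits A y e}"

lemma W_pos: "0 < W"
  unfolding W_def using n_pos w_pos by (intro sum_pos) auto

lemma finite_\<G>: "finite (set_pmf \<G>)"
  unfolding rpl_edges_def by (rule finite_set_Pi_pmf_bool[OF finite_vertex_pairs])

lemma p_edge_range: "u < n \<Longrightarrow> v < n \<Longrightarrow> 0 \<le> p_edge u v \<and> p_edge u v \<le> 1"
  using W_pos w_pos[of u] w_pos[of v] by (auto simp: p_edge_def)

lemma p_edge_sym: "p_edge u v = p_edge v u"
  by (simp add: p_edge_def mult.commute)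

lemma \<G>_eq: "\<G> = Pi_pmf (vertex_pairs n) False (\<lambda>i. bernoulli_pmf (p_edge (fst i) (snd i)))"
  unfolding rpl_edges_def p_edge_def W_def by (simp add: case_prod_unfold)

lemma expectation_indep:
  fixes f g :: "edge_config \<Rightarrow> real"
  assumes "X \<subseteq> vertex_pairs n" "Y \<subseteq> vertex_pairs n" "X \<inter> Y = {}" "depends_only X f" "depends_only Y g"
  shows "\<E> (\<lambda>e. f e * g e) = \<E> f * \<E> g"
  unfolding \<G>_eq by (rule expectation_Pi_pmf_indep[OF finite_vertex_pairs assms])

lemma prob_adj:
  assumes "u < n" "v < n" "u \<noteq> v"
  shows "prob\<^sub>G {e. adj n e u v} = p_edge u v"
proof -
  define p where "p = (min u v, max u v)"
  have p: "p \<in> vertex_pairs n" using assms by (auto simp: p_def vertex_pairs_def min_def max_def)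
  have "prob\<^sub>G {e. adj n e u v} = measure_pmf.prob (map_pmf (\<lambda>e. e p) \<G>) {True}"
    using assms by (auto simp: adj_def p_def vimage_def)
  also have "map_pmf (\<lambda>e. e p) \<G> = bernoulli_pmf (p_edge (fst p) (snd p))"
    unfolding \<G>_eq using p by (simp add: Pi_pmf_component[OF finite_vertex_pairs])
  also have "measure_pmf.prob \<dots> {True} = p_edge (fst p) (snd p)"
    using assms p_edge_range[of "fst p" "snd p"] by (auto simp: measure_pmf_single p_def)
  also have "\<dots> = p_edge u v" by (auto simp: p_def min_def max_def p_edge_sym)
  finally show ?thesis .
qed

text \<open>The Markov property of the search. A value of the state is decided by pairs touching the
  previous ball, the next step by pairs between the layer \<open>A\<close> and the complement of
  \<open>B\<close>. The layer avoids the previous ball, so these sets of pairs are disjoint, and a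
  bound for fixed sets may be averaged over all states.\<close>

lemma step_expectation:
  fixes h :: "nat set \<Rightarrow> nat set \<Rightarrow> nat set \<Rightarrow> real"
  assumes x: "x < n"
    and bound: "\<And>B A. A \<subseteq> B \<Longrightarrow> B \<subseteq> {..<n} \<Longrightarrow> \<E> (\<lambda>e. h B A (fresh_nbrs n e B A)) \<le> b B A"
  shows "\<E> (\<lambda>e. h (bfs_ball n e x i) (bfs_layer n F e x i)
                   (fresh_nbrs n e (bfs_ball n e x i) (bfs_layer n F e x i)))
         \<le> \<E> (\<lambda>e. b (bfs_ball n e x i) (bfs_layer n F e x i))"
proof -
  define st where "st e = (prev_ball n e x i, bfs_ball n e x i, bfs_layer n F e x i)" for e
  define Z where "Z = st ` set_pmf \<G>"
  have finZ: "finite Z" unfolding Z_def using finite_\<G> by simp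
  have split: "\<E> f = (\<Sum>z\<in>Z. \<E> (\<lambda>e. of_bool (st e = z) * f e))" for f :: "edge_config \<Rightarrow> real"
  proof -
    have "\<E> f = \<E> (\<lambda>e. \<Sum>z\<in>Z. of_bool (st e = z) * f e)"
    proof (intro antisym expectation_mono_finite finite_\<G>)
      fix e assume e: "e \<in> set_pmf \<G>"
      have "(\<Sum>z\<in>Z. of_bool (st e = z) * f e) = (\<Sum>z\<in>Z. if z = st e then f e else 0)"
        by (intro sum.cong) auto
      also have "\<dots> = f e" using e finZ by (simp add: Z_def)
      finally have eq: "(\<Sum>z\<in>Z. of_bool (st e = z) * f e) = f e" .
      show "f e \<le> (\<Sum>z\<in>Z. of_bool (st e = z) * f e)" "(\<Sum>z\<in>Z. of_bool (st e = z) * f e) \<le> f e"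
        unfolding eq by auto
    qed
    then show ?thesis by (simp only: expectation_sum_finite[OF finite_\<G>])
  qed
  have one: "\<E> (\<lambda>e. of_bool (st e = z) * h (bfs_ball n e x i) (bfs_layer n F e x i)
                   (fresh_nbrs n e (bfs_ball n e x i) (bfs_layer n F e x i)))
      \<le> \<E> (\<lambda>e. of_bool (st e = z) * b (bfs_ball n e x i) (bfs_layer n F e x i))"
    if z: "z \<in> Z" for z
  proof -
    obtain B0 B A where zeq: "z = (B0, B, A)" by (cases z)
    obtain e0 where "st e0 = z" using z by (auto simp: Z_def)
    then have A: "A \<subseteq> B" "B \<subseteq> {..<n}" "A \<inter> B0 = {}" "B0 \<subseteq> B"
      using bfs_layer_subset_ball bfs_ball_subset[OF x] layer_prev_ball_disjoint prev_ball_subset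
      unfolding st_def zeq by blast+
    have dz: "depends_only (touching_pairs n B0) (\<lambda>e. of_bool (st e = z) :: real)"
      using depends_only_comp[OF state_depends_only[of n B0 x i B F A], of of_bool]
      unfolding st_def zeq prod.inject .
    have dn: "depends_only (cross_pairs n A ({..<n} - B)) (\<lambda>e. h B A (fresh_nbrs n e B A))"
      by (rule depends_only_comp[OF fresh_nbrs_depends_only])
    have disj: "touching_pairs n B0 \<inter> cross_pairs n A ({..<n} - B) = {}"
      using A by (intro cross_touching_disjoint) auto
    have "\<E> (\<lambda>e. of_bool (st e = z) * h (bfs_ball n e x i) (bfs_layer n F e x i)
                   (fresh_nbrs n e (bfs_ball n e x i) (bfs_layer n F e x i)))
        = \<E> (\<lambda>e. of_bool (st e = z) * h B A (fresh_nbrs n e B A))"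
      by (intro Bochner_Integration.integral_cong) (auto simp: st_def zeq)
    also have "\<dots> = \<E> (\<lambda>e. of_bool (st e = z)) * \<E> (\<lambda>e. h B A (fresh_nbrs n e B A))"
      by (rule expectation_indep[OF touching_pairs_subset cross_pairs_subset disj dz dn])
    also have "\<dots> \<le> \<E> (\<lambda>e. of_bool (st e = z)) * b B A"
      by (intro mult_left_mono bound A expectation_nonneg_pmf finite_\<G>) auto
    also have "\<dots> = \<E> (\<lambda>e. of_bool (st e = z) * b B A)" by simp
    also have "\<dots> = \<E> (\<lambda>e. of_bool (st e = z) * b (bfs_ball n e x i) (bfs_layer n F e x i))"
      by (intro Bochner_Integration.integral_cong) (auto simp: st_def zeq)
    finally show ?thesis .
  qed
  show ?thesis by (subst (1 2) split) (intro sum_mono one)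
qed

section \<open>Probability of having a neighbour in a given set\<close>

lemma hit_prob_range: "0 \<le> hit_prob A y" "hit_prob A y \<le> 1"
  by (auto simp: hit_prob_def)

lemma hit_prob_le:
  assumes "A \<subseteq> {..<n}" "y < n" "y \<notin> A"
  shows "hit_prob A y \<le> vol A * w y / W"
proof -
  have "finite A" using assms(1) finite_subset by blast
  then have "hit_prob A y \<le> (\<Sum>u\<in>A. prob\<^sub>G {e. adj n e u y})"
  proof -
    have "{e. hits A y e} = (\<Union>u\<in>A. {e. adj n e u y})" by (auto simp: hits_def)
    then show ?thesis unfolding hit_prob_def
      using measure_pmf.finite_measure_subadditive_finite[OF \<open>finite A\<close>, of "\<lambda>u. {e. adj n e u y}"]
      by simp
  qed
  also have "\<dots> \<le> (\<Sum>u\<in>A. w u * w y / W)"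
  proof (intro sum_mono)
    fix u assume "u \<in> A"
    then have "u < n" "u \<noteq> y" using assms by auto
    then show "prob\<^sub>G {e. adj n e u y} \<le> w u * w y / W"
      using prob_adj[of u y] assms(2) by (simp add: p_edge_def)
  qed
  also have "\<dots> = vol A * w y / W" by (simp add: vol_def sum_distrib_right sum_divide_distrib)
  finally show ?thesis .
qed

lemma hits_depends_only: "depends_only (cross_pairs n A {y}) (hits A y)"
  unfolding depends_only_def
proof (intro allI impI)
  fix e e' :: edge_config assume ag: "\<forall>p\<in>cross_pairs n A {y}. e p = e' p"
  have "adj n e u y = adj n e' u y" if "u \<in> A" for u
    by (rule adj_cong_cross[of n A "{y}"]) (use ag that in auto)
  then show "hits A y e = hits A y e'" unfolding hits_def by auto
qed

lemma no_hit_prob: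
  assumes "finite A" "A \<subseteq> {..<n}" "y < n" "y \<notin> A"
  shows "\<E> (\<lambda>e. of_bool (\<not> hits A y e)) = (\<Prod>u\<in>A. 1 - p_edge u y)"
  using assms
proof (induction A rule: finite_induct)
  case (insert u A)
  have d: "depends_only (cross_pairs n X {y}) (\<lambda>e. of_bool (\<not> hits X y e) :: real)" for X
    by (rule depends_only_comp[OF hits_depends_only])
  have "\<E> (\<lambda>e. of_bool (\<not> hits (insert u A) y e)) =
      \<E> (\<lambda>e. of_bool (\<not> hits {u} y e) * of_bool (\<not> hits A y e) :: real)"
    by (intro Bochner_Integration.integral_cong) (auto simp: hits_def)
  also have "\<dots> = \<E> (\<lambda>e. of_bool (\<not> hits {u} y e) :: real) * \<E> (\<lambda>e. of_bool (\<not> hits A y e) :: real)"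
    by (rule expectation_indep[OF cross_pairs_subset cross_pairs_subset _ d d])
       (use insert in \<open>intro cross_pairs_disjoint'; auto\<close>)
  also have "\<E> (\<lambda>e. of_bool (\<not> hits {u} y e)) = 1 - p_edge u y"
    using prob_adj[of u y] insert.prems
    unfolding prob_eq_expectation[symmetric] prob_compl_pmf by (auto simp: hits_def)
  finally show ?case using insert by simp
qed (simp add: hits_def)

text \<open>\<open>small\<close> makes the cut-off at 1 in \<open>p_edge\<close> harmless. The
  probability of no hit is then at most \<open>exp (- a)\<close>, and the hit probability is linear
  in \<open>a\<close> up to a quadratic error.\<close>

lemma hit_prob_ge:
  assumes A: "A \<subseteq> {..<n}" and y: "y < n" "y \<notin> A" and small: "\<And>u. u \<in> A \<Longrightarrow> w u * w y \<le> W"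
  shows "vol A * w y / W - (vol A * w y / W)\<^sup>2 \<le> hit_prob A y"
proof -
  define a where "a = vol A * w y / W"
  have fin: "finite A" using A finite_subset by blast
  have a0: "0 \<le> a" unfolding a_def vol_def using A y w_pos W_pos
    by (intro divide_nonneg_pos mult_nonneg_nonneg sum_nonneg) (auto simp: less_imp_le subset_iff)
  have "1 - hit_prob A y = (\<Prod>u\<in>A. 1 - p_edge u y)"
    using no_hit_prob[OF fin A y] unfolding prob_eq_expectation[symmetric] prob_compl_pmf hit_prob_def by simp
  also have "\<dots> \<le> (\<Prod>u\<in>A. exp (- (w u * w y / W)))"
  proof (intro prod_mono)
    fix u assume u: "u \<in> A"
    then have "p_edge u y = w u * w y / W" using small W_pos by (auto simp: p_edge_def)
    moreover have "p_edge u y \<le> 1" using p_edge_range u A y by blast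
    ultimately show "0 \<le> 1 - p_edge u y \<and> 1 - p_edge u y \<le> exp (- (w u * w y / W))"
      using exp_ge_add_one_self[of "- (w u * w y / W)"] by auto
  qed
  also have "\<dots> = exp (- a)"
    using fin by (simp add: exp_sum[symmetric] a_def vol_def sum_negf sum_distrib_right sum_divide_distrib)
  also have "\<dots> \<le> 1 / (1 + a)"
    using exp_ge_add_one_self[of a] a0 by (simp add: exp_minus inverse_eq_divide frac_le)
  also have "\<dots> \<le> 1 - a + a\<^sup>2"
  proof -
    \<comment> \<open>The product equals 1 + a^3.\<close>
    have "1 \<le> (1 - a + a\<^sup>2) * (1 + a)" using a0 by (simp add: algebra_simps power2_eq_square)
    then show ?thesis using a0 by (simp add: field_simps)
  qed
  finally show ?thesis unfolding a_def by simp
qed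

lemma hits_indep:
  assumes "y < n" "z < n" "y \<notin> A" "z \<notin> A" "y \<noteq> z"
  shows "\<E> (\<lambda>e. of_bool (hits A y e) * of_bool (hits A z e)) = hit_prob A y * hit_prob A z"
proof -
  have d: "depends_only (cross_pairs n A {y}) (\<lambda>e. of_bool (hits A y e) :: real)" for y
    by (rule depends_only_comp[OF hits_depends_only])
  have "\<E> (\<lambda>e. of_bool (hits A y e) * of_bool (hits A z e)) =
      \<E> (\<lambda>e. of_bool (hits A y e) :: real) * \<E> (\<lambda>e. of_bool (hits A z e) :: real)"
    by (rule expectation_indep[OF cross_pairs_subset cross_pairs_subset _ d d])
       (use assms in \<open>intro cross_pairs_disjoint; auto\<close>)
  then show ?thesis by (simp add: hit_prob_def prob_eq_expectation)
qed

definition hit_sum where "hit_sum f A C e = (\<Sum>y\<in>C. f y * of_bool (hits A y e))" for f :: "nat \<Rightarrow> real"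

lemma expectation_hit_sum: "\<E> (hit_sum f A C) = (\<Sum>y\<in>C. f y * hit_prob A y)"
  unfolding hit_sum_def expectation_sum_finite[OF finite_\<G>]
  by (simp add: hit_prob_def prob_eq_expectation)

text \<open>Hits of distinct vertices outside \<open>A\<close> use disjoint pairs and are
  independent, so only the diagonal exceeds the squared mean, and there the square of
  \<open>f y\<close> is at most \<open>M * f y\<close>.\<close>

lemma second_moment_hit_sum:
  assumes C: "C \<subseteq> {..<n}" "C \<inter> A = {}" and f: "\<And>y. y \<in> C \<Longrightarrow> 0 \<le> f y \<and> f y \<le> M"
  shows "\<E> (\<lambda>e. (hit_sum f A C e)\<^sup>2) \<le> (\<E> (hit_sum f A C))\<^sup>2 + M * \<E> (hit_sum f A C)"
proof -
  have finC: "finite C" using C finite_subset by blast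
  define q where "q = hit_prob A"
  have "\<E> (\<lambda>e. (hit_sum f A C e)\<^sup>2) =
      \<E> (\<lambda>e. \<Sum>y\<in>C. \<Sum>z\<in>C. f y * f z * (of_bool (hits A y e) * of_bool (hits A z e)))"
    unfolding hit_sum_def power2_eq_square sum_product by (simp add: mult_ac)
  also have "\<dots> = (\<Sum>y\<in>C. \<Sum>z\<in>C. f y * f z * \<E> (\<lambda>e. of_bool (hits A y e) * of_bool (hits A z e)))"
    by (simp add: expectation_sum_finite[OF finite_\<G>])
  also have "\<dots> \<le> (\<Sum>y\<in>C. \<Sum>z\<in>C. f y * f z * (q y * q z) + (if z = y then M * (f y * q y) else 0))"
  proof (intro sum_mono)
    fix y z assume yz: "y \<in> C" "z \<in> C"
    show "f y * f z * \<E> (\<lambda>e. of_bool (hits A y e) * of_bool (hits A z e))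
        \<le> f y * f z * (q y * q z) + (if z = y then M * (f y * q y) else 0)"
    proof (cases "z = y")
      case False
      then show ?thesis using hits_indep[of y z A] yz C by (auto simp: q_def disjoint_iff subset_iff)
    next
      case True
      have "(\<lambda>e. of_bool (hits A y e) * of_bool (hits A y e)) = (\<lambda>e. of_bool (hits A y e) :: real)"
        by auto
      then have "f y * f z * \<E> (\<lambda>e. of_bool (hits A y e) * of_bool (hits A z e)) = f y * (f y * q y)"
        using True by (simp add: q_def hit_prob_def prob_eq_expectation)
      also have "\<dots> \<le> M * (f y * q y)"
        using f[OF yz(1)] hit_prob_range[of A y] unfolding q_def by (intro mult_right_mono) auto
      also have "\<dots> \<le> f y * f z * (q y * q z) + M * (f y * q y)"
        using f yz hit_prob_range unfolding q_def by simp
      finally show ?thesis using True by simp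
    qed
  qed
  also have "\<dots> = (\<E> (hit_sum f A C))\<^sup>2 + M * \<E> (hit_sum f A C)"
    using finC by (simp add: expectation_hit_sum sum.distrib power2_eq_square sum_product sum_distrib_left
      q_def mult_ac)
  finally show ?thesis .
qed

lemma hit_sum_chebyshev:
  assumes C: "C \<subseteq> {..<n}" "C \<inter> A = {}" and f: "\<And>y. y \<in> C \<Longrightarrow> 0 \<le> f y \<and> f y \<le> M" and t: "0 < t"
  shows "prob\<^sub>G {e. hit_sum f A C e \<le> \<E> (hit_sum f A C) - t} \<le> M * \<E> (hit_sum f A C) / t\<^sup>2"
proof -
  let ?m = "\<E> (hit_sum f A C)"
  have int: "integrable (measure_pmf \<G>) g" for g :: "edge_config \<Rightarrow> real"
    by (rule integrable_measure_pmf_finite[OF finite_\<G>])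
  have "(\<lambda>e. (hit_sum f A C e - ?m)\<^sup>2) = (\<lambda>e. (hit_sum f A C e)\<^sup>2 - 2 * ?m * hit_sum f A C e + ?m\<^sup>2)"
    by (auto simp: power2_diff algebra_simps)
  then have "\<E> (\<lambda>e. (hit_sum f A C e - ?m)\<^sup>2) = \<E> (\<lambda>e. (hit_sum f A C e)\<^sup>2) - 2 * ?m * ?m + ?m\<^sup>2"
    using int by simp
  then have var: "\<E> (\<lambda>e. (hit_sum f A C e - ?m)\<^sup>2) \<le> M * ?m"
    using second_moment_hit_sum[OF C, of f M] f by (simp add: power2_eq_square)
  have "prob\<^sub>G {e. hit_sum f A C e \<le> ?m - t} \<le>
      prob\<^sub>G {e. t\<^sup>2 \<le> (hit_sum f A C e - ?m)\<^sup>2}"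
  proof (rule prob_mono_finite[OF finite_\<G>])
    fix e assume "hit_sum f A C e \<le> ?m - t"
    then have "t \<le> \<bar>hit_sum f A C e - ?m\<bar>" using t by auto
    then show "t\<^sup>2 \<le> (hit_sum f A C e - ?m)\<^sup>2" using t by (metis abs_le_square_iff abs_of_pos)
  qed
  also have "\<dots> \<le> M * ?m / t\<^sup>2"
    by (rule markov_pmf[OF finite_\<G> _ var]) (use t in auto)
  finally show ?thesis .
qed

lemma sum_fresh_nbrs:
  fixes f :: "nat \<Rightarrow> real"
  shows "(\<Sum>y\<in>F \<inter> fresh_nbrs n e B A. f y) = hit_sum f A (F \<inter> {..<n} - B) e"
proof -
  have eq: "F \<inter> fresh_nbrs n e B A = {y \<in> F \<inter> {..<n} - B. hits A y e}"
    using fresh_nbrs_subset[of n e B A] by (auto simp: fresh_nbrs_def hits_def)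
  have "finite (F \<inter> {..<n} - B)" by simp
  from sum.inter_filter[OF this, of f "\<lambda>y. hits A y e"] show ?thesis
    unfolding eq hit_sum_def by (simp add: of_bool_def if_distrib cong: if_cong)
qed

end

section \<open>Growth of balls\<close>

context weighted_vertices
begin

definition Q where "Q = (\<Sum>x<n. (w x)\<^sup>2)"
text \<open>The mean weight of a vertex drawn with probability proportional to its weight: the
  factor by which the volume of a layer grows on average.\<close>

definition \<mu> where "\<mu> = Q / W"
text \<open>The part of the size-biased mean of \<open>f\<close> that comes from
  \<open>F\<close>.\<close>

definition mass where "mass F f = (\<Sum>y\<in>F \<inter> {..<n}. f y * w y) / W" for f :: "nat \<Rightarrow> real"

lemma vol_nonneg: "A \<subseteq> {..<n} \<Longrightarrow> 0 \<le> vol A"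
  unfolding vol_def using w_pos by (intro sum_nonneg) (auto simp: less_imp_le subset_iff)

lemma vol_mono: "A \<subseteq> B \<Longrightarrow> B \<subseteq> {..<n} \<Longrightarrow> vol A \<le> vol B"
  unfolding vol_def using w_pos finite_subset[of B "{..<n}"]
  by (intro sum_mono2) (auto simp: less_imp_le subset_iff)

lemma vol_Un_le: "A \<subseteq> {..<n} \<Longrightarrow> B \<subseteq> {..<n} \<Longrightarrow> vol (A \<union> B) \<le> vol A + vol B"
  using sum_Un[of A B w] vol_nonneg[of "A \<inter> B"] finite_subset[of _ "{..<n}"]
  unfolding vol_def by fastforce

lemma Q_pos: "0 < Q"
  unfolding Q_def using n_pos w_pos by (intro sum_pos) (auto simp: less_imp_neq[symmetric])

lemma mass_UNIV_w: "mass UNIV w = \<mu>"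
  by (simp add: mass_def \<mu>_def Q_def power2_eq_square)

lemma mass_mono: "F \<subseteq> G \<Longrightarrow> (\<And>y. y < n \<Longrightarrow> 0 \<le> f y) \<Longrightarrow> mass F f \<le> mass G f"
  unfolding mass_def using w_pos W_pos
  by (intro divide_right_mono sum_mono2) (auto simp: less_imp_le)

lemma mass_one_le: "mass F (\<lambda>_. 1) \<le> 1"
proof -
  have "mass F (\<lambda>_. 1) \<le> mass UNIV (\<lambda>_. 1)" by (rule mass_mono) auto
  also have "\<dots> = 1" using W_pos by (simp add: mass_def W_def)
  finally show ?thesis .
qed

lemma mass_nonneg: "(\<And>y. y < n \<Longrightarrow> 0 \<le> f y) \<Longrightarrow> 0 \<le> mass F f"
  unfolding mass_def using w_pos W_pos
  by (intro divide_nonneg_pos sum_nonneg mult_nonneg_nonneg) (auto simp: less_imp_le)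

lemma \<mu>_pos: "0 < \<mu>"
  using Q_pos W_pos by (simp add: \<mu>_def)

lemma expectation_hit_sum_le:
  assumes A: "A \<subseteq> B" "B \<subseteq> {..<n}" and f: "\<And>y. y < n \<Longrightarrow> 0 \<le> f y"
  shows "\<E> (hit_sum f A (F \<inter> {..<n} - B)) \<le> vol A * mass F f"
proof -
  have "\<E> (hit_sum f A (F \<inter> {..<n} - B)) \<le> (\<Sum>y\<in>F \<inter> {..<n} - B. f y * (vol A * w y / W))"
    unfolding expectation_hit_sum using A f by (intro sum_mono mult_left_mono hit_prob_le) auto
  also have "\<dots> \<le> (\<Sum>y\<in>F \<inter> {..<n}. f y * (vol A * w y / W))"
    using A f w_pos W_pos
    by (intro sum_mono2) (auto intro!: mult_nonneg_nonneg divide_nonneg_pos vol_nonneg simp: less_imp_le)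
  also have "\<dots> = vol A * mass F f"
    by (simp add: mass_def sum_distrib_left sum_divide_distrib mult_ac)
  finally show ?thesis .
qed

lemma hit_sum_nonneg:
  assumes "C \<subseteq> {..<n}" "\<And>y. y < n \<Longrightarrow> 0 \<le> f y"
  shows "0 \<le> hit_sum f A C e"
  unfolding hit_sum_def using assms by (intro sum_nonneg) auto

lemma expectation_hit_sum_nonneg:
  assumes "C \<subseteq> {..<n}" "\<And>y. y < n \<Longrightarrow> 0 \<le> f y"
  shows "0 \<le> \<E> (hit_sum f A C)"
  using hit_sum_nonneg[OF assms] by (intro expectation_nonneg_pmf finite_\<G>) auto

lemma expectation_fresh_le:
  assumes x: "x < n" and f: "\<And>y. y < n \<Longrightarrow> 0 \<le> f y"
  shows "\<E> (\<lambda>e. \<Sum>y\<in>F \<inter> fresh_nbrs n e (bfs_ball n e x i) (bfs_layer n G e x i). f y)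
         \<le> \<E> (\<lambda>e. vol (bfs_layer n G e x i)) * mass F f"
proof -
  have "\<E> (\<lambda>e. \<Sum>y\<in>F \<inter> fresh_nbrs n e (bfs_ball n e x i) (bfs_layer n G e x i). f y)
     \<le> \<E> (\<lambda>e. vol (bfs_layer n G e x i) * mass F f)"
  proof (rule step_expectation[OF x, where h = "\<lambda>B A N. \<Sum>y\<in>F \<inter> N. f y" and b = "\<lambda>B A. vol A * mass F f"])
    fix B A :: "nat set" assume "A \<subseteq> B" "B \<subseteq> {..<n}"
    then show "\<E> (\<lambda>e. \<Sum>y\<in>F \<inter> fresh_nbrs n e B A. f y) \<le> vol A * mass F f"
      unfolding sum_fresh_nbrs using expectation_hit_sum_le f by blast
  qed
  then show ?thesis by simp
qed

text \<open>\<open>F\<close> and \<open>f\<close> are decoupled from the set \<open>G\<close>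
  confining the search. Volumes of the next layer take \<open>F = G\<close> and
  \<open>f = w\<close>; sizes of far layers take \<open>F = H\<close> and \<open>f\<close>
  constantly 1.\<close>

lemma expectation_fresh_square_le:
  assumes x: "x < n" and f: "\<And>y. y < n \<Longrightarrow> 0 \<le> f y" and M: "\<And>y. y < n \<Longrightarrow> y \<in> F \<Longrightarrow> f y \<le> M" "0 \<le> M"
  shows "\<E> (\<lambda>e. (\<Sum>y\<in>F \<inter> fresh_nbrs n e (bfs_ball n e x i) (bfs_layer n G e x i). f y)\<^sup>2)
         \<le> \<E> (\<lambda>e. (vol (bfs_layer n G e x i))\<^sup>2) * (mass F f)\<^sup>2
           + M * \<E> (\<lambda>e. vol (bfs_layer n G e x i)) * mass F f"
proof -
  have "\<E> (\<lambda>e. (\<Sum>y\<in>F \<inter> fresh_nbrs n e (bfs_ball n e x i) (bfs_layer n G e x i). f y)\<^sup>2)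
     \<le> \<E> (\<lambda>e. (vol (bfs_layer n G e x i) * mass F f)\<^sup>2 + M * (vol (bfs_layer n G e x i) * mass F f))"
  proof (rule step_expectation[OF x, where h = "\<lambda>B A N. (\<Sum>y\<in>F \<inter> N. f y)\<^sup>2"
        and b = "\<lambda>B A. (vol A * mass F f)\<^sup>2 + M * (vol A * mass F f)"])
    fix B A :: "nat set" assume A: "A \<subseteq> B" "B \<subseteq> {..<n}"
    let ?C = "F \<inter> {..<n} - B"
    have "\<E> (\<lambda>e. (hit_sum f A ?C e)\<^sup>2) \<le> (\<E> (hit_sum f A ?C))\<^sup>2 + M * \<E> (hit_sum f A ?C)"
      using A f M by (intro second_moment_hit_sum) auto
    also have "\<dots> \<le> (vol A * mass F f)\<^sup>2 + M * (vol A * mass F f)" using A f M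
      by (intro add_mono power_mono mult_left_mono expectation_hit_sum_le expectation_hit_sum_nonneg) auto
    finally show "\<E> (\<lambda>e. (\<Sum>y\<in>F \<inter> fresh_nbrs n e B A. f y)\<^sup>2) \<le> (vol A * mass F f)\<^sup>2 + M * (vol A * mass F f)"
      unfolding sum_fresh_nbrs .
  qed
  also have "\<dots> = \<E> (\<lambda>e. (vol (bfs_layer n G e x i))\<^sup>2) * (mass F f)\<^sup>2
           + M * \<E> (\<lambda>e. vol (bfs_layer n G e x i)) * mass F f"
    by (simp add: power_mult_distrib integrable_measure_pmf_finite[OF finite_\<G>])
  finally show ?thesis .
qed

lemma expectation_layer_le:
  assumes x: "x < n"
  shows "\<E> (\<lambda>e. vol (bfs_layer n F e x i)) \<le> w x * \<mu> ^ i"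
proof (induction i)
  case (Suc i)
  have "\<E> (\<lambda>e. vol (bfs_layer n F e x (Suc i))) \<le> \<E> (\<lambda>e. vol (bfs_layer n F e x i)) * mass F w"
    unfolding bfs_layer.simps(2) vol_def[of "F \<inter> _"]
    by (rule expectation_fresh_le[OF x]) (simp add: w_pos less_imp_le)
  also have "\<dots> \<le> (w x * \<mu> ^ i) * mass UNIV w" using x w_pos \<mu>_pos
    by (intro mult_mono Suc mass_mono mass_nonneg) (auto simp: less_imp_le)
  finally show ?case by (simp add: mass_UNIV_w mult_ac)
qed (simp add: vol_def)

text \<open>Each step multiplies the second moment by at most \<open>\<mu>\<^sup>2\<close> and adds
  a variance term at most \<open>K * w x * \<mu> ^ Suc i\<close>. Because \<mu> is at least 1 this
  is absorbed in the leading power, and relative to it \<open>i\<close> equal terms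
  accumulate.\<close>

lemma expectation_layer_square_le:
  assumes x: "x < n" and K: "\<And>y. y < n \<Longrightarrow> y \<in> F \<Longrightarrow> w y \<le> K" "0 \<le> K" and \<mu>1: "1 \<le> \<mu>"
  shows "\<E> (\<lambda>e. (vol (bfs_layer n F e x i))\<^sup>2) \<le> \<mu> ^ (2 * i) * ((w x)\<^sup>2 + real i * K * w x)"
proof (induction i)
  case (Suc i)
  have mF: "0 \<le> mass F w" "mass F w \<le> \<mu>"
    using mass_mono[of F UNIV w] mass_nonneg[of w F] w_pos by (auto simp: less_imp_le mass_UNIV_w)
  have "\<E> (\<lambda>e. (vol (bfs_layer n F e x (Suc i)))\<^sup>2) \<le> \<E> (\<lambda>e. (vol (bfs_layer n F e x i))\<^sup>2) * (mass F w)\<^sup>2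
       + K * \<E> (\<lambda>e. vol (bfs_layer n F e x i)) * mass F w"
    unfolding bfs_layer.simps(2) vol_def[of "F \<inter> _"]
    by (rule expectation_fresh_square_le[OF x]) (auto simp: w_pos less_imp_le K)
  also have "\<dots> \<le> (\<mu> ^ (2 * i) * ((w x)\<^sup>2 + real i * K * w x)) * \<mu>\<^sup>2 + K * (w x * \<mu> ^ i) * \<mu>"
    using mF K x w_pos[OF x] \<mu>_pos
    by (intro add_mono mult_mono Suc power_mono expectation_layer_le mult_nonneg_nonneg add_nonneg_nonneg
        expectation_nonneg_pmf finite_\<G> vol_nonneg bfs_layer_subset) auto
  also have "K * (w x * \<mu> ^ i) * \<mu> = K * w x * \<mu> ^ Suc i" by simp
  also have "\<dots> \<le> K * w x * \<mu> ^ (2 * Suc i)"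
    using \<mu>1 K w_pos[OF x] by (intro mult_left_mono power_increasing) auto
  finally show ?case by (simp add: algebra_simps power2_eq_square)
qed (simp add: vol_def)

text \<open>Each of the \<open>Suc i\<close> spheres is bounded by the estimate for the largest
  radius.\<close>

lemma expectation_ball_le:
  assumes x: "x < n" and \<mu>1: "1 \<le> \<mu>"
  shows "\<E> (\<lambda>e. vol (bfs_ball n e x i)) \<le> real (Suc i) * w x * \<mu> ^ i"
proof -
  have "\<E> (\<lambda>e. vol (bfs_ball n e x i)) \<le> \<E> (\<lambda>e. \<Sum>j\<le>i. vol (bfs_layer n UNIV e x j))"
  proof (intro expectation_mono_finite finite_\<G>)
    fix e
    show "vol (bfs_ball n e x i) \<le> (\<Sum>j\<le>i. vol (bfs_layer n UNIV e x j))"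
    proof (induction i)
      case (Suc i)
      have "vol (bfs_ball n e x (Suc i)) \<le> vol (bfs_ball n e x i) + vol (bfs_layer n UNIV e x (Suc i))"
        unfolding bfs_ball_Suc by (intro vol_Un_le bfs_ball_subset bfs_layer_subset x)
      then show ?case using Suc unfolding sum.atMost_Suc by linarith
    qed (simp add: vol_def)
  qed
  also have "\<dots> = (\<Sum>j\<le>i. \<E> (\<lambda>e. vol (bfs_layer n UNIV e x j)))"
    by (rule expectation_sum_finite[OF finite_\<G>])
  also have "\<dots> \<le> (\<Sum>j\<le>i. w x * \<mu> ^ i)" using \<mu>1 w_pos[OF x]
    by (intro sum_mono order_trans[OF expectation_layer_le[OF x]] mult_left_mono power_increasing) auto
  also have "\<dots> = real (Suc i) * w x * \<mu> ^ i" by simp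
  finally show ?thesis .
qed

end

text \<open>\<open>L\<close> is the scale of the starting weights, \<open>K\<close> the cap on the
  weights the search may pass through, \<open>V\<close> a volume that balls of radius
  \<open>r\<close> rarely exceed, \<eta> the relative loss per step. \<open>loss\<close> says that
  the cap and a removed ball of volume \<open>V\<close> cost at most a fraction \<eta> of the
  branching factor; \<open>half\<close> allows twice that in each of \<open>r\<close> steps, once
  for the mean and once for the fluctuation. \<open>VL\<close> keeps hit probabilities on
  \<open>H\<close> at half of their linear value or above, and \<open>VH\<close> prevents a ball
  from using up more than half of \<open>H\<close>.\<close>

locale growth_parameters = weighted_vertices +
  fixes K L V \<eta> :: real and r :: nat
  assumes \<mu>1: "1 \<le> \<mu>" and K1: "1 \<le> K" and L1: "1 \<le> L" and V_pos: "0 < V" and \<eta>_pos: "0 < \<eta>"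
    and r1: "1 \<le> r"
    and loss: "V * K / W + ((\<Sum>y | y < n \<and> K < w y. (w y)\<^sup>2) + K * V) / Q \<le> \<eta>"
    and half: "1 / 2 \<le> (1 - 2 * \<eta>) ^ r" and \<eta>_small: "\<eta> \<le> 1 / 4"
    and VL: "V * (2 * L) / W \<le> 1 / 2"
    and VH: "V / L \<le> real (card {x. x < n \<and> L \<le> w x \<and> w x \<le> 2 * L}) / 2"
begin

definition H where "H = {x. x < n \<and> L \<le> w x \<and> w x \<le> 2 * L}"
definition low where "low = {y. w y \<le> K}"
text \<open>Half of a lower bound for the expected size of a far layer: at least half of
  \<open>H\<close> is outside the ball, the last restricted layer has volume at least
  \<open>L * \<mu> ^ (r - 1) / 2\<close>, and each remaining vertex is hit with at least half of the
  linear probability.\<close>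

definition Rm where "Rm = real (card H) * L\<^sup>2 * \<mu> ^ (r - 1) / (16 * W)"

section \<open>Concentration of a single search step\<close>

lemma H_subset: "H \<subseteq> {..<n}" by (auto simp: H_def)
lemma finite_H: "finite H" using H_subset finite_subset by blast
lemma H_pos: "0 < real (card H)"
proof -
  have "0 < V / L" using V_pos L1 by simp
  then show ?thesis using VH unfolding H_def by linarith
qed

text \<open>As long as the explored volume stays below \<open>V\<close>, the quadratic error of
  \<open>hit_prob_ge\<close> is a relative loss of at most \<alpha>.\<close>

lemma hit_prob_ge':
  assumes A: "A \<subseteq> B" "B \<subseteq> {..<n}" and V: "vol B \<le> V" and y: "y < n" "y \<notin> B" "w y \<le> z"
    and \<alpha>: "V * z / W \<le> \<alpha>" "\<alpha> \<le> 1"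
  shows "vol A * w y / W * (1 - \<alpha>) \<le> hit_prob A y"
proof -
  define a where "a = vol A * w y / W"
  have wy: "0 < w y" using y w_pos by simp
  have vA: "0 \<le> vol A" "vol A \<le> V" using vol_nonneg[of A] vol_mono[of A B] A V by auto
  have "vol A * w y \<le> V * z" using vA wy y V_pos by (intro mult_mono) auto
  then have "a \<le> V * z / W" unfolding a_def using W_pos by (intro divide_right_mono) auto
  then have "a \<le> \<alpha>" using \<alpha> by simp
  moreover have a0: "0 \<le> a" unfolding a_def using vA wy W_pos by simp
  ultimately have "a * (1 - \<alpha>) \<le> a - a\<^sup>2"
    using mult_left_mono[of a \<alpha> a] by (simp add: algebra_simps power2_eq_square)
  moreover have "a - a\<^sup>2 \<le> hit_prob A y" unfolding a_def
  proof (rule hit_prob_ge)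
    fix u assume u: "u \<in> A"
    have "w u = vol {u}" by (simp add: vol_def)
    also have "\<dots> \<le> V" using vol_mono[of "{u}" B] u A V by auto
    finally have "w u * w y \<le> V * z" using wy y V_pos by (intro mult_mono) auto
    also have "\<dots> \<le> \<alpha> * W" using \<alpha>(1) W_pos by (simp add: field_simps)
    also have "\<dots> \<le> W" using \<alpha>(2) W_pos by simp
    finally show "w u * w y \<le> W" .
  qed (use A y in auto)
  ultimately show ?thesis unfolding a_def[symmetric] by linarith
qed

lemma expectation_low_hits:
  assumes A: "A \<subseteq> B" "B \<subseteq> {..<n}" and V: "vol B \<le> V"
  shows "(1 - \<eta>) * (vol A * \<mu>) \<le> \<E> (hit_sum w A (low \<inter> {..<n} - B))"
proof -
  define \<alpha> where "\<alpha> = V * K / W"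
  define T where "T = (\<Sum>y | y < n \<and> K < w y. (w y)\<^sup>2)"
  let ?C = "low \<inter> {..<n} - B"
  have T0: "0 \<le> T" unfolding T_def by (intro sum_nonneg) auto
  have \<alpha>0: "0 \<le> \<alpha>" using V_pos K1 W_pos by (simp add: \<alpha>_def)
  have TQ0: "0 \<le> (T + K * V) / Q" using T0 K1 V_pos Q_pos by simp
  have l: "\<alpha> + (T + K * V) / Q \<le> \<eta>" using loss by (simp add: \<alpha>_def T_def)
  have \<alpha>1: "\<alpha> \<le> 1" using l TQ0 \<eta>_small by linarith
  have vA: "0 \<le> vol A" "vol A \<le> V" using vol_nonneg[of A] vol_mono[of A B] A V by auto
  have q: "vol A * w y / W * (1 - \<alpha>) \<le> hit_prob A y" if y: "y \<in> ?C" for y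
    using y A V \<alpha>1 by (intro hit_prob_ge'[where z = K]) (auto simp: low_def \<alpha>_def)
  \<comment> \<open>Heavy vertices account for \<open>T\<close>; a light vertex inside the ball has
    squared weight at most \<open>K\<close> times its weight, so the ball removes at most
    \<open>K * V\<close>.\<close>
  have sq: "Q - T - K * V \<le> (\<Sum>y\<in>?C. (w y)\<^sup>2)"
  proof -
    have "Q = (\<Sum>y\<in>{y. y < n \<and> K < w y} \<union> ((low \<inter> B) \<inter> {..<n} \<union> ?C). (w y)\<^sup>2)"
      unfolding Q_def by (intro sum.cong) (auto simp: low_def)
    also have "\<dots> = T + (\<Sum>y\<in>(low \<inter> B) \<inter> {..<n} \<union> ?C. (w y)\<^sup>2)"
      unfolding T_def by (rule sum.union_disjoint) (auto simp: low_def)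
    also have "(\<Sum>y\<in>(low \<inter> B) \<inter> {..<n} \<union> ?C. (w y)\<^sup>2) = (\<Sum>y\<in>(low \<inter> B) \<inter> {..<n}. (w y)\<^sup>2) + (\<Sum>y\<in>?C. (w y)\<^sup>2)"
      by (rule sum.union_disjoint) auto
    also have "(\<Sum>y\<in>(low \<inter> B) \<inter> {..<n}. (w y)\<^sup>2) \<le> (\<Sum>y\<in>(low \<inter> B) \<inter> {..<n}. K * w y)"
      unfolding power2_eq_square using w_pos
      by (intro sum_mono mult_right_mono) (auto simp: low_def less_imp_le)
    also have "\<dots> = K * vol ((low \<inter> B) \<inter> {..<n})" by (simp add: vol_def sum_distrib_left)
    also have "\<dots> \<le> K * V"
    proof (rule mult_left_mono)
      show "vol ((low \<inter> B) \<inter> {..<n}) \<le> V"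
        by (rule order_trans[OF vol_mono V]) (use A in auto)
    qed (use K1 in simp)
    finally show ?thesis by simp
  qed
  have "(1 - \<eta>) * (vol A * \<mu>) \<le> ((1 - \<alpha>) * (1 - (T + K * V) / Q)) * (vol A * \<mu>)"
  proof (rule mult_right_mono)
    have "(1 - \<alpha>) * (1 - z) = 1 - \<alpha> - z + \<alpha> * z" for z by (simp add: algebra_simps)
    from this[of "(T + K * V) / Q"]
    have "(1 - \<alpha>) * (1 - (T + K * V) / Q) = 1 - \<alpha> - (T + K * V) / Q + \<alpha> * ((T + K * V) / Q)" .
    moreover have "0 \<le> \<alpha> * ((T + K * V) / Q)" using \<alpha>0 TQ0 by (intro mult_nonneg_nonneg)
    ultimately show "1 - \<eta> \<le> (1 - \<alpha>) * (1 - (T + K * V) / Q)" using l by linarith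
  qed (use vA \<mu>1 in simp)
  also have "\<dots> = (1 - \<alpha>) * (vol A / W) * (Q - T - K * V)"
    using Q_pos W_pos by (simp add: \<mu>_def field_simps)
  also have "\<dots> \<le> (1 - \<alpha>) * (vol A / W) * (\<Sum>y\<in>?C. (w y)\<^sup>2)"
    using sq vA W_pos \<alpha>1 by (intro mult_left_mono) auto
  also have "\<dots> = (\<Sum>y\<in>?C. w y * (vol A * w y / W * (1 - \<alpha>)))"
    by (simp add: sum_distrib_left power2_eq_square mult_ac)
  also have "\<dots> \<le> \<E> (hit_sum w A ?C)" unfolding expectation_hit_sum using q w_pos
    by (intro sum_mono mult_left_mono) (auto simp: less_imp_le)
  finally show ?thesis .
qed

text \<open>Chebyshev with variance at most \<open>K\<close> times the mean. One \<eta> pays for the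
  gap between the mean and \<open>\<mu> * vol A\<close>, the other for the deviation.\<close>

lemma low_step_fails:
  assumes A: "A \<subseteq> B" "B \<subseteq> {..<n}" and V: "vol B \<le> V" and v: "0 < v" "v \<le> vol A"
  shows "prob\<^sub>G {e. hit_sum w A (low \<inter> {..<n} - B) e \<le> (1 - 2 * \<eta>) * \<mu> * vol A} \<le> K / (\<eta>\<^sup>2 * v)"
proof -
  let ?C = "low \<inter> {..<n} - B" and ?t = "\<eta> * (vol A * \<mu>)"
  have t: "0 < ?t" using v \<mu>1 \<eta>_pos by simp
  have "prob\<^sub>G {e. hit_sum w A ?C e \<le> (1 - 2 * \<eta>) * \<mu> * vol A} \<le>
        prob\<^sub>G {e. hit_sum w A ?C e \<le> \<E> (hit_sum w A ?C) - ?t}"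
    using expectation_low_hits[OF A V]
    by (intro prob_mono_finite finite_\<G>) (auto simp: algebra_simps)
  also have "\<dots> \<le> K * \<E> (hit_sum w A ?C) / ?t\<^sup>2"
    using A w_pos t by (intro hit_sum_chebyshev) (auto simp: low_def less_imp_le)
  also have "\<dots> \<le> K * (vol A * \<mu>) / ?t\<^sup>2"
  proof -
    have "\<E> (hit_sum w A ?C) \<le> vol A * mass low w"
      using A w_pos by (intro expectation_hit_sum_le) (auto simp: less_imp_le)
    also have "\<dots> \<le> vol A * \<mu>" unfolding mass_UNIV_w[symmetric]
      using v w_pos by (intro mult_left_mono mass_mono) (auto simp: less_imp_le)
    finally show ?thesis using K1 by (intro divide_right_mono mult_left_mono) auto
  qed
  also have "\<dots> = K / (\<eta>\<^sup>2 * (vol A * \<mu>))"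
    using v \<mu>1 \<eta>_pos by (simp add: power2_eq_square field_simps)
  also have "\<dots> \<le> K / (\<eta>\<^sup>2 * v)"
  proof -
    have "v * 1 \<le> vol A * \<mu>" using v \<mu>1 by (intro mult_mono) auto
    then show ?thesis using K1 \<eta>_pos v by (intro divide_left_mono mult_left_mono) auto
  qed
  finally show ?thesis .
qed

lemma half_power: "i \<le> r \<Longrightarrow> 1 / 2 \<le> (1 - 2 * \<eta>) ^ i"
  using half \<eta>_small \<eta>_pos power_decreasing[of i r "1 - 2 * \<eta>"] by linarith

definition big_layer where
  "big_layer x i e \<longleftrightarrow> (1 - 2 * \<eta>) ^ i * \<mu> ^ i * w x \<le> vol (bfs_layer n low e x i)"

text \<open>At the first failure the previous layer is still big, hence of volume at least
  \<open>w x / 2\<close> by \<open>half_power\<close>, and \<open>low_step_fails\<close> applies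
  with that volume; the failures of the steps add up. The cap on the ball is kept inside the event
  because conditioning on it would destroy independence.\<close>

lemma big_layer_fails:
  assumes x: "x < n"
  shows "i \<le> r \<Longrightarrow> prob\<^sub>G {e. vol (bfs_ball n e x i) \<le> V \<and> \<not> big_layer x i e}
          \<le> real i * (2 * K / (\<eta>\<^sup>2 * w x))"
proof (induction i)
  case (Suc i)
  let ?h = "\<lambda>B A N. of_bool (vol B \<le> V \<and> w x / 2 \<le> vol A \<and> vol (low \<inter> N) \<le> (1 - 2 * \<eta>) * \<mu> * vol A) :: real"
  let ?Bad = "\<lambda>e. vol (bfs_ball n e x i) \<le> V \<and> w x / 2 \<le> vol (bfs_layer n low e x i) \<and>
      vol (bfs_layer n low e x (Suc i)) \<le> (1 - 2 * \<eta>) * \<mu> * vol (bfs_layer n low e x i)"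
  have wx: "0 < w x" using w_pos[OF x] .
  have "prob\<^sub>G {e. ?Bad e} \<le> \<E> (\<lambda>e. 2 * K / (\<eta>\<^sup>2 * w x))"
    unfolding prob_eq_expectation bfs_layer.simps(2)
  proof (rule step_expectation[OF x, where h = ?h and b = "\<lambda>B A. 2 * K / (\<eta>\<^sup>2 * w x)"])
    fix B A :: "nat set" assume A: "A \<subseteq> B" "B \<subseteq> {..<n}"
    show "\<E> (\<lambda>e. ?h B A (fresh_nbrs n e B A)) \<le> 2 * K / (\<eta>\<^sup>2 * w x)"
    proof (cases "vol B \<le> V \<and> w x / 2 \<le> vol A")
      case True
      then have "\<E> (\<lambda>e. ?h B A (fresh_nbrs n e B A)) =
        prob\<^sub>G {e. hit_sum w A (low \<inter> {..<n} - B) e \<le> (1 - 2 * \<eta>) * \<mu> * vol A}"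
        unfolding prob_eq_expectation by (simp add: vol_def[of "low \<inter> _"] sum_fresh_nbrs)
      also have "\<dots> \<le> K / (\<eta>\<^sup>2 * (w x / 2))"
        using True A wx by (intro low_step_fails) auto
      finally show ?thesis by (simp add: mult_ac)
    next
      case False
      then have z: "?h B A (fresh_nbrs n e B A) = 0" for e by auto
      show ?thesis unfolding z using K1 wx by simp
    qed
  qed
  then have bad: "prob\<^sub>G {e. ?Bad e} \<le> 2 * K / (\<eta>\<^sup>2 * w x)" by simp
  have "prob\<^sub>G {e. vol (bfs_ball n e x (Suc i)) \<le> V \<and> \<not> big_layer x (Suc i) e}
     \<le> prob\<^sub>G {e. (vol (bfs_ball n e x i) \<le> V \<and> \<not> big_layer x i e) \<or> ?Bad e}"
  proof (rule prob_mono_finite[OF finite_\<G>])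
    fix e assume e: "vol (bfs_ball n e x (Suc i)) \<le> V \<and> \<not> big_layer x (Suc i) e"
    have vb: "vol (bfs_ball n e x i) \<le> V"
      using vol_mono[OF bfs_ball_mono[of i "Suc i" n e x] bfs_ball_subset[OF x]] e by simp
    have "?Bad e" if b: "big_layer x i e"
    proof -
      let ?v = "vol (bfs_layer n low e x i)"
      have p: "1 / 2 \<le> (1 - 2 * \<eta>) ^ i" using half_power Suc.prems by auto
      have "w x / 2 = (1 / 2) * 1 * w x" by simp
      also have "\<dots> \<le> (1 - 2 * \<eta>) ^ i * \<mu> ^ i * w x"
        using p \<mu>1 wx one_le_power[OF \<mu>1] by (intro mult_right_mono mult_mono) auto
      finally have "w x / 2 \<le> ?v" using b by (simp add: big_layer_def)
      moreover have "vol (bfs_layer n low e x (Suc i)) < (1 - 2 * \<eta>) ^ Suc i * \<mu> ^ Suc i * w x"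
        using e by (simp add: big_layer_def)
      moreover have "(1 - 2 * \<eta>) ^ Suc i * \<mu> ^ Suc i * w x \<le> (1 - 2 * \<eta>) * \<mu> * ?v"
      proof -
        have "(1 - 2 * \<eta>) * \<mu> * ((1 - 2 * \<eta>) ^ i * \<mu> ^ i * w x) \<le> (1 - 2 * \<eta>) * \<mu> * ?v"
          using b \<eta>_small \<mu>1 unfolding big_layer_def by (intro mult_left_mono) auto
        then show ?thesis by (simp add: mult_ac)
      qed
      ultimately show ?thesis using vb by linarith
    qed
    then show "(vol (bfs_ball n e x i) \<le> V \<and> \<not> big_layer x i e) \<or> ?Bad e" using vb by blast
  qed
  also have "\<dots> \<le> prob\<^sub>G {e. vol (bfs_ball n e x i) \<le> V \<and> \<not> big_layer x i e}
      + prob\<^sub>G {e. ?Bad e}"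
    by (rule prob_union_pmf)
  also have "\<dots> \<le> real i * (2 * K / (\<eta>\<^sup>2 * w x)) + 2 * K / (\<eta>\<^sup>2 * w x)"
    using Suc bad by simp
  also have "\<dots> = real (Suc i) * (2 * K / (\<eta>\<^sup>2 * w x))" by (simp only: of_nat_Suc distrib_right mult_1_left add.commute)
  finally show ?case .
qed (simp add: big_layer_def vol_def)

lemma Rm_pos: "0 < Rm"
  using H_pos L1 \<mu>1 W_pos by (simp add: Rm_def)

text \<open>The last step counts vertices of \<open>H\<close> instead of volume, so every summand is
  at most 1 and the variance at most the mean, which is at least \<open>2 * Rm\<close>.\<close>

lemma last_step_fails:
  assumes A: "A \<subseteq> B" "B \<subseteq> {..<n}" and V: "vol B \<le> V" and v: "L * \<mu> ^ (r - 1) / 2 \<le> vol A"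
  shows "prob\<^sub>G {e. hit_sum (\<lambda>_. 1) A (H \<inter> {..<n} - B) e \<le> Rm} \<le> 2 / Rm"
proof -
  let ?C = "H \<inter> {..<n} - B"
  let ?m = "\<E> (hit_sum (\<lambda>_. 1) A ?C)"
  have vA: "0 \<le> vol A" "vol A \<le> V" using vol_nonneg[of A] vol_mono[of A B] A V by auto
  have q: "vol A * L / (2 * W) \<le> hit_prob A y" if y: "y \<in> ?C" for y
  proof -
    have wy: "L \<le> w y" "w y \<le> 2 * L" using y by (auto simp: H_def)
    have "vol A * L / (2 * W) = vol A * L / W * (1 - 1 / 2)" by simp
    also have "\<dots> \<le> vol A * w y / W * (1 - 1 / 2)"
      using wy vA W_pos by (intro mult_right_mono divide_right_mono mult_left_mono) auto
    also have "\<dots> \<le> hit_prob A y"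
      using y wy A V VL by (intro hit_prob_ge'[where z = "2 * L"]) auto
    finally show ?thesis .
  qed
  have cC: "real (card H) / 2 \<le> real (card ?C)"
  proof -
    have finB: "finite B" using A finite_subset by blast
    have "L * real (card (H \<inter> B)) \<le> vol (H \<inter> B)"
      unfolding vol_def using sum_bounded_below[of "H \<inter> B" L w] by (auto simp: H_def mult.commute)
    also have "\<dots> \<le> V" using vol_mono[of "H \<inter> B" B] A V by auto
    finally have "real (card (H \<inter> B)) \<le> V / L" using L1 by (simp add: field_simps)
    also have "\<dots> \<le> real (card H) / 2" using VH by (simp add: H_def)
    finally have "real (card (H \<inter> B)) \<le> real (card H) / 2" .
    moreover have "card H = card (H \<inter> B) + card ?C"
    proof -
      have "H = (H \<inter> B) \<union> ?C" using H_subset by auto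
      then show ?thesis using finB finite_H by (metis card_Un_disjoint Diff_disjoint Int_commute
            finite_Diff finite_Int inf_assoc inf_bot_right)
    qed
    ultimately show ?thesis by simp
  qed
  have m: "2 * Rm \<le> ?m"
  proof -
    have "2 * Rm = (real (card H) / 2) * ((L * \<mu> ^ (r - 1) / 2) * L / (2 * W))"
      using W_pos by (simp add: Rm_def field_simps power2_eq_square)
    also have "\<dots> \<le> real (card ?C) * (vol A * L / (2 * W))"
      using cC v L1 W_pos \<mu>1 by (intro mult_mono divide_right_mono mult_right_mono) auto
    also have "\<dots> = (\<Sum>y\<in>?C. 1 * (vol A * L / (2 * W)))" by simp
    also have "\<dots> \<le> ?m"
      unfolding expectation_hit_sum using q by (intro sum_mono mult_left_mono) auto
    finally show ?thesis .
  qed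
  have m0: "0 < ?m" using m Rm_pos by linarith
  have "prob\<^sub>G {e. hit_sum (\<lambda>_. 1) A ?C e \<le> Rm} \<le>
        prob\<^sub>G {e. hit_sum (\<lambda>_. 1) A ?C e \<le> ?m - ?m / 2}"
    using m by (intro prob_mono_finite finite_\<G>) auto
  also have "\<dots> \<le> 1 * ?m / (?m / 2)\<^sup>2" using A m0 by (intro hit_sum_chebyshev) auto
  also have "\<dots> = 4 / ?m" using m0 by (simp add: power2_eq_square field_simps)
  also have "\<dots> \<le> 4 / (2 * Rm)" using m m0 Rm_pos by (intro divide_left_mono) auto
  finally show ?thesis by simp
qed

section \<open>Typical vertices and moments of far layers\<close>

definition far where "far e x = far_layer n low H e x r"

lemma card_far: "real (card (far e x)) =
    (\<Sum>y\<in>H \<inter> fresh_nbrs n e (bfs_ball n e x (r - 1)) (bfs_layer n low e x (r - 1)). 1)"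
  by (simp add: far_def far_layer_def)

definition typical where
  "typical e x \<longleftrightarrow> vol (bfs_ball n e x r) \<le> V \<and> Rm \<le> real (card (far e x))"

text \<open>In this order: Markov's inequality for the volume of the ball, the failures of the
  search steps, the failure of the last step.\<close>

definition fail_bound where
  "fail_bound = 2 * L * real (Suc r) * \<mu> ^ r / V + real r * (2 * K / (\<eta>\<^sup>2 * L)) + 2 / Rm"

lemma typical_fails:
  assumes x: "x \<in> H"
  shows "prob\<^sub>G {e. \<not> typical e x} \<le> fail_bound"
proof -
  have xn: "x < n" and wx: "L \<le> w x" "w x \<le> 2 * L" using x by (auto simp: H_def)
  let ?v0 = "L * \<mu> ^ (r - 1) / 2"
  let ?E1 = "\<lambda>e. V \<le> vol (bfs_ball n e x r)"
  let ?E2 = "\<lambda>e. vol (bfs_ball n e x (r - 1)) \<le> V \<and> \<not> big_layer x (r - 1) e"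
  let ?E3 = "\<lambda>e. vol (bfs_ball n e x (r - 1)) \<le> V \<and> ?v0 \<le> vol (bfs_layer n low e x (r - 1)) \<and> real (card (far e x)) \<le> Rm"
  have nn: "0 \<le> vol (bfs_ball n e x r)" for e by (rule vol_nonneg[OF bfs_ball_subset[OF xn]])
  have "prob\<^sub>G {e. ?E1 e} \<le> real (Suc r) * w x * \<mu> ^ r / V"
    by (rule markov_pmf[OF finite_\<G> nn expectation_ball_le[OF xn \<mu>1] V_pos])
  also have "\<dots> \<le> 2 * L * real (Suc r) * \<mu> ^ r / V"
  proof -
    have "real (Suc r) * \<mu> ^ r * w x \<le> real (Suc r) * \<mu> ^ r * (2 * L)"
      using wx \<mu>1 by (intro mult_left_mono) auto
    then have "real (Suc r) * w x * \<mu> ^ r \<le> 2 * L * real (Suc r) * \<mu> ^ r" by (simp only: mult_ac)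
    then show ?thesis using V_pos by (intro divide_right_mono) auto
  qed
  finally have e1: "prob\<^sub>G {e. ?E1 e} \<le> 2 * L * real (Suc r) * \<mu> ^ r / V" .
  have "prob\<^sub>G {e. ?E2 e} \<le> real (r - 1) * (2 * K / (\<eta>\<^sup>2 * w x))"
    by (rule big_layer_fails[OF xn]) simp
  also have "\<dots> \<le> real r * (2 * K / (\<eta>\<^sup>2 * L))"
    using K1 L1 wx \<eta>_pos by (intro mult_mono divide_left_mono mult_left_mono) auto
  finally have e2: "prob\<^sub>G {e. ?E2 e} \<le> real r * (2 * K / (\<eta>\<^sup>2 * L))" .
  have "prob\<^sub>G {e. ?E3 e} \<le> \<E> (\<lambda>e. 2 / Rm)"
    unfolding prob_eq_expectation card_far
  proof (rule step_expectation[OF xn, where h = "\<lambda>B A N. of_bool (vol B \<le> V \<and> ?v0 \<le> vol A \<and> (\<Sum>y\<in>H \<inter> N. 1) \<le> Rm)"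
        and b = "\<lambda>B A. 2 / Rm"])
    fix B A :: "nat set" assume A: "A \<subseteq> B" "B \<subseteq> {..<n}"
    show "\<E> (\<lambda>e. of_bool (vol B \<le> V \<and> ?v0 \<le> vol A \<and> (\<Sum>y\<in>H \<inter> fresh_nbrs n e B A. 1) \<le> Rm)) \<le> 2 / Rm"
    proof (cases "vol B \<le> V \<and> ?v0 \<le> vol A")
      case True
      then have "\<E> (\<lambda>e. of_bool (vol B \<le> V \<and> ?v0 \<le> vol A \<and> (\<Sum>y\<in>H \<inter> fresh_nbrs n e B A. 1) \<le> Rm)) =
        prob\<^sub>G {e. hit_sum (\<lambda>_. 1) A (H \<inter> {..<n} - B) e \<le> Rm}"
        unfolding prob_eq_expectation sum_fresh_nbrs by simp
      also have "\<dots> \<le> 2 / Rm" using True A by (intro last_step_fails) auto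
      finally show ?thesis .
    next
      case False
      then have z: "of_bool (vol B \<le> V \<and> ?v0 \<le> vol A \<and> (\<Sum>y\<in>H \<inter> fresh_nbrs n e B A. 1) \<le> Rm) = (0::real)" for e by auto
      show ?thesis unfolding z using Rm_pos by simp
    qed
  qed
  then have e3: "prob\<^sub>G {e. ?E3 e} \<le> 2 / Rm" by simp
  have "prob\<^sub>G {e. \<not> typical e x} \<le> prob\<^sub>G {e. ?E1 e \<or> (?E2 e \<or> ?E3 e)}"
  proof (rule prob_mono_finite[OF finite_\<G>])
    fix e assume e: "\<not> typical e x"
    show "?E1 e \<or> (?E2 e \<or> ?E3 e)"
    proof (rule ccontr)
      assume c: "\<not> ?thesis"
      then have vr: "vol (bfs_ball n e x r) \<le> V" by simp
      then have vr1: "vol (bfs_ball n e x (r - 1)) \<le> V"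
        using vol_mono[OF bfs_ball_mono[of "r - 1" r n e x] bfs_ball_subset[OF xn]] by simp
      then have "big_layer x (r - 1) e" using c by blast
      then have "(1 - 2 * \<eta>) ^ (r - 1) * \<mu> ^ (r - 1) * w x \<le> vol (bfs_layer n low e x (r - 1))"
        by (simp add: big_layer_def)
      moreover have "(1 / 2) * \<mu> ^ (r - 1) * L \<le> (1 - 2 * \<eta>) ^ (r - 1) * \<mu> ^ (r - 1) * w x"
        using half_power[of "r - 1"] \<mu>1 wx L1 \<eta>_small by (intro mult_mono mult_right_mono) auto
      ultimately have "?v0 \<le> vol (bfs_layer n low e x (r - 1))" by (simp add: mult_ac)
      then have "Rm \<le> real (card (far e x))" using c vr1 by auto
      then show False using e vr by (simp add: typical_def)
    qed
  qed
  also have "\<dots> \<le> prob\<^sub>G {e. ?E1 e} + prob\<^sub>G {e. ?E2 e \<or> ?E3 e}"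
    by (rule prob_union_pmf)
  also have "\<dots> \<le> prob\<^sub>G {e. ?E1 e} + (prob\<^sub>G {e. ?E2 e} + prob\<^sub>G {e. ?E3 e})"
    by (intro add_left_mono prob_union_pmf)
  also have "\<dots> \<le> fail_bound" using e1 e2 e3 by (simp add: fail_bound_def)
  finally show ?thesis .
qed

definition far_sq where
  "far_sq = \<mu> ^ (2 * (r - 1)) * (4 * L\<^sup>2 + real r * K * (2 * L)) + 2 * L * \<mu> ^ (r - 1)"

text \<open>Needed to bound what is lost when vertices with an exceptionally large far layer are
  discarded. \<open>far_sq\<close> exceeds \<open>Rm\<close> squared only by polylogarithmic factors
  for the parameters chosen later.\<close>

lemma expectation_far_square:
  assumes x: "x \<in> H"
  shows "\<E> (\<lambda>e. (real (card (far e x)))\<^sup>2) \<le> far_sq"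
proof -
  have xn: "x < n" and wx: "0 < w x" "w x \<le> 2 * L" using x w_pos by (auto simp: H_def)
  let ?v = "\<lambda>e. vol (bfs_layer n low e x (r - 1))"
  have m: "0 \<le> mass H (\<lambda>_. 1)" "mass H (\<lambda>_. 1) \<le> 1" using mass_nonneg mass_one_le by auto
  have v0: "0 \<le> ?v e" for e by (rule vol_nonneg[OF bfs_layer_subset[OF xn]])
  have E0: "0 \<le> \<E> ?v" "0 \<le> \<E> (\<lambda>e. (?v e)\<^sup>2)"
    using v0 by (auto intro!: expectation_nonneg_pmf finite_\<G>)
  have "\<E> (\<lambda>e. (real (card (far e x)))\<^sup>2) \<le> \<E> (\<lambda>e. (?v e)\<^sup>2) * (mass H (\<lambda>_. 1))\<^sup>2
           + 1 * \<E> ?v * mass H (\<lambda>_. 1)"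
    unfolding card_far by (rule expectation_fresh_square_le[OF xn]) auto
  also have "\<dots> \<le> \<E> (\<lambda>e. (?v e)\<^sup>2) * 1 + 1 * \<E> ?v * 1"
    using m E0 by (intro add_mono mult_left_mono power_le_one) auto
  also have "\<dots> \<le> \<mu> ^ (2 * (r - 1)) * ((w x)\<^sup>2 + real (r - 1) * K * w x) + w x * \<mu> ^ (r - 1)"
    using expectation_layer_square_le[OF xn, of low K "r - 1"] expectation_layer_le[OF xn, of low "r - 1"] K1 \<mu>1
    by (simp add: low_def)
  also have "\<dots> \<le> far_sq"
  proof -
    have "(w x)\<^sup>2 \<le> (2 * L)\<^sup>2" using wx by (intro power_mono) auto
    moreover have "real (r - 1) * K * w x \<le> real r * K * (2 * L)"
      using wx K1 L1 by (intro mult_mono) auto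
    moreover have "w x * \<mu> ^ (r - 1) \<le> 2 * L * \<mu> ^ (r - 1)"
      using wx \<mu>1 by (intro mult_right_mono) auto
    ultimately show ?thesis unfolding far_sq_def using \<mu>1
      by (intro add_mono mult_left_mono) (auto simp: power_mult_distrib)
  qed
  finally show ?thesis .
qed

lemma card_ball_H_le: "L * real (card (bfs_ball n e x i \<inter> H)) \<le> vol (bfs_ball n e x i)" if "x < n"
proof -
  have "L * real (card (bfs_ball n e x i \<inter> H)) \<le> vol (bfs_ball n e x i \<inter> H)"
    unfolding vol_def using sum_bounded_below[of "bfs_ball n e x i \<inter> H" L w] by (auto simp: H_def mult.commute)
  also have "\<dots> \<le> vol (bfs_ball n e x i)" by (intro vol_mono bfs_ball_subset that) auto
  finally show ?thesis .
qed

lemma expectation_card_ball: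
  assumes x: "x \<in> H"
  shows "\<E> (\<lambda>e. real (card (bfs_ball n e x i \<inter> H))) \<le> 2 * real (Suc i) * \<mu> ^ i"
proof -
  have xn: "x < n" and wx: "0 < w x" "w x \<le> 2 * L" using x w_pos by (auto simp: H_def)
  have "L * \<E> (\<lambda>e. real (card (bfs_ball n e x i \<inter> H))) = \<E> (\<lambda>e. L * real (card (bfs_ball n e x i \<inter> H)))"
    by simp
  also have "\<dots> \<le> \<E> (\<lambda>e. vol (bfs_ball n e x i))"
    by (intro expectation_mono_finite finite_\<G> card_ball_H_le xn)
  also have "\<dots> \<le> real (Suc i) * w x * \<mu> ^ i" by (rule expectation_ball_le[OF xn \<mu>1])
  also have "\<dots> \<le> real (Suc i) * (2 * L) * \<mu> ^ i"
    using wx \<mu>1 by (intro mult_right_mono mult_left_mono) auto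
  finally have "L * \<E> (\<lambda>e. real (card (bfs_ball n e x i \<inter> H))) \<le> L * (2 * real (Suc i) * \<mu> ^ i)"
    by (simp add: mult_ac)
  then show ?thesis using L1 by simp
qed

text \<open>Expected number of vertices of \<open>H\<close> within distance
  \<open>2 * r + 1\<close>, the range within which two owners may have an edge between private
  vertices without contradicting their distance.\<close>

definition close_bound where "close_bound = 2 * real (Suc (2 * r + 1)) * \<mu> ^ (2 * r + 1)"

text \<open>Only averages over \<open>H\<close> are controlled; \<Lambda> is the slack that Markov's
  inequality turns into a failure probability.\<close>

definition regular where
  "regular \<Lambda> e \<longleftrightarrow> real (card H) / 2 \<le> real (card {u \<in> H. typical e u}) \<and>
     (\<Sum>x\<in>H. (real (card (far e x)))\<^sup>2) \<le> \<Lambda> * (real (card H) * far_sq) \<and>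
     (\<Sum>x\<in>H. real (card (bfs_ball n e x (2 * r + 1) \<inter> H))) \<le> \<Lambda> * (real (card H) * close_bound)"

lemma regular_fails:
  assumes \<Lambda>: "0 < \<Lambda>"
  shows "prob\<^sub>G {e. \<not> regular \<Lambda> e} \<le> 2 * fail_bound + 2 / \<Lambda>"
proof -
  let ?h = "real (card H)"
  let ?E1 = "\<lambda>e. ?h / 2 \<le> (\<Sum>u\<in>H. of_bool (\<not> typical e u))"
  let ?E2 = "\<lambda>e. \<Lambda> * (?h * far_sq) \<le> (\<Sum>x\<in>H. (real (card (far e x)))\<^sup>2)"
  let ?E3 = "\<lambda>e. \<Lambda> * (?h * close_bound) \<le> (\<Sum>x\<in>H. real (card (bfs_ball n e x (2 * r + 1) \<inter> H)))"
  have fs: "0 < far_sq" unfolding far_sq_def using \<mu>1 L1 K1 by (intro add_nonneg_pos) auto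
  have cb: "0 < close_bound" unfolding close_bound_def using \<mu>1 by simp
  have "\<E> (\<lambda>e. \<Sum>u\<in>H. of_bool (\<not> typical e u)) \<le> (\<Sum>u\<in>H. fail_bound)"
    unfolding expectation_sum_finite[OF finite_\<G>]
    by (intro sum_mono) (use typical_fails prob_eq_expectation in metis)
  then have "prob\<^sub>G {e. ?E1 e} \<le> (\<Sum>u\<in>H. fail_bound) / (?h / 2)"
    using H_pos by (intro markov_pmf finite_\<G> sum_nonneg) auto
  then have e1: "prob\<^sub>G {e. ?E1 e} \<le> 2 * fail_bound" using H_pos by (simp add: field_simps)
  have "\<E> (\<lambda>e. \<Sum>x\<in>H. (real (card (far e x)))\<^sup>2) \<le> (\<Sum>x\<in>H. far_sq)"
    unfolding expectation_sum_finite[OF finite_\<G>] by (intro sum_mono expectation_far_square)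
  then have "prob\<^sub>G {e. ?E2 e} \<le> (\<Sum>x\<in>H. far_sq) / (\<Lambda> * (?h * far_sq))"
    using H_pos \<Lambda> fs by (intro markov_pmf finite_\<G> sum_nonneg) auto
  then have e2: "prob\<^sub>G {e. ?E2 e} \<le> 1 / \<Lambda>" using H_pos fs \<Lambda> by (simp add: field_simps)
  have "\<E> (\<lambda>e. \<Sum>x\<in>H. real (card (bfs_ball n e x (2 * r + 1) \<inter> H))) \<le> (\<Sum>x\<in>H. close_bound)"
    unfolding expectation_sum_finite[OF finite_\<G>] close_bound_def by (intro sum_mono expectation_card_ball)
  then have "prob\<^sub>G {e. ?E3 e} \<le> (\<Sum>x\<in>H. close_bound) / (\<Lambda> * (?h * close_bound))"
    using H_pos \<Lambda> cb by (intro markov_pmf finite_\<G> sum_nonneg) auto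
  then have e3: "prob\<^sub>G {e. ?E3 e} \<le> 1 / \<Lambda>" using H_pos cb \<Lambda> by (simp add: field_simps)
  have "prob\<^sub>G {e. \<not> regular \<Lambda> e} \<le> prob\<^sub>G {e. ?E1 e \<or> (?E2 e \<or> ?E3 e)}"
  proof (rule prob_mono_finite[OF finite_\<G>])
    fix e assume e: "\<not> regular \<Lambda> e"
    have "card H = card {u \<in> H. typical e u} + card {u \<in> H. \<not> typical e u}"
      using finite_H by (subst card_Un_disjoint[symmetric]) (auto intro: arg_cong[of _ _ card])
    moreover have "(\<Sum>u\<in>H. of_bool (\<not> typical e u)) = real (card {u \<in> H. \<not> typical e u})"
      using finite_H by (simp add: of_bool_def sum.If_cases Int_def)
    ultimately show "?E1 e \<or> (?E2 e \<or> ?E3 e)" using e unfolding regular_def by linarith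
  qed
  also have "\<dots> \<le> prob\<^sub>G {e. ?E1 e} + prob\<^sub>G {e. ?E2 e \<or> ?E3 e}"
    by (rule prob_union_pmf)
  also have "\<dots> \<le> prob\<^sub>G {e. ?E1 e} + (prob\<^sub>G {e. ?E2 e} + prob\<^sub>G {e. ?E3 e})"
    by (intro add_left_mono prob_union_pmf)
  finally show ?thesis using e1 e2 e3 by simp
qed

end

section \<open>Min-entropy of the distances\<close>

text \<open>If the label split off has length \<open>j\<close>, the induction hypothesis leaves a
  factor 2^(M - j) beyond A^M. The geometric sum over \<open>j\<close> is at most 2^(M + 1), so each
  element of \<open>S\<close> costs one more factor 2.\<close>

lemma card_weighted_labelings:
  fixes len :: "'l \<Rightarrow> nat"
  assumes S: "finite S" and Lab: "\<And>j. finite {l \<in> Lab. len l = j}" "\<And>j. card {l \<in> Lab. len l = j} \<le> A ^ j"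
    and A: "1 \<le> A"
  shows "finite {f \<in> S \<rightarrow>\<^sub>E Lab. (\<Sum>x\<in>S. len (f x)) \<le> M} \<and>
    card {f \<in> S \<rightarrow>\<^sub>E Lab. (\<Sum>x\<in>S. len (f x)) \<le> M} \<le> (2 * A) ^ M * 2 ^ card S"
  using S
proof (induction S arbitrary: M rule: finite_induct)
  case empty
  have "{f \<in> {} \<rightarrow>\<^sub>E Lab. (\<Sum>x\<in>{}. len (f x)) \<le> M} = {\<lambda>_. undefined}" by auto
  then show ?case using A by simp
next
  case (insert s S)
  let ?F = "\<lambda>S M. {f \<in> S \<rightarrow>\<^sub>E Lab. (\<Sum>x\<in>S. len (f x)) \<le> M}"
  let ?Lj = "\<lambda>j. {l \<in> Lab. len l = j}"
  let ?g = "\<lambda>(l, f). f(s := l)"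
  have sub: "?F (insert s S) M \<subseteq> (\<Union>j\<le>M. ?g ` (?Lj j \<times> ?F S (M - j)))"
  proof
    fix f assume f: "f \<in> ?F (insert s S) M"
    then have sum: "len (f s) + (\<Sum>x\<in>S. len (f x)) \<le> M" using insert by simp
    define f' where "f' = restrict f S"
    have "f' \<in> S \<rightarrow>\<^sub>E Lab" using f by (auto simp: f'_def)
    moreover have "(\<Sum>x\<in>S. len (f' x)) = (\<Sum>x\<in>S. len (f x))" by (intro sum.cong) (auto simp: f'_def)
    ultimately have "(f s, f') \<in> ?Lj (len (f s)) \<times> ?F S (M - len (f s))" using f sum by auto
    moreover have "f = ?g (f s, f')"
      using f by (auto simp: f'_def fun_eq_iff PiE_def extensional_def)
    ultimately have "f \<in> ?g ` (?Lj (len (f s)) \<times> ?F S (M - len (f s)))" by blast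
    moreover have "len (f s) \<le> M" using sum by simp
    ultimately show "f \<in> (\<Union>j\<le>M. ?g ` (?Lj j \<times> ?F S (M - j)))" by blast
  qed
  have fin: "finite (?g ` (?Lj j \<times> ?F S (M - j)))" for j
    using Lab(1) insert.IH by (intro finite_imageI finite_cartesian_product) auto
  have finU: "finite (\<Union>j\<le>M. ?g ` (?Lj j \<times> ?F S (M - j)))" using fin by blast
  have "card (?F (insert s S) M) \<le> card (\<Union>j\<le>M. ?g ` (?Lj j \<times> ?F S (M - j)))"
    by (rule card_mono[OF finU sub])
  also have "\<dots> \<le> (\<Sum>j\<le>M. card (?g ` (?Lj j \<times> ?F S (M - j))))" by (rule card_UN_le) simp
  also have "\<dots> \<le> (\<Sum>j\<le>M. A ^ j * ((2 * A) ^ (M - j) * 2 ^ card S))"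
  proof (rule sum_mono)
    fix j
    have "card (?g ` (?Lj j \<times> ?F S (M - j))) \<le> card (?Lj j \<times> ?F S (M - j))"
      using Lab(1) insert.IH by (intro card_image_le finite_cartesian_product) auto
    also have "\<dots> \<le> A ^ j * ((2 * A) ^ (M - j) * 2 ^ card S)"
      unfolding card_cartesian_product using Lab(2) insert.IH by (intro mult_le_mono) auto
    finally show "card (?g ` (?Lj j \<times> ?F S (M - j))) \<le> A ^ j * ((2 * A) ^ (M - j) * 2 ^ card S)" .
  qed
  also have "\<dots> = A ^ M * 2 ^ card S * (\<Sum>j\<le>M. 2 ^ (M - j))" unfolding sum_distrib_left
    by (intro sum.cong refl) (simp add: power_mult_distrib power_add[symmetric] mult_ac)
  also have "(\<Sum>j\<le>M. 2 ^ (M - j)) = (\<Sum>j\<le>M. 2 ^ j :: nat)"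
    by (rule sum.reindex_bij_witness[of _ "\<lambda>j. M - j" "\<lambda>j. M - j"]) auto
  also have "\<dots> \<le> 2 ^ Suc M" by (induction M) auto
  finally have "card (?F (insert s S) M) \<le> A ^ M * 2 ^ card S * 2 ^ Suc M" by simp
  also have "\<dots> = (2 * A) ^ M * 2 ^ card (insert s S)"
    using insert by (simp add: power_mult_distrib)
  finally show ?case using finite_subset[OF sub finU] by simp
qed

context growth_parameters
begin

text \<open>A vertex whose far layer has more than \<open>R\<close> elements gets no private
  vertices at all. This caps what one close pair of owners can spoil.\<close>

definition priv where
  "priv R e S x = (if real (card (far e x)) \<le> R
     then {u \<in> far e x. \<forall>y\<in>S. y \<noteq> x \<longrightarrow> u \<notin> bfs_ball n e y r} else {})"

text \<open>The distances are a parameter \<open>d\<close> and not read off from \<open>e\<close>: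
  for prescribed \<open>d\<close> the set depends on \<open>e\<close> through the searches only,
  which yields the invariance required by \<open>prob_all_absent_le\<close>.\<close>

definition split_pairs where
  "split_pairs R e S d = {p \<in> vertex_pairs n. \<exists>x\<in>S. \<exists>y\<in>S. x \<noteq> y \<and> fst p \<in> priv R e S x \<and> snd p \<in> priv R e S y
     \<and> enat (2 * r + 1) < d x y}" for d :: "nat \<Rightarrow> nat \<Rightarrow> enat"

abbreviation "dist_of e \<equiv> gdist (adj n e)"

lemma far_subset: "far e x \<subseteq> H" "far e x \<subseteq> bfs_ball n e x r - bfs_ball n e x (r - 1)"
  using far_layer_subset_ball[of r n low H e x] r1 by (auto simp: far_def far_layer_def)

lemma finite_far: "finite (far e x)" using far_subset(1) finite_H finite_subset by blast

lemma far_sym: "x \<in> H \<Longrightarrow> u \<in> far e x \<Longrightarrow> x \<in> far e u"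
  using far_layer_sym[of r x H u n low e] r1 by (simp add: far_def)

lemma priv_subset: "priv R e S x \<subseteq> far e x" by (auto simp: priv_def)

lemma priv_not_interior:
  assumes "u \<in> priv R e S x" "z \<in> S"
  shows "u \<notin> bfs_ball n e z (r - 1)"
proof (cases "z = x")
  case True then show ?thesis using assms priv_subset far_subset by blast
next
  case False
  then have "u \<notin> bfs_ball n e z r" using assms by (auto simp: priv_def split: if_splits)
  then show ?thesis using bfs_ball_mono[of "r - 1" r n e z] by auto
qed

text \<open>Private vertices lie outside the ball of radius \<open>r - 1\<close> around every
  element of \<open>S\<close>, and the searches to radius \<open>r\<close> query only edges at
  vertices of those balls. So changing edges between private vertices leaves the searches, and with
  them the set, unchanged.\<close>

lemma split_pairs_inv:
  assumes agree: "\<And>p. p \<notin> split_pairs R e S d \<Longrightarrow> e' p = e p"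
  shows "split_pairs R e' S d = split_pairs R e S d"
proof -
  have a: "adj n e u v = adj n e' u v" if z: "z \<in> S" and u: "u \<in> bfs_ball n e z (r - 1)" for z u v
  proof -
    have "fst p \<notin> bfs_ball n e z (r - 1) \<and> snd p \<notin> bfs_ball n e z (r - 1)"
      if "p \<in> split_pairs R e S d" for p
      using that priv_not_interior z unfolding split_pairs_def by blast
    from this[of "(min u v, max u v)"] u have "(min u v, max u v) \<notin> split_pairs R e S d"
      by (auto simp: min_def max_def split: if_splits)
    then show ?thesis using agree by (simp add: adj_def)
  qed
  have balls: "bfs_ball n e' z r = bfs_ball n e z r" "far e' z = far e z" if z: "z \<in> S" for z
  proof -
    note ag = bfs_agree[of n e z "r - 1" e', OF a[OF z]]
    show "bfs_ball n e' z r = bfs_ball n e z r" using ag[of r] by auto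
    have "bfs_ball n e' z (r - 1) = bfs_ball n e z (r - 1)" "bfs_layer n low e' z (r - 1) = bfs_layer n low e z (r - 1)"
      using ag[of "r - 1" low] by auto
    moreover have "fresh_nbrs n e' (bfs_ball n e z (r - 1)) (bfs_layer n low e z (r - 1)) =
        fresh_nbrs n e (bfs_ball n e z (r - 1)) (bfs_layer n low e z (r - 1))"
      using a[OF z] bfs_layer_subset_ball[of n low e z "r - 1"] unfolding fresh_nbrs_def by blast
    ultimately show "far e' z = far e z" by (simp add: far_def far_layer_def)
  qed
  have "priv R e' S x = priv R e S x" if "x \<in> S" for x using balls that by (auto simp: priv_def)
  then show ?thesis unfolding split_pairs_def by auto
qed

text \<open>Such an edge would complete a walk of length \<open>r + 1 + r\<close> between the two
  owners.\<close>

lemma split_pairs_absent: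
  assumes "S \<subseteq> H" "p \<in> split_pairs R e S (dist_of e)"
  shows "\<not> e p"
proof
  assume e: "e p"
  obtain u v x y where p: "p = (u, v)" "(u, v) \<in> vertex_pairs n" and xy: "x \<in> S" "y \<in> S"
    "u \<in> priv R e S x" "v \<in> priv R e S y" "enat (2 * r + 1) < dist_of e x y"
    using assms(2) unfolding split_pairs_def by (cases p) auto
  have "adj n e u v" using p e by (auto simp: adj_def vertex_pairs_def min_def max_def)
  then have 1: "v \<in> bfs_ball n e u 1" by (rule bfs_ball_adj)
  have 2: "u \<in> bfs_ball n e x r" "v \<in> bfs_ball n e y r" using xy priv_subset far_subset by blast+
  have "y \<in> bfs_ball n e x (r + 1 + r)"
    using bfs_ball_trans[OF bfs_ball_trans[OF 2(1) 1]] 2(2) bfs_ball_sym by blast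
  then have "dist_of e x y \<le> enat (2 * r + 1)" unfolding gdist_le_iff by (simp add: mult_2)
  then show False using xy by simp
qed

text \<open>On this event \<open>d\<close> may replace the true distances, and then all pairs of a
  self-determined set are absent. Both ends of such a pair lie in \<open>H\<close> and have weight
  at least 1, whence the edge probability of at least \<open>1 / W\<close>.\<close>

lemma prob_distances_le:
  assumes S: "S \<subseteq> H" and W1: "1 \<le> W"
  shows "prob\<^sub>G {e. (\<forall>x\<in>S. \<forall>y\<in>S. d x y = dist_of e x y) \<and> m \<le> card (split_pairs R e S (dist_of e))}
         \<le> (1 - 1 / W) ^ m"
proof -
  have cong: "split_pairs R e S (dist_of e) = split_pairs R e S d"
    if "\<forall>x\<in>S. \<forall>y\<in>S. d x y = dist_of e x y" for e
    using that by (auto simp: split_pairs_def)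
  have "prob\<^sub>G {e. (\<forall>x\<in>S. \<forall>y\<in>S. d x y = dist_of e x y) \<and> m \<le> card (split_pairs R e S (dist_of e))}
     \<le> prob\<^sub>G {e. m \<le> card (split_pairs R e S d) \<and> (\<forall>p\<in>split_pairs R e S d. \<not> e p)}"
    using split_pairs_absent[OF S] by (intro prob_mono_finite finite_\<G>) (metis cong)
  also have "\<dots> \<le> (1 - 1 / W) ^ m" unfolding \<G>_eq
  proof (rule prob_all_absent_le[OF finite_vertex_pairs])
    fix i assume "i \<in> vertex_pairs n"
    then show "0 \<le> p_edge (fst i) (snd i) \<and> p_edge (fst i) (snd i) \<le> 1"
      by (intro p_edge_range) (auto simp: vertex_pairs_def)
  next
    fix e i assume "i \<in> split_pairs R e S d"
    then have "fst i \<in> H" "snd i \<in> H"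
      using priv_subset far_subset unfolding split_pairs_def by blast+
    then have "1 * 1 \<le> w (fst i) * w (snd i)" using L1 by (intro mult_mono) (auto simp: H_def)
    then show "1 / W \<le> p_edge (fst i) (snd i)"
      using W_pos W1 by (auto simp: p_edge_def intro: divide_right_mono)
  next
    show "\<And>e e'. (\<And>i. i \<notin> split_pairs R e S d \<Longrightarrow> e' i = e i) \<Longrightarrow> split_pairs R e' S d = split_pairs R e S d"
      by (rule split_pairs_inv)
  qed (use W1 in \<open>auto simp: split_pairs_def\<close>)
  finally show ?thesis .
qed

text \<open>Through \<open>D\<close> a labeling of \<open>S\<close> prescribes one distance matrix,
  so it remains to multiply by the number of short labelings.\<close>

lemma prob_short_labels_le:
  fixes len :: "'l \<Rightarrow> nat" and D :: "'l \<Rightarrow> 'l \<Rightarrow> enat"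
  assumes S: "S \<subseteq> H" and W1: "1 \<le> W"
    and Lab: "\<And>j. finite {l \<in> Lab. len l = j}" "\<And>j. card {l \<in> Lab. len l = j} \<le> A ^ j" and A: "1 \<le> A"
  shows "prob\<^sub>G {e. \<exists>l\<in>S \<rightarrow>\<^sub>E Lab. (\<Sum>x\<in>S. len (l x)) \<le> M \<and>
       (\<forall>x\<in>S. \<forall>y\<in>S. D (l x) (l y) = dist_of e x y) \<and> m \<le> card (split_pairs R e S (dist_of e))}
     \<le> (2 * real A) ^ M * 2 ^ card S * (1 - 1 / W) ^ m"
proof -
  let ?F = "{f \<in> S \<rightarrow>\<^sub>E Lab. (\<Sum>x\<in>S. len (f x)) \<le> M}"
  let ?E = "\<lambda>l. {e. (\<forall>x\<in>S. \<forall>y\<in>S. D (l x) (l y) = dist_of e x y) \<and> m \<le> card (split_pairs R e S (dist_of e))}"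
  have finS: "finite S" using S finite_H finite_subset by blast
  note F = card_weighted_labelings[OF finS Lab A, of M]
  have "prob\<^sub>G (\<Union>l\<in>?F. ?E l) \<le> (\<Sum>l\<in>?F. prob\<^sub>G (?E l))"
    using F by (intro measure_pmf.finite_measure_subadditive_finite) auto
  also have "\<dots> \<le> (\<Sum>l\<in>?F. (1 - 1 / W) ^ m)"
    by (intro sum_mono prob_distances_le[OF S W1])
  also have "\<dots> = real (card ?F) * (1 - 1 / W) ^ m" by simp
  also have "\<dots> \<le> real ((2 * A) ^ M * 2 ^ card S) * (1 - 1 / W) ^ m"
  proof (rule mult_right_mono)
    show "real (card ?F) \<le> real ((2 * A) ^ M * 2 ^ card S)"
      using F by (simp only: of_nat_le_iff)
  qed (use W1 in simp)
  finally have "prob\<^sub>G (\<Union>l\<in>?F. ?E l) \<le> (2 * real A) ^ M * 2 ^ card S * (1 - 1 / W) ^ m" by simp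
  moreover have "{e. \<exists>l\<in>S \<rightarrow>\<^sub>E Lab. (\<Sum>x\<in>S. len (l x)) \<le> M \<and>
       (\<forall>x\<in>S. \<forall>y\<in>S. D (l x) (l y) = dist_of e x y) \<and> m \<le> card (split_pairs R e S (dist_of e))}
      = (\<Union>l\<in>?F. ?E l)" by auto
  ultimately show ?thesis by simp
qed

section \<open>Counting pairs of private vertices\<close>

lemma priv_disjoint:
  assumes "x \<in> S" "y \<in> S" "x \<noteq> y"
  shows "priv R e S x \<inter> priv R e S y = {}"
proof -
  have "u \<notin> priv R e S y" if "u \<in> priv R e S x" for u
  proof
    assume "u \<in> priv R e S y"
    then have "u \<in> bfs_ball n e y r" using priv_subset far_subset by blast
    then show False using that assms by (auto simp: priv_def split: if_splits)
  qed
  then show ?thesis by blast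
qed

definition hit_count where "hit_count R e S = (\<Sum>x\<in>S. card (priv R e S x))"
text \<open>Ordered pairs with the diagonal, so that pairs of private vertices with the same owner
  are written off as well.\<close>

definition close_pairs where "close_pairs e S = {(x, y). x \<in> S \<and> y \<in> S \<and> y \<in> bfs_ball n e x (2 * r + 1)}"

lemma finite_priv: "finite (priv R e S x)"
  by (rule finite_subset[OF priv_subset finite_far])

lemma hit_count_eq: "S \<subseteq> H \<Longrightarrow> hit_count R e S = card (\<Union>x\<in>S. priv R e S x)"
  unfolding hit_count_def using finite_subset[OF _ finite_H] finite_priv priv_disjoint
  by (intro card_UN_disjoint[symmetric]) auto

lemma hit_count_le: "S \<subseteq> H \<Longrightarrow> hit_count R e S \<le> card H"
  unfolding hit_count_eq using priv_subset far_subset(1) by (intro card_mono finite_H) blast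

text \<open>Among all ordered pairs of private vertices, one whose owners are far apart is a split
  pair after possibly swapping it, hence the factor 2. All others are charged to a close pair of
  owners, at most \<open>R\<^sup>2\<close> for each.\<close>

lemma card_split_pairs_ge:
  assumes S: "S \<subseteq> H" and R: "0 \<le> R"
  shows "(real (hit_count R e S))\<^sup>2 \<le> 2 * real (card (split_pairs R e S (dist_of e))) + R\<^sup>2 * real (card (close_pairs e S))"
proof -
  let ?p = "priv R e S"
  let ?U = "\<Union>x\<in>S. ?p x"
  let ?G = "split_pairs R e S (dist_of e)"
  let ?C = "\<Union>z\<in>close_pairs e S. ?p (fst z) \<times> ?p (snd z)"
  have finS: "finite S" using S finite_H finite_subset by blast
  have finC: "finite (close_pairs e S)"
    by (rule finite_subset[of _ "S \<times> S"]) (use finS in \<open>auto simp: close_pairs_def\<close>)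
  have finG: "finite ?G" by (rule finite_subset[OF _ finite_vertex_pairs]) (auto simp: split_pairs_def)
  have sub: "?U \<times> ?U \<subseteq> (?G \<union> prod.swap ` ?G) \<union> ?C"
  proof
    fix q assume "q \<in> ?U \<times> ?U"
    then obtain u v x y where q: "q = (u, v)" and xy: "x \<in> S" "y \<in> S" "u \<in> ?p x" "v \<in> ?p y" by auto
    have uv: "u < n" "v < n" using xy priv_subset far_subset(1) H_subset by blast+
    show "q \<in> (?G \<union> prod.swap ` ?G) \<union> ?C"
    proof (cases "y \<in> bfs_ball n e x (2 * r + 1)")
      case True
      then have "(x, y) \<in> close_pairs e S" using xy by (simp add: close_pairs_def)
      then show ?thesis using q xy by force
    next
      case False
      then have d: "enat (2 * r + 1) < dist_of e x y" unfolding gdist_le_iff[symmetric] not_le .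
      then have d': "enat (2 * r + 1) < dist_of e y x" by (simp add: gdist_sym)
      have ne: "x \<noteq> y" using False self_in_bfs_ball by auto
      then have "u \<noteq> v" using xy priv_disjoint by blast
      then consider "u < v" | "v < u" by linarith
      then show ?thesis
      proof cases
        case 1
        then have "(u, v) \<in> ?G" using uv xy ne d unfolding split_pairs_def vertex_pairs_def by auto
        then show ?thesis using q by blast
      next
        case 2
        then have "(v, u) \<in> ?G" using uv xy ne[symmetric] d' unfolding split_pairs_def vertex_pairs_def by auto
        then show ?thesis using q by force
      qed
    qed
  qed
  have pR: "real (card (?p x)) \<le> R" for x
  proof (cases "real (card (far e x)) \<le> R")
    case True
    moreover have "card (?p x) \<le> card (far e x)" by (rule card_mono[OF finite_far priv_subset])
    ultimately show ?thesis by linarith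
  qed (simp add: priv_def R)
  have "real (card ?C) \<le> (\<Sum>z\<in>close_pairs e S. real (card (?p (fst z) \<times> ?p (snd z))))"
    unfolding of_nat_sum[symmetric] of_nat_le_iff by (rule card_UN_le[OF finC])
  also have "\<dots> \<le> (\<Sum>z\<in>close_pairs e S. R * R)"
    unfolding card_cartesian_product of_nat_mult by (intro sum_mono mult_mono pR R) auto
  also have "\<dots> = R\<^sup>2 * real (card (close_pairs e S))" by (simp add: power2_eq_square)
  finally have cC: "real (card ?C) \<le> R\<^sup>2 * real (card (close_pairs e S))" .
  have "(real (hit_count R e S))\<^sup>2 = real (card (?U \<times> ?U))"
    by (simp add: hit_count_eq[OF S] power2_eq_square card_cartesian_product)
  also have "\<dots> \<le> real (card ((?G \<union> prod.swap ` ?G) \<union> ?C))"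
    using finG finC finite_priv by (intro of_nat_mono card_mono sub) auto
  also have "\<dots> \<le> real (card (?G \<union> prod.swap ` ?G)) + real (card ?C)"
    using card_Un_le[of "?G \<union> prod.swap ` ?G" ?C] by linarith
  also have "\<dots> \<le> 2 * real (card ?G) + real (card ?C)"
    using card_Un_le[of ?G "prod.swap ` ?G"] card_image_le[OF finG, of prod.swap] by linarith
  finally show ?thesis using cC by linarith
qed

end

section \<open>A random set of test vertices\<close>

context growth_parameters
begin

text \<open>A ball of volume at most \<open>V\<close> contains at most \<open>V / L\<close> vertices
  of \<open>H\<close>, hence on average at most 1/2 chosen vertex.\<close>

definition rate where "rate = L / (2 * V)"
text \<open>Lower bound for the expected fraction of \<open>H\<close> that becomes private:
  \<open>Rm / 4\<close> usable incidences per vertex, each successful with probability at least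
  \<open>rate / 2\<close>.\<close>

definition \<kappa> where "\<kappa> = Rm * rate / 8"
definition sample where "sample = Pi_pmf H False (\<lambda>_. bernoulli_pmf rate)"
definition chosen where "chosen g = {x \<in> H. g x}"

abbreviation "\<E>\<^sub>S \<equiv> measure_pmf.expectation sample"
abbreviation "prob\<^sub>S \<equiv> measure_pmf.prob sample"

lemma finite_sample: "finite (set_pmf sample)"
  unfolding sample_def by (rule finite_set_Pi_pmf_bool[OF finite_H])

lemma chosen_subset: "chosen g \<subseteq> H" by (auto simp: chosen_def)

lemma rate_pos: "0 < rate" using L1 V_pos by (simp add: rate_def)

lemma \<kappa>_pos: "0 < \<kappa>" using Rm_pos rate_pos by (simp add: \<kappa>_def)

lemma expectation_chosen:
  assumes "x \<in> H" "rate \<le> 1"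
  shows "\<E>\<^sub>S (\<lambda>g. of_bool (x \<in> chosen g)) = rate"
proof -
  have "\<E>\<^sub>S (\<lambda>g. of_bool (x \<in> chosen g)) = measure_pmf.prob (map_pmf (\<lambda>g. g x) sample) {True}"
    using assms unfolding prob_eq_expectation[symmetric] by (simp add: chosen_def vimage_def)
  also have "map_pmf (\<lambda>g. g x) sample = bernoulli_pmf rate"
    unfolding sample_def using assms by (simp add: Pi_pmf_component[OF finite_H])
  finally show ?thesis using assms rate_pos by (simp add: measure_pmf_single)
qed

lemma expectation_chosen_pair:
  assumes "x \<in> H" "y \<in> H" "x \<noteq> y" "rate \<le> 1"
  shows "\<E>\<^sub>S (\<lambda>g. of_bool (x \<in> chosen g) * of_bool (y \<in> chosen g)) = rate\<^sup>2"
proof -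
  have "\<E>\<^sub>S (\<lambda>g. of_bool (x \<in> chosen g) * of_bool (y \<in> chosen g)) =
      \<E>\<^sub>S (\<lambda>g. of_bool (x \<in> chosen g) :: real) * \<E>\<^sub>S (\<lambda>g. of_bool (y \<in> chosen g) :: real)"
    unfolding sample_def by (rule expectation_Pi_pmf_indep[of _ "{x}" "{y}"])
       (use assms finite_H in \<open>auto simp: depends_only_def chosen_def\<close>)
  then show ?thesis using assms by (simp add: expectation_chosen power2_eq_square)
qed

text \<open>Bonferroni's inequality: \<open>u\<close> is private to a chosen \<open>x\<close> unless
  some other chosen \<open>y\<close> has \<open>u\<close> in its ball. The bound involves only pairs
  of chosen vertices, so its mean is computable.\<close>

lemma hit_count_ge:
  assumes S: "S \<subseteq> H"
  shows "(\<Sum>x | x \<in> H \<and> real (card (far e x)) \<le> R. \<Sum>u | u \<in> far e x \<and> typical e u.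
       of_bool (x \<in> S) - (\<Sum>y\<in>bfs_ball n e u r \<inter> H - {x}. of_bool (x \<in> S) * of_bool (y \<in> S)))
     \<le> real (hit_count R e S)"
proof -
  let ?t = "\<lambda>x u. of_bool (x \<in> S) - (\<Sum>y\<in>bfs_ball n e u r \<inter> H - {x}. of_bool (x \<in> S) * of_bool (y \<in> S)) :: real"
  let ?H' = "{x. x \<in> H \<and> real (card (far e x)) \<le> R}"
  let ?T = "\<lambda>x. {u. u \<in> far e x \<and> typical e u}"
  have one: "(\<Sum>u\<in>?T x. ?t x u) \<le> (if x \<in> S then real (card (priv R e S x)) else 0)" if x: "x \<in> ?H'" for x
  proof (cases "x \<in> S")
    case True
    have "(\<Sum>u\<in>?T x. ?t x u) \<le> (\<Sum>u\<in>?T x. of_bool (u \<in> priv R e S x))"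
    proof (rule sum_mono)
      fix u assume u: "u \<in> ?T x"
      show "?t x u \<le> of_bool (u \<in> priv R e S x)"
      proof (cases "u \<in> priv R e S x")
        case T: True
        have "0 \<le> (\<Sum>y\<in>bfs_ball n e u r \<inter> H - {x}. of_bool (x \<in> S) * of_bool (y \<in> S) :: real)"
          by (intro sum_nonneg) auto
        then show ?thesis using T True by simp
      next
        case False
        then obtain y where y: "y \<in> S" "y \<noteq> x" "u \<in> bfs_ball n e y r"
          using u x by (auto simp: priv_def)
        then have "y \<in> bfs_ball n e u r \<inter> H - {x}" using bfs_ball_sym S by blast
        then have "of_bool (x \<in> S) * of_bool (y \<in> S)
            \<le> (\<Sum>y\<in>bfs_ball n e u r \<inter> H - {x}. of_bool (x \<in> S) * of_bool (y \<in> S) :: real)"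
          by (rule member_le_sum) (use finite_H in auto)
        then show ?thesis using True y by simp
      qed
    qed
    also have "\<dots> \<le> (\<Sum>u\<in>far e x. of_bool (u \<in> priv R e S x))"
      by (intro sum_mono2 finite_far) auto
    also have "\<dots> = real (card (far e x \<inter> priv R e S x))"
      using finite_far[of e x] by (simp add: of_bool_def sum.If_cases Int_def)
    also have "far e x \<inter> priv R e S x = priv R e S x" using priv_subset by blast
    finally show ?thesis using True by simp
  qed simp
  have "(\<Sum>x\<in>?H'. \<Sum>u\<in>?T x. ?t x u) \<le> (\<Sum>x\<in>?H'. if x \<in> S then real (card (priv R e S x)) else 0)"
    by (intro sum_mono one)
  also have "\<dots> \<le> (\<Sum>x\<in>H. if x \<in> S then real (card (priv R e S x)) else 0)"
    using finite_H by (intro sum_mono2) auto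
  also have "\<dots> = real (hit_count R e S)"
    using finite_H S by (simp add: hit_count_def sum.If_cases Int_absorb1 Collect_mem_eq)
  finally show ?thesis .
qed

lemma finite_conj_H: "finite {x. x \<in> H \<and> P x}"
  using finite_H by simp

text \<open>The incidences are counted from a typical \<open>u\<close>, whose far layer has at least
  \<open>Rm\<close> elements, and transferred to \<open>x\<close> by symmetry. Owners with a far
  layer above \<open>R\<close> carry little, since there the size is at most its square over
  \<open>R\<close> and the squares are controlled on average.\<close>

lemma typical_incidences_ge:
  assumes reg: "regular \<Lambda> e" and R: "0 < R" and c: "\<Lambda> * far_sq / R \<le> Rm / 4"
  shows "real (card H) * Rm / 4 \<le>
    (\<Sum>x | x \<in> H \<and> real (card (far e x)) \<le> R. real (card {u. u \<in> far e x \<and> typical e u}))"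
proof -
  let ?T = "{u. u \<in> H \<and> typical e u}"
  let ?c = "\<lambda>x. real (card {u. u \<in> far e x \<and> typical e u})"
  have "real (card H) / 2 * Rm \<le> real (card ?T) * Rm"
    using reg Rm_pos by (intro mult_right_mono) (auto simp: regular_def)
  also have "\<dots> = (\<Sum>u\<in>?T. Rm)" by simp
  also have "\<dots> \<le> (\<Sum>u\<in>?T. real (card (far e u)))"
    by (intro sum_mono) (auto simp: typical_def)
  also have "\<dots> = (\<Sum>u\<in>?T. \<Sum>x\<in>H. of_bool (x \<in> far e u))"
  proof (intro sum.cong refl)
    fix u
    have "H \<inter> far e u = far e u" using far_subset(1) by blast
    then show "real (card (far e u)) = (\<Sum>x\<in>H. of_bool (x \<in> far e u))"
      using finite_H by (simp add: of_bool_def sum.If_cases Int_def)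
  qed
  also have "\<dots> = (\<Sum>x\<in>H. \<Sum>u\<in>?T. of_bool (x \<in> far e u))" by (rule sum.swap)
  also have "\<dots> = (\<Sum>x\<in>H. ?c x)"
  proof (intro sum.cong refl)
    fix x assume x: "x \<in> H"
    have "(\<Sum>u\<in>?T. of_bool (x \<in> far e u)) = real (card (?T \<inter> {u. x \<in> far e u}))"
      using finite_conj_H[of "typical e"] by (simp add: of_bool_def sum.If_cases)
    also have "?T \<inter> {u. x \<in> far e u} = {u. u \<in> far e x \<and> typical e u}"
      using far_sym x far_subset(1) by blast
    finally show "(\<Sum>u\<in>?T. of_bool (x \<in> far e u)) = ?c x" .
  qed
  also have "\<dots> = (\<Sum>x | x \<in> H \<and> real (card (far e x)) \<le> R. ?c x) + (\<Sum>x | x \<in> H \<and> \<not> real (card (far e x)) \<le> R. ?c x)"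
    using finite_H by (subst sum.union_disjoint[symmetric]) (auto intro: sum.cong)
  also have "(\<Sum>x | x \<in> H \<and> \<not> real (card (far e x)) \<le> R. ?c x) \<le> (\<Sum>x | x \<in> H \<and> \<not> real (card (far e x)) \<le> R. (real (card (far e x)))\<^sup>2 / R)"
  proof (rule sum_mono)
    fix x assume x: "x \<in> {x. x \<in> H \<and> \<not> real (card (far e x)) \<le> R}"
    have "?c x \<le> real (card (far e x))" using finite_far by (intro of_nat_mono card_mono) auto
    also have "\<dots> \<le> (real (card (far e x)))\<^sup>2 / R"
      using x R by (simp add: field_simps power2_eq_square)
    finally show "?c x \<le> (real (card (far e x)))\<^sup>2 / R" .
  qed
  also have "\<dots> \<le> (\<Sum>x\<in>H. (real (card (far e x)))\<^sup>2 / R)"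
    using finite_H R by (intro sum_mono2) auto
  also have "\<dots> \<le> \<Lambda> * (real (card H) * far_sq) / R"
    unfolding sum_divide_distrib[symmetric] using reg R by (intro divide_right_mono) (auto simp: regular_def)
  also have "\<dots> = real (card H) * (\<Lambda> * far_sq / R)" by simp
  also have "\<dots> \<le> real (card H) * (Rm / 4)" using c by (intro mult_left_mono) auto
  also have "real (card H) * (Rm / 4) = real (card H) * Rm / 4" by simp
  finally have "real (card H) / 2 * Rm \<le>
      (\<Sum>x | x \<in> H \<and> real (card (far e x)) \<le> R. ?c x) + real (card H) * Rm / 4" by simp
  moreover have "real (card H) / 2 * Rm = real (card H) * Rm / 4 + real (card H) * Rm / 4" by simp
  ultimately show ?thesis by linarith
qed

lemma expectation_hit_count_ge:
  assumes reg: "regular \<Lambda> e" and R: "0 < R" and c: "\<Lambda> * far_sq / R \<le> Rm / 4" and r1: "rate \<le> 1"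
  shows "\<kappa> * real (card H) \<le> \<E>\<^sub>S (\<lambda>g. real (hit_count R e (chosen g)))"
proof -
  let ?H' = "{x. x \<in> H \<and> real (card (far e x)) \<le> R}"
  let ?T = "\<lambda>x. {u. u \<in> far e x \<and> typical e u}"
  let ?t = "\<lambda>x u g. of_bool (x \<in> chosen g) - (\<Sum>y\<in>bfs_ball n e u r \<inter> H - {x}. of_bool (x \<in> chosen g) * of_bool (y \<in> chosen g)) :: real"
  have one: "rate / 2 \<le> \<E>\<^sub>S (?t x u)" if x: "x \<in> ?H'" and u: "u \<in> ?T x" for x u
  proof -
    let ?B = "bfs_ball n e u r \<inter> H - {x}"
    have un: "u < n" using u far_subset(1) H_subset by blast
    have int: "integrable (measure_pmf sample) f" for f :: "(nat \<Rightarrow> bool) \<Rightarrow> real"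
      by (rule integrable_measure_pmf_finite[OF finite_sample])
    have "\<E>\<^sub>S (?t x u) = rate - (\<Sum>y\<in>?B. rate\<^sup>2)"
      using x r1 by (subst Bochner_Integration.integral_diff[OF int int])
        (auto simp: expectation_sum_finite[OF finite_sample] expectation_chosen expectation_chosen_pair
          simp del: sum_constant intro!: sum.cong)
    also have "\<dots> = rate - real (card ?B) * rate\<^sup>2" by simp
    finally have eq: "\<E>\<^sub>S (?t x u) = rate - real (card ?B) * rate\<^sup>2" .
    have "real (card ?B) \<le> real (card (bfs_ball n e u r \<inter> H))"
      using finite_H by (intro of_nat_mono card_mono) auto
    also have "\<dots> \<le> V / L"
      using card_ball_H_le[OF un, of e r] u L1 by (simp add: typical_def field_simps)
    \<comment> \<open>Here the choice of \<open>rate\<close> makes the expected collisions at most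
      half of the main term.\<close>
    finally have "real (card ?B) * rate\<^sup>2 \<le> V / L * rate\<^sup>2" by (intro mult_right_mono) auto
    also have "\<dots> = rate / 2" using L1 V_pos by (simp add: rate_def power2_eq_square field_simps)
    finally show ?thesis using eq by simp
  qed
  have "\<kappa> * real (card H) = real (card H) * Rm / 4 * (rate / 2)" by (simp add: \<kappa>_def)
  also have "\<dots> \<le> (\<Sum>x\<in>?H'. real (card (?T x))) * (rate / 2)"
    using typical_incidences_ge[OF reg R c] rate_pos by (intro mult_right_mono) auto
  also have "\<dots> = (\<Sum>x\<in>?H'. \<Sum>u\<in>?T x. rate / 2)" by (simp add: sum_distrib_right)
  also have "\<dots> \<le> (\<Sum>x\<in>?H'. \<Sum>u\<in>?T x. \<E>\<^sub>S (?t x u))" by (intro sum_mono one)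
  also have "\<dots> = \<E>\<^sub>S (\<lambda>g. \<Sum>x\<in>?H'. \<Sum>u\<in>?T x. ?t x u g)"
    by (simp only: expectation_sum_finite[OF finite_sample])
  also have "\<dots> \<le> \<E>\<^sub>S (\<lambda>g. real (hit_count R e (chosen g)))"
    by (intro expectation_mono_finite finite_sample hit_count_ge chosen_subset)
  finally show ?thesis .
qed

lemma expectation_close_pairs:
  assumes reg: "regular \<Lambda> e" and r1: "rate \<le> 1"
  shows "\<E>\<^sub>S (\<lambda>g. real (card (close_pairs e (chosen g))))
     \<le> real (card H) * (rate + rate\<^sup>2 * (\<Lambda> * close_bound))"
proof -
  let ?B = "\<lambda>x. bfs_ball n e x (2 * r + 1) \<inter> H"
  have cp: "real (card (close_pairs e (chosen g))) =
      (\<Sum>x\<in>H. \<Sum>y\<in>?B x. of_bool (x \<in> chosen g) * of_bool (y \<in> chosen g))" for g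
  proof -
    have "close_pairs e (chosen g) = {p \<in> Sigma H ?B. fst p \<in> chosen g \<and> snd p \<in> chosen g}"
      by (auto simp: close_pairs_def chosen_def)
    moreover have "finite (Sigma H ?B)" using finite_H by simp
    ultimately have "real (card (close_pairs e (chosen g))) =
        (\<Sum>p\<in>Sigma H ?B. of_bool (fst p \<in> chosen g \<and> snd p \<in> chosen g))"
      by (simp add: of_bool_def sum.If_cases Int_def)
    also have "\<dots> = (\<Sum>x\<in>H. \<Sum>y\<in>?B x. of_bool (x \<in> chosen g \<and> y \<in> chosen g))"
      using finite_H by (subst sum.Sigma) (auto simp: case_prod_unfold)
    finally show ?thesis by (simp only: of_bool_conj)
  qed
  have "\<E>\<^sub>S (\<lambda>g. real (card (close_pairs e (chosen g)))) =
      (\<Sum>x\<in>H. \<Sum>y\<in>?B x. \<E>\<^sub>S (\<lambda>g. of_bool (x \<in> chosen g) * of_bool (y \<in> chosen g)))"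
    unfolding cp by (simp only: expectation_sum_finite[OF finite_sample])
  also have "\<dots> \<le> (\<Sum>x\<in>H. rate + rate\<^sup>2 * real (card (?B x)))"
  proof (rule sum_mono)
    fix x assume x: "x \<in> H"
    have xB: "x \<in> ?B x" using x self_in_bfs_ball by blast
    have finB: "finite (?B x)" using finite_H by simp
    have "\<E>\<^sub>S (\<lambda>g. of_bool (x \<in> chosen g) * of_bool (x \<in> chosen g)) = rate"
      using expectation_chosen[OF x r1] by (simp only: of_bool_conj[symmetric] conj_absorb)
    then have "(\<Sum>y\<in>?B x. \<E>\<^sub>S (\<lambda>g. of_bool (x \<in> chosen g) * of_bool (y \<in> chosen g))) =
       rate + (\<Sum>y\<in>?B x - {x}. rate\<^sup>2)"
      unfolding sum.remove[OF finB xB] using x r1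
      by (intro arg_cong2[of _ _ _ _ "(+)"] sum.cong expectation_chosen_pair refl) auto
    also have "\<dots> \<le> rate + rate\<^sup>2 * real (card (?B x))"
      using card_Diff1_le[of "?B x" x] by (simp add: mult.commute mult_left_mono)
    finally show "(\<Sum>y\<in>?B x. \<E>\<^sub>S (\<lambda>g. of_bool (x \<in> chosen g) * of_bool (y \<in> chosen g))) \<le> rate + rate\<^sup>2 * real (card (?B x))" .
  qed
  also have "\<dots> = real (card H) * rate + rate\<^sup>2 * (\<Sum>x\<in>H. real (card (?B x)))"
    by (simp add: sum.distrib sum_distrib_left)
  also have "\<dots> \<le> real (card H) * rate + rate\<^sup>2 * (\<Lambda> * (real (card H) * close_bound))"
    using reg by (intro add_left_mono mult_left_mono) (auto simp: regular_def)
  finally show ?thesis by (simp add: algebra_simps)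
qed

lemma expectation_sum_chosen:
  fixes f :: "nat \<Rightarrow> real"
  assumes r1: "rate \<le> 1"
  shows "\<E>\<^sub>S (\<lambda>g. \<Sum>x\<in>chosen g. f x) = rate * (\<Sum>x\<in>H. f x)"
proof -
  have "(\<Sum>x\<in>chosen g. f x) = (\<Sum>x\<in>H. f x * of_bool (x \<in> chosen g))" for g
  proof -
    have "(\<Sum>x\<in>H. f x * of_bool (x \<in> chosen g)) = (\<Sum>x\<in>H. if g x then f x else 0)"
      by (intro sum.cong) (auto simp: chosen_def)
    then show ?thesis unfolding chosen_def using sum.inter_filter[OF finite_H, of f g] by simp
  qed
  then have "\<E>\<^sub>S (\<lambda>g. \<Sum>x\<in>chosen g. f x) = (\<Sum>x\<in>H. f x * \<E>\<^sub>S (\<lambda>g. of_bool (x \<in> chosen g)))"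
    by (simp add: expectation_sum_finite[OF finite_sample])
  also have "\<dots> = (\<Sum>x\<in>H. f x * rate)" using r1 by (intro sum.cong) (auto simp: expectation_chosen)
  finally show ?thesis by (simp add: sum_distrib_left mult.commute)
qed

text \<open>What remains visible of a short labeling when only \<open>S\<close> is inspected. It
  mentions labels of \<open>S\<close> alone, so a union bound over those labels suffices.\<close>

definition witness where
  "witness D Lab len R M m s e S \<longleftrightarrow> real (card S) \<le> s \<and>
     (\<exists>l\<in>S \<rightarrow>\<^sub>E Lab. (\<Sum>x\<in>S. len (l x)) \<le> M \<and>
       (\<forall>x\<in>S. \<forall>y\<in>S. D (l x) (l y) = dist_of e x y) \<and> m \<le> card (split_pairs R e S (dist_of e)))"
  for len :: "'l \<Rightarrow> nat" and M m :: nat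

definition short_labeling where
  "short_labeling D Lab len B e \<longleftrightarrow> (\<exists>l. (\<forall>x<n. l x \<in> Lab) \<and>
     (\<forall>x<n. \<forall>y<n. D (l x) (l y) = dist_of e x y) \<and> real (\<Sum>x<n. len (l x)) < B)"
  for len :: "'l \<Rightarrow> nat"

text \<open>The configuration is fixed and only the sample is random. Many private vertices occur
  with probability at least \<open>\<kappa> / 2\<close>; too many close pairs, too long labels and
  too large a sample each cost at most \<open>\<kappa> / 8\<close>.\<close>

lemma prob_witness_ge:
  fixes len :: "'l \<Rightarrow> nat"
  assumes reg: "regular \<Lambda> e" and R: "0 < R" and c: "\<Lambda> * far_sq / R \<le> Rm / 4" and r1: "rate \<le> 1"
    and c2: "64 * R\<^sup>2 * (rate + rate\<^sup>2 * (\<Lambda> * close_bound)) \<le> \<kappa> ^ 3 * real (card H)"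
    and B: "0 < B" and short: "short_labeling D Lab len B e"
  shows "\<kappa> / 8 \<le> prob\<^sub>S {g. witness D Lab len R (nat \<lfloor>8 * rate * B / \<kappa>\<rfloor>)
     (nat \<lceil>\<kappa>\<^sup>2 * (real (card H))\<^sup>2 / 16\<rceil>) (8 * rate * real (card H) / \<kappa>) e (chosen g)}"
proof -
  obtain l where l: "\<forall>x<n. l x \<in> Lab" "\<forall>x<n. \<forall>y<n. D (l x) (l y) = dist_of e x y"
    "real (\<Sum>x<n. len (l x)) < B" using short unfolding short_labeling_def by blast
  let ?h = "real (card H)"
  let ?J = "\<lambda>g. witness D Lab len R (nat \<lfloor>8 * rate * B / \<kappa>\<rfloor>)
     (nat \<lceil>\<kappa>\<^sup>2 * ?h\<^sup>2 / 16\<rceil>) (8 * rate * ?h / \<kappa>) e (chosen g)"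
  let ?A = "\<lambda>g. \<kappa> * ?h / 2 \<le> real (hit_count R e (chosen g))"
  let ?B1 = "\<lambda>g. \<kappa>\<^sup>2 * ?h\<^sup>2 / 8 \<le> R\<^sup>2 * real (card (close_pairs e (chosen g)))"
  let ?B2 = "\<lambda>g. 8 * rate * B / \<kappa> \<le> (\<Sum>x\<in>chosen g. real (len (l x)))"
  let ?B3 = "\<lambda>g. 8 * rate * ?h / \<kappa> \<le> (\<Sum>x\<in>chosen g. 1)"
  let ?P = "\<lambda>E. prob\<^sub>S {g. E g}"
  note pos = \<kappa>_pos rate_pos H_pos
  \<comment> \<open>Reverse Markov: \<open>hit_count\<close> never exceeds the size of
    \<open>H\<close>, so a mean of at least \<kappa> times that size forces the value to be at least
    half the mean bound with probability at least \<open>\<kappa> / 2\<close>.\<close>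
  have pA: "\<kappa> / 2 \<le> ?P ?A"
  proof -
    have "\<kappa> * ?h \<le> \<E>\<^sub>S (\<lambda>g. real (hit_count R e (chosen g)))"
      by (rule expectation_hit_count_ge[OF reg R c r1])
    also have "\<dots> \<le> \<E>\<^sub>S (\<lambda>g. \<kappa> * ?h / 2 + ?h * of_bool (?A g))"
    proof (intro expectation_mono_finite finite_sample)
      fix g
      have "real (hit_count R e (chosen g)) \<le> ?h" using hit_count_le[OF chosen_subset] by simp
      then show "real (hit_count R e (chosen g)) \<le> \<kappa> * ?h / 2 + ?h * of_bool (?A g)"
        using mult_pos_pos[OF pos(1,3)] by (cases "?A g") auto
    qed
    also have "\<dots> = \<kappa> * ?h / 2 + ?h * ?P ?A"
      by (simp add: prob_eq_expectation integrable_measure_pmf_finite[OF finite_sample])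
    finally have "?h * (\<kappa> / 2) \<le> ?h * ?P ?A" by (simp add: algebra_simps)
    then show ?thesis using pos by simp
  qed
  have p1: "?P ?B1 \<le> \<kappa> / 8"
  proof -
    have "?P ?B1 \<le> (R\<^sup>2 * (?h * (rate + rate\<^sup>2 * (\<Lambda> * close_bound)))) / (\<kappa>\<^sup>2 * ?h\<^sup>2 / 8)"
      using expectation_close_pairs[OF reg r1] pos
      by (intro markov_pmf finite_sample) (auto intro!: mult_left_mono)
    also have "\<dots> \<le> \<kappa> / 8"
    proof -
      have "R\<^sup>2 * (?h * (rate + rate\<^sup>2 * (\<Lambda> * close_bound))) = ?h / 64 * (64 * R\<^sup>2 * (rate + rate\<^sup>2 * (\<Lambda> * close_bound)))"
        by simp
      also have "\<dots> \<le> ?h / 64 * (\<kappa> ^ 3 * ?h)" using c2 pos by (intro mult_left_mono) auto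
      also have "\<dots> = \<kappa> / 8 * (\<kappa>\<^sup>2 * ?h\<^sup>2 / 8)" by (simp add: power2_eq_square power3_eq_cube)
      finally show ?thesis using pos by (subst pos_divide_le_eq) auto
    qed
    finally show ?thesis .
  qed
  have sumH: "(\<Sum>x\<in>H. real (len (l x))) \<le> B"
  proof -
    have "(\<Sum>x\<in>H. real (len (l x))) \<le> (\<Sum>x<n. real (len (l x)))"
      using H_subset by (intro sum_mono2) auto
    then show ?thesis using l(3) by simp
  qed
  have p2: "?P ?B2 \<le> \<kappa> / 8"
  proof -
    have "\<E>\<^sub>S (\<lambda>g. \<Sum>x\<in>chosen g. real (len (l x))) \<le> rate * B"
      unfolding expectation_sum_chosen[OF r1] using sumH pos by (intro mult_left_mono) auto
    then have "?P ?B2 \<le> rate * B / (8 * rate * B / \<kappa>)"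
      using pos B by (intro markov_pmf finite_sample sum_nonneg) auto
    then show ?thesis using pos B by (simp add: field_simps)
  qed
  have p3: "?P ?B3 \<le> \<kappa> / 8"
  proof -
    have "?P ?B3 \<le> rate * ?h / (8 * rate * ?h / \<kappa>)"
      using pos expectation_sum_chosen[OF r1, of "\<lambda>_. 1"] by (intro markov_pmf finite_sample sum_nonneg) auto
    then show ?thesis using pos by (simp add: field_simps)
  qed
  have "?P ?A \<le> ?P (\<lambda>g. ?J g \<or> (?B1 g \<or> (?B2 g \<or> ?B3 g)))"
  proof (rule prob_mono_finite[OF finite_sample])
    fix g assume A: "?A g"
    let ?S = "chosen g"
    show "?J g \<or> (?B1 g \<or> (?B2 g \<or> ?B3 g))"
    proof (rule ccontr)
      assume "\<not> ?thesis"
      then have nJ: "\<not> ?J g" and nB: "\<not> ?B1 g" "\<not> ?B2 g" "\<not> ?B3 g" by auto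
      have Sn: "x < n" if "x \<in> ?S" for x using that chosen_subset H_subset by blast
      have "real (card ?S) \<le> 8 * rate * ?h / \<kappa>" using nB(3) by simp
      moreover have "restrict l ?S \<in> ?S \<rightarrow>\<^sub>E Lab" using l(1) Sn by auto
      moreover have "(\<Sum>x\<in>?S. len (restrict l ?S x)) \<le> nat \<lfloor>8 * rate * B / \<kappa>\<rfloor>"
      proof -
        have "real (\<Sum>x\<in>?S. len (restrict l ?S x)) = (\<Sum>x\<in>?S. real (len (l x)))" by simp
        also have "\<dots> \<le> 8 * rate * B / \<kappa>" using nB(2) by simp
        finally show ?thesis by (simp add: le_nat_floor)
      qed
      moreover have "\<forall>x\<in>?S. \<forall>y\<in>?S. D (restrict l ?S x) (restrict l ?S y) = dist_of e x y"
        using l(2) Sn by auto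
      moreover have "nat \<lceil>\<kappa>\<^sup>2 * ?h\<^sup>2 / 16\<rceil> \<le> card (split_pairs R e ?S (dist_of e))"
      proof -
        have "(\<kappa> * ?h / 2)\<^sup>2 \<le> (real (hit_count R e ?S))\<^sup>2"
          using A pos by (intro power_mono) auto
        then have "\<kappa>\<^sup>2 * ?h\<^sup>2 / 4 \<le> (real (hit_count R e ?S))\<^sup>2"
          by (simp add: power_mult_distrib power_divide)
        \<comment> \<open>A quarter minus the eighth lost to close pairs leaves an eighth for twice
          the number of split pairs.\<close>
        then have "\<kappa>\<^sup>2 * ?h\<^sup>2 / 16 \<le> real (card (split_pairs R e ?S (dist_of e)))"
          using card_split_pairs_ge[OF chosen_subset, of R e g] R nB(1) by linarith
        then show ?thesis by (simp add: ceiling_le_iff nat_le_iff)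
      qed
      ultimately have "?J g" unfolding witness_def by blast
      then show False using nJ by blast
    qed
  qed
  also have "\<dots> \<le> ?P ?J + (?P ?B1 + (?P ?B2 + ?P ?B3))"
    by (intro order_trans[OF prob_union_pmf] add_left_mono)
       (intro order_trans[OF prob_union_pmf] add_left_mono order_refl)
  finally show ?thesis using pA p1 p2 p3 by linarith
qed

text \<open>Double counting: a regular configuration with a short labeling is witnessed by a
  fraction of at least \<open>\<kappa> / 8\<close> of the samples, whereas for a fixed
  \<open>S\<close> the probability of being a witness is at most \<open>?X\<close>. Exchanging the
  two expectations compares these bounds.\<close>

theorem prob_short_labeling_le:
  fixes len :: "'l \<Rightarrow> nat"
  assumes \<Lambda>: "0 < \<Lambda>" and R: "0 < R" and c: "\<Lambda> * far_sq / R \<le> Rm / 4" and r1: "rate \<le> 1"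
    and c2: "64 * R\<^sup>2 * (rate + rate\<^sup>2 * (\<Lambda> * close_bound)) \<le> \<kappa> ^ 3 * real (card H)"
    and B: "0 < B" and W1: "1 \<le> W"
    and Lab: "\<And>j. finite {l \<in> Lab. len l = j}" "\<And>j. card {l \<in> Lab. len l = j} \<le> A ^ j" and A: "1 \<le> A"
  shows "prob\<^sub>G {e. short_labeling D Lab len B e} \<le> 2 * fail_bound + 2 / \<Lambda> +
    8 / \<kappa> * exp (8 * rate * B / \<kappa> * ln (2 * real A) + 8 * rate * real (card H) / \<kappa>
       - \<kappa>\<^sup>2 * (real (card H))\<^sup>2 / (16 * W))"
proof -
  let ?h = "real (card H)"
  let ?M = "nat \<lfloor>8 * rate * B / \<kappa>\<rfloor>" and ?m = "nat \<lceil>\<kappa>\<^sup>2 * ?h\<^sup>2 / 16\<rceil>" and ?s = "8 * rate * ?h / \<kappa>"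
  let ?J = "\<lambda>e S. witness D Lab len R ?M ?m ?s e S"
  let ?X = "exp (8 * rate * B / \<kappa> * ln (2 * real A) + ?s - \<kappa>\<^sup>2 * ?h\<^sup>2 / (16 * W))"
  let ?F = "\<lambda>e. short_labeling D Lab len B e \<and> regular \<Lambda> e"
  note pos = \<kappa>_pos rate_pos H_pos W_pos
  have J: "prob\<^sub>G {e. ?J e S} \<le> ?X" if S: "S \<subseteq> H" for S
  proof (cases "real (card S) \<le> ?s")
    case False
    then have "{e. ?J e S} = {}" by (auto simp: witness_def)
    then show ?thesis by (simp only: measure_empty exp_ge_zero)
  next
    case True
    have "prob\<^sub>G {e. ?J e S} \<le> (2 * real A) ^ ?M * 2 ^ card S * (1 - 1 / W) ^ ?m"
      unfolding witness_def using True prob_short_labels_le[OF S W1 Lab A, of ?M D ?m R] by simp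
    also have "\<dots> \<le> exp (8 * rate * B / \<kappa> * ln (2 * real A)) * exp ?s * exp (- (\<kappa>\<^sup>2 * ?h\<^sup>2 / (16 * W)))"
    proof (intro mult_mono)
      have "(2 * real A) ^ ?M = exp (real ?M * ln (2 * real A))"
        using A by (simp add: exp_of_nat_mult)
      also have "\<dots> \<le> exp (8 * rate * B / \<kappa> * ln (2 * real A))"
        using pos B A of_nat_floor[of "8 * rate * B / \<kappa>"]
        by (intro iffD2[OF exp_le_cancel_iff] mult_right_mono ln_ge_zero) auto
      finally show "(2 * real A) ^ ?M \<le> exp (8 * rate * B / \<kappa> * ln (2 * real A))" .
      have "(2::real) ^ card S = exp (real (card S) * ln 2)" by (simp add: exp_of_nat_mult)
      also have "\<dots> \<le> exp ?s"
      proof -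
        have "ln 2 \<le> (1::real)" using ln_le_minus_one[of 2] by simp
        then have "real (card S) * ln 2 \<le> real (card S) * 1" by (intro mult_left_mono) auto
        then show ?thesis using True by simp
      qed
      finally show "(2::real) ^ card S \<le> exp ?s" .
      have "(1 - 1 / W) ^ ?m \<le> exp (- (1 / W)) ^ ?m"
        using exp_ge_add_one_self[of "- (1 / W)"] W1 by (intro power_mono) auto
      also have "\<dots> = exp (- (real ?m / W))" by (simp add: exp_of_nat_mult[symmetric])
      also have "\<dots> \<le> exp (- (\<kappa>\<^sup>2 * ?h\<^sup>2 / (16 * W)))"
      proof -
        have "\<kappa>\<^sup>2 * ?h\<^sup>2 / 16 \<le> real ?m" by (rule real_nat_ceiling_ge)
        then have "\<kappa>\<^sup>2 * ?h\<^sup>2 / 16 / W \<le> real ?m / W" using pos by (intro divide_right_mono) auto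
        then show ?thesis by (simp add: mult.commute)
      qed
      finally show "(1 - 1 / W) ^ ?m \<le> exp (- (\<kappa>\<^sup>2 * ?h\<^sup>2 / (16 * W)))" .
    qed (use W1 in auto)
    also have "\<dots> = ?X" by (simp add: exp_add[symmetric])
    finally show ?thesis .
  qed
  have "\<kappa> / 8 * prob\<^sub>G {e. ?F e} = \<E> (\<lambda>e. \<kappa> / 8 * of_bool (?F e))"
    by (simp add: prob_eq_expectation)
  also have "\<dots> \<le> \<E> (\<lambda>e. \<E>\<^sub>S (\<lambda>g. of_bool (?J e (chosen g))))"
  proof (intro expectation_mono_finite finite_\<G>)
    fix e
    show "\<kappa> / 8 * of_bool (?F e) \<le> \<E>\<^sub>S (\<lambda>g. of_bool (?J e (chosen g)))"
    proof (cases "?F e")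
      case True
      then have "\<kappa> / 8 \<le> prob\<^sub>S {g. ?J e (chosen g)}"
        by (intro prob_witness_ge[OF _ R c r1 c2 B]) auto
      then show ?thesis using True by (simp add: prob_eq_expectation)
    qed (auto intro: expectation_nonneg_pmf finite_sample)
  qed
  also have "\<dots> = \<E>\<^sub>S (\<lambda>g. \<E> (\<lambda>e. of_bool (?J e (chosen g))))"
    by (rule expectation_swap_finite[OF finite_\<G> finite_sample])
  also have "\<dots> \<le> \<E>\<^sub>S (\<lambda>g. ?X)"
    using J[OF chosen_subset] unfolding prob_eq_expectation by (intro expectation_mono_finite finite_sample)
  finally have F: "prob\<^sub>G {e. ?F e} \<le> 8 / \<kappa> * ?X" using pos by (simp add: field_simps)
  have "prob\<^sub>G {e. short_labeling D Lab len B e} \<le> prob\<^sub>G {e. \<not> regular \<Lambda> e \<or> ?F e}"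
    by (intro prob_mono_finite finite_\<G>) auto
  also have "\<dots> \<le> prob\<^sub>G {e. \<not> regular \<Lambda> e} + prob\<^sub>G {e. ?F e}"
    by (rule prob_union_pmf)
  finally show ?thesis using F regular_fails[OF \<Lambda>] by linarith
qed

end

section \<open>Choice of the parameters\<close>

lemma exists_power_bracket:
  fixes m t :: real
  assumes m: "1 < m" and t: "m \<le> t"
  obtains r :: nat where "1 \<le> r" "m ^ r \<le> t" "t < m ^ Suc r"
proof -
  obtain N where N: "t < m ^ N" using real_arch_pow[OF m] by blast
  define k where "k = (LEAST k. t < m ^ k)"
  have k: "t < m ^ k" unfolding k_def using N by (rule LeastI)
  have "k \<noteq> 0" "k \<noteq> 1" using k t m by (auto intro: ccontr)
  then obtain r where r: "k = Suc r" "1 \<le> r" by (cases k) auto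
  have "\<not> t < m ^ r" using not_less_Least[of r "\<lambda>k. t < m ^ k"] r by (simp add: k_def)
  then show ?thesis using that[of r] r k by auto
qed

lemma frac_le_iff: "0 < y \<Longrightarrow> 0 < v \<Longrightarrow> x / y \<le> u / v \<longleftrightarrow> x * v \<le> u * y" for x y u v :: real
  by (simp add: field_simps)

context weighted_vertices
begin

text \<open>Cauchy-Schwarz against the constant 1, which bounds \<mu> below by the average
  weight.\<close>

lemma W_square_le: "W\<^sup>2 \<le> real n * Q"
  using arith_geo_mean_sqrt Cauchy_Schwarz_ineq_sum[of "\<lambda>_. 1" w "{..<n}"] by (simp add: W_def Q_def)

text \<open>Powers of \<open>l\<close>: \<open>a\<close> caps the interior weights, \<open>b\<close>
  is the scale of \<open>H\<close>, \<open>h\<close> the sparsity of \<open>H\<close>,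
  \<open>g\<close> the truncation of far layers relative to \<open>M\<close>, \<open>q\<close>
  bounds \<open>1 / \<kappa>\<close>, \<open>c\<close> is the gap between \<open>M\<close> and the
  square root of \<open>n\<close>, and \<open>k\<close> the final loss. Each is large enough to
  absorb the earlier ones and numerical constants, which \<open>l\<close> at least 64 dominates. The
  slack \<Lambda> is taken to be \<open>l\<close>.\<close>

theorem prob_short_labeling_good_weights:
  fixes l \<epsilon> :: real and a b g q c k h :: nat and len :: "'l \<Rightarrow> nat"
  assumes l: "l = ln (real n)" "64 \<le> l" and \<epsilon>: "0 < \<epsilon>" "l / ln (1 + \<epsilon>) + 1 \<le> l\<^sup>2"
    and W_ge: "(1 + \<epsilon>) * real n \<le> W" and Q_le: "Q \<le> real n * l"
    and tail: "(\<Sum>y | y < n \<and> l ^ a < w y. (w y)\<^sup>2) \<le> real n / l ^ 3"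
    and H_ge: "real n / l ^ h \<le> real (card {x. x < n \<and> l ^ b \<le> w x \<and> w x \<le> 2 * l ^ b})"
    and b: "b = a + 9" and g: "g = 2 * b + h + 7" and q: "q = h + 7"
    and c: "c = g + 3 + 3 * q + h + b + 4" and k: "k = c + 3 * q + 2 * h + 9"
    and big: "32 * l ^ k \<le> sqrt (real n)"
    and Lab: "\<And>j. finite {x \<in> Lab. len x = j}" "\<And>j. card {x \<in> Lab. len x = j} \<le> A ^ j"
    and A: "1 \<le> A" "ln (2 * real A) \<le> 4 * l"
  shows "prob\<^sub>G {e. \<exists>f. (\<forall>x<n. f x \<in> Lab) \<and>
     (\<forall>x<n. \<forall>y<n. D (f x) (f y) = gdist (adj n e) x y) \<and>
     real (\<Sum>x<n. len (f x)) < real n powr (3/2) / l ^ k} \<le> 9 / l"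
proof -
  define s where "s = sqrt (real n)"
  have n: "real n = s * s" by (simp add: s_def)
  have l1: "1 \<le> l" and l0: "0 < l" using l by auto
  have pw: "l ^ i \<le> l ^ j" if "i \<le> j" for i j using that l1 by (rule power_increasing)
  have pos: "0 < l ^ i" for i using l0 by simp
  have big': "32 * l ^ i \<le> s" if "i \<le> k" for i using big pw[OF that] by (simp add: s_def)
  have s1: "32 \<le> s" using big'[of 0] by simp
  have s0: "0 < s" using s1 by simp
  have np: "0 < real n" using n_pos by simp

  have nW: "real n \<le> W" using W_ge \<epsilon> np by (smt (verit) mult_less_cancel_right2)
  have W1: "1 \<le> W" using nW n_pos by (smt (verit) of_nat_1 of_nat_le_iff Suc_leI One_nat_def)
  have mu_ge: "1 + \<epsilon> \<le> \<mu>"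
  proof -
    have "(1 + \<epsilon>) * real n * W \<le> W * W" using W_ge W_pos by (intro mult_right_mono) auto
    also have "\<dots> \<le> real n * Q" using W_square_le by (simp add: power2_eq_square)
    finally have "real n * ((1 + \<epsilon>) * W) \<le> real n * Q" by (simp add: mult_ac)
    then have "(1 + \<epsilon>) * W \<le> Q" using np by simp
    then show ?thesis using W_pos by (simp add: \<mu>_def field_simps)
  qed
  have mu1: "1 \<le> \<mu>" using mu_ge \<epsilon> by simp
  have mu_le: "\<mu> \<le> l"
  proof -
    have "Q \<le> W * l" using Q_le nW l0 by (smt (verit) mult_right_mono)
    then show ?thesis using W_pos by (simp add: \<mu>_def field_simps)
  qed
  have Q_ge: "real n \<le> Q" using mu1 W_pos nW by (simp add: \<mu>_def field_simps)
  have W_le: "W \<le> real n * l"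
  proof -
    have "W \<le> Q" using mu1 W_pos by (simp add: \<mu>_def)
    then show ?thesis using Q_le by simp
  qed

  have "\<mu> \<le> s / l ^ c"
  proof -
    have "l * l ^ c \<le> s" using big'[of "Suc c"] pos[of "Suc c"] k by simp
    then have "l \<le> s / l ^ c" using pos[of c] by (simp add: field_simps)
    then show ?thesis using mu_le by simp
  qed
  \<comment> \<open>Being the last radius below the bound, \<open>r\<close> leaves \<open>M\<close>
    at most one factor \<mu> short of it, and this is at most \<open>l\<close>.\<close>
  then obtain r where r1: "1 \<le> r" and Mle: "\<mu> ^ r \<le> s / l ^ c" and Mgt: "s / l ^ c < \<mu> ^ Suc r"
    using exists_power_bracket[of \<mu> "s / l ^ c"] mu_ge \<epsilon> by auto
  define M where "M = \<mu> ^ r"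
  have M1: "1 \<le> M" unfolding M_def using mu1 by (rule one_le_power)
  have M_ge: "s / l ^ (c + 1) \<le> M"
  proof -
    have "s / l ^ c \<le> \<mu> * M" using Mgt by (simp add: M_def)
    also have "\<dots> \<le> l * M" using mu_le M1 by (intro mult_right_mono) auto
    finally have "s / l ^ c \<le> l * M" .
    then show ?thesis using l0 by (simp add: field_simps)
  qed
  have M_le: "M * l ^ c \<le> s" using Mle pos[of c] by (simp add: M_def field_simps)
  have M_le': "M * l ^ i \<le> s" if "i \<le> c" for i
    using mult_left_mono[OF pw[OF that], of M] M1 M_le by linarith
  have r_le: "real (Suc r) \<le> l\<^sup>2"
  proof -
    have "(1 + \<epsilon>) ^ r \<le> M" unfolding M_def using mu_ge \<epsilon> by (intro power_mono) auto
    also have "\<dots> \<le> s" using M_le'[of 0] by simp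
    also have "\<dots> \<le> real n" using s1 n by (simp add: mult_le_cancel_right1)
    finally have "ln ((1 + \<epsilon>) ^ r) \<le> l" unfolding l using np \<epsilon> by (subst ln_le_cancel_iff) auto
    then have "real r * ln (1 + \<epsilon>) \<le> l" using \<epsilon> by (simp add: ln_realpow)
    moreover have "0 < ln (1 + \<epsilon>)" using \<epsilon> by simp
    ultimately have "real r \<le> l / ln (1 + \<epsilon>)" by (simp add: field_simps)
    then show ?thesis using \<epsilon> by simp
  qed
  have l2: "64 \<le> l\<^sup>2" "4096 \<le> l\<^sup>2" using power_mono[OF l(2), of 2] by auto

  \<comment> \<open>\<open>V\<close> is \<open>l\<close> times the bound on the expected volume of a
    ball around a vertex of weight \<open>2 * L\<close>, so Markov's inequality fails with
    probability at most \<open>1 / l\<close>. At most \<open>l\<^sup>2\<close> steps with loss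
    \<open>2 * \<eta>\<close> sum to at most \<open>4 / l\<close>.\<close>
  define K L V \<eta> where "K = l ^ a" and "L = l ^ b" and "V = 2 * L * real (Suc r) * M * l" and "\<eta> = 2 / l ^ 3"
  have K1: "1 \<le> K" and L1: "1 \<le> L" unfolding K_def L_def using one_le_power[OF l1] by auto
  have V0: "0 < V" unfolding V_def using L1 M1 l0 by simp
  have V_le: "V \<le> s"
  proof -
    have "V \<le> 2 * L * l\<^sup>2 * M * l" unfolding V_def
      using r_le L1 M1 l0 by (intro mult_right_mono mult_left_mono) auto
    also have "\<dots> = M * l ^ (b + 3) * 2" by (simp add: L_def power_add power2_eq_square power3_eq_cube)
    also have "\<dots> \<le> M * l ^ (b + 3) * l" using M1 l pos by (intro mult_left_mono) auto
    also have "\<dots> = M * l ^ (b + 4)" by (simp add: power_add power3_eq_cube power4_eq_xxxx)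
    also have "\<dots> \<le> s" using c by (intro M_le') simp
    finally show ?thesis .
  qed
  have eta0: "0 < \<eta>" using l0 by (simp add: \<eta>_def)
  have l3: "64 \<le> l ^ 3" using pw[of 1 3] l by simp
  have eta4: "\<eta> \<le> 1 / 4" using l3 l0 by (simp add: \<eta>_def field_simps)
  have loss: "V * K / W + ((\<Sum>y | y < n \<and> K < w y. (w y)\<^sup>2) + K * V) / Q \<le> \<eta>"
  proof -
    have aux: "V * K / real n \<le> 1 / (2 * l ^ 3)"
    proof -
      have "V * K * (2 * l ^ 3) \<le> s * l ^ a * (2 * l ^ 3)"
        unfolding K_def using V_le l0 by (intro mult_right_mono) auto
      moreover have "2 * l ^ (a + 3) \<le> s" using big'[of "a + 3"] pos[of "a + 3"] k c g b by simp
      then have "s * l ^ a * (2 * l ^ 3) \<le> s * s"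
        using s0 by (simp add: power_add mult_ac mult_left_mono)
      ultimately have "V * K * (2 * l ^ 3) \<le> s * s" by (rule order_trans)
      then show ?thesis using np l0 by (simp add: n field_simps)
    qed
    have "V * K / W \<le> V * K / real n" using nW np V0 K1 by (intro divide_left_mono) auto
    moreover have "((\<Sum>y | y < n \<and> K < w y. (w y)\<^sup>2) + K * V) / Q \<le> (real n / l ^ 3 + K * V) / real n"
      using tail Q_ge np K1 V0 l0 unfolding K_def by (intro frac_le) auto
    moreover have "(real n / l ^ 3 + K * V) / real n = 1 / l ^ 3 + V * K / real n"
      using np by (simp add: add_divide_distrib mult.commute)
    moreover have "1 / (2 * l ^ 3) + 1 / (2 * l ^ 3) = 1 / l ^ 3" by simp
    moreover have "\<eta> = 1 / l ^ 3 + 1 / l ^ 3" by (simp add: \<eta>_def)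
    ultimately show ?thesis using aux by linarith
  qed
  have half: "1 / 2 \<le> (1 - 2 * \<eta>) ^ r"
  proof -
    have "1 + real r * (- (2 * \<eta>)) \<le> (1 + - (2 * \<eta>)) ^ r"
      using eta4 by (intro Bernoulli_inequality) auto
    moreover have "real r * (2 * \<eta>) \<le> 1 / 2"
    proof -
      have "real r * (2 * \<eta>) \<le> l\<^sup>2 * (2 * \<eta>)" using r_le eta0 by (intro mult_right_mono) auto
      also have "\<dots> = 4 / l" using l0 by (simp add: \<eta>_def power2_eq_square power3_eq_cube)
      also have "\<dots> \<le> 1 / 2" using l by (simp add: field_simps)
      finally show ?thesis .
    qed
    ultimately show ?thesis by simp
  qed
  have VL: "V * (2 * L) / W \<le> 1 / 2"
  proof -
    have "4 * L \<le> s" unfolding L_def using big'[of b] pos[of b] k c by simp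
    then have "V * (4 * L) \<le> s * s" using V_le V0 L1 s0 by (intro mult_mono) auto
    then show ?thesis using nW n W_pos by (simp add: field_simps)
  qed
  have VH: "V / L \<le> real (card {x. x < n \<and> L \<le> w x \<and> w x \<le> 2 * L}) / 2"
  proof -
    have "V / L \<le> V / 1" using L1 V0 by (intro divide_left_mono) auto
    then have VL1: "V / L \<le> V" by simp
    have "s * (2 * l ^ h) \<le> s * s"
      using big'[of h] pos[of h] k s0 by (intro mult_left_mono) auto
    then have "s \<le> real n / l ^ h / 2" using pos[of h] by (simp add: n field_simps)
    note VL1
    also note V_le
    also note \<open>s \<le> real n / l ^ h / 2\<close>
    also have "real n / l ^ h / 2 \<le> real (card {x. x < n \<and> L \<le> w x \<and> w x \<le> 2 * L}) / 2"
      unfolding L_def by (rule divide_right_mono[OF H_ge]) simp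
    finally show ?thesis .
  qed
  interpret growth_parameters n w K L V \<eta> r
    by unfold_locales fact+

  have H_ge': "real n / l ^ h \<le> real (card H)" unfolding H_def using H_ge by (simp add: L_def)
  have H_le: "real (card H) \<le> real n" using card_mono[OF _ H_subset] by simp
  have mr: "M \<le> l * \<mu> ^ (r - 1)"
  proof -
    have "M = \<mu> * \<mu> ^ (r - 1)" unfolding M_def using r1 by (cases r) auto
    then show ?thesis using mu_le mu1 by (simp add: mult_right_mono)
  qed
  have mr': "\<mu> ^ (r - 1) \<le> M" unfolding M_def using mu1 by (intro power_increasing) auto
  have Rm_ge: "M / (16 * l ^ (h + 2)) \<le> Rm"
  proof -
    have "M / (16 * l ^ (h + 2)) = (real n / l ^ h) * 1 * (M / l) / (16 * (real n * l))"
      using np l0 by (simp add: power_add power2_eq_square)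
    also have "\<dots> \<le> real (card H) * L\<^sup>2 * \<mu> ^ (r - 1) / (16 * W)"
    proof (rule frac_le)
      show "real n / l ^ h * 1 * (M / l) \<le> real (card H) * L\<^sup>2 * \<mu> ^ (r - 1)"
        using H_ge' mr l0 M1 mu1 L1 one_le_power[OF L1, of 2] np
        by (intro mult_mono) (auto simp: field_simps)
    qed (use W_le W_pos H_pos L1 mu1 in auto)
    finally show ?thesis by (simp add: Rm_def)
  qed
  have rate_eq: "rate = 1 / (4 * real (Suc r) * M * l)"
  proof -
    have "rate = L / (2 * V)" by (rule rate_def)
    then show ?thesis unfolding V_def using L1 by simp
  qed
  have rate_ge: "1 / (4 * l ^ 3 * M) \<le> rate"
  proof -
    have "4 * real (Suc r) * M * l \<le> 4 * l\<^sup>2 * M * l"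
      using r_le M1 l0 by (intro mult_right_mono mult_left_mono) auto
    also have "\<dots> = 4 * l ^ 3 * M" by (simp add: power2_eq_square power3_eq_cube)
    finally show ?thesis unfolding rate_eq using M1 l0 by (intro divide_left_mono) auto
  qed
  have rate_le: "rate \<le> 1 / M"
  proof -
    have "1 * 1 \<le> (4 * real (Suc r)) * l" using l1 by (intro mult_mono) auto
    then have "1 * M \<le> (4 * real (Suc r) * l) * M" using M1 by (intro mult_right_mono) auto
    then have "M \<le> 4 * real (Suc r) * M * l" by (simp only: mult_ac mult_1)
    then show ?thesis unfolding rate_eq using M1 l0 by (intro divide_left_mono) auto
  qed
  have rate1: "rate \<le> 1" using rate_le M1 by (smt (verit) divide_le_eq_1)
  have \<kappa>_ge: "1 / l ^ q \<le> \<kappa>"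
  proof -
    have "(M / (16 * l ^ (h + 2))) * (1 / (4 * l ^ 3 * M)) \<le> Rm * rate"
      using Rm_ge rate_ge M1 l0 Rm_pos by (intro mult_mono) auto
    moreover have "(M / (16 * l ^ (h + 2))) * (1 / (4 * l ^ 3 * M)) = 1 / (64 * l ^ (h + 5))"
    proof -
      have "h + 5 = (h + 2) + 3" by simp
      then show ?thesis using M1 by (simp only: power_add) simp
    qed
    ultimately have "1 / (512 * l ^ (h + 5)) \<le> \<kappa>" by (simp add: \<kappa>_def)
    moreover have "512 * l ^ (h + 5) \<le> l ^ q"
    proof -
      have "q = 2 + (h + 5)" using q by simp
      then have "l ^ q = l\<^sup>2 * l ^ (h + 5)" by (simp only: power_add)
      then show ?thesis using l2 pos[of "h + 5"] by simp
    qed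
    then have "1 / l ^ q \<le> 1 / (512 * l ^ (h + 5))" using pos by (intro divide_left_mono) auto
    ultimately show ?thesis by linarith
  qed
  have fb: "fail_bound \<le> 3 / l"
  proof -
    have f1: "2 * L * real (Suc r) * \<mu> ^ r / V = 1 / l"
      unfolding V_def M_def using L1 mu1 l0 by simp
    \<comment> \<open>This fixes \<open>b = a + 9\<close>: the factor
      \<open>1 / \<eta>\<^sup>2\<close> costs six powers of \<open>l\<close>, the number of steps
      two, and one is the gain.\<close>
    have f2: "real r * (2 * K / (\<eta>\<^sup>2 * L)) \<le> 1 / l"
    proof -
      have "2 * K / (\<eta>\<^sup>2 * L) = 2 * K * l ^ 6 / (4 * L)"
        unfolding \<eta>_def by (simp add: power_divide power_mult[symmetric])
      also have "\<dots> = 1 / (2 * l ^ 3)"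
      proof -
        have "b = a + 6 + 3" using b by simp
        then have "L = K * l ^ 6 * l ^ 3" by (simp only: L_def K_def power_add)
        then show ?thesis using K1 l0 by (simp add: field_simps)
      qed
      finally have "real r * (2 * K / (\<eta>\<^sup>2 * L)) \<le> l\<^sup>2 * (1 / (2 * l ^ 3))"
        using r_le l0 by (simp only:) (intro mult_right_mono, auto)
      also have "\<dots> \<le> 1 / l" using l0 by (simp add: power2_eq_square power3_eq_cube field_simps)
      finally show ?thesis .
    qed
    have f3: "2 / Rm \<le> 1 / l"
    proof -
      have "s / l ^ (c + 1) / (16 * l ^ (h + 2)) \<le> Rm"
        using order_trans[OF divide_right_mono[OF M_ge, of "16 * l ^ (h + 2)"] Rm_ge] l0 by simp
      moreover have "s / l ^ (c + 1) / (16 * l ^ (h + 2)) = s / (16 * l ^ (c + h + 3))"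
        by (simp add: power_add power3_eq_cube power2_eq_square mult_ac)
      moreover have "2 * l \<le> s / (16 * l ^ (c + h + 3))"
      proof -
        have "32 * l ^ (c + h + 4) \<le> s" using k by (intro big') simp
        moreover have "c + h + 4 = Suc (c + h + 3)" by simp
        then have "l ^ (c + h + 4) = l * l ^ (c + h + 3)" by (simp only: power_Suc)
        ultimately show ?thesis using pos[of "c + h + 3"] by (simp add: field_simps)
      qed
      ultimately have "2 * l \<le> Rm" by linarith
      then show ?thesis using l0 Rm_pos by (simp add: field_simps)
    qed
    have "fail_bound \<le> 1 / l + 1 / l + 1 / l"
      unfolding fail_bound_def f1 by (intro add_mono order_refl f2 f3)
    then show ?thesis by simp
  qed
  \<comment> \<open>By \<open>c1\<close> and the choice of \<open>g\<close>, far layers above this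
    size hold at most half of the typical incidences counted in
    \<open>typical_incidences_ge\<close>.\<close>
  define R where "R = M * l ^ g"
  have R0: "0 < R" using M1 pos by (simp add: R_def)
  have far_le: "far_sq \<le> M\<^sup>2 * l ^ (2 * b + 3)"
  proof -
    have KL: "K \<le> L" unfolding K_def L_def using b by (intro pw) simp
    have LL: "L \<le> L\<^sup>2" "1 \<le> L\<^sup>2" using L1 by (auto simp: power2_eq_square mult_le_cancel_left1 intro: order_trans)
    have "\<mu> ^ (2 * (r - 1)) \<le> M\<^sup>2"
      unfolding power_mult[symmetric] M_def using mu1 by (simp add: power_mult[symmetric] power_increasing)
    moreover have "4 * L\<^sup>2 + real r * K * (2 * L) \<le> 4 * L\<^sup>2 + 2 * l\<^sup>2 * L\<^sup>2"
    proof -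
      have "real r * K * (2 * L) \<le> l\<^sup>2 * L * (2 * L)"
        using r_le KL K1 L1 by (intro mult_mono) auto
      then show ?thesis by (simp add: power2_eq_square)
    qed
    ultimately have "\<mu> ^ (2 * (r - 1)) * (4 * L\<^sup>2 + real r * K * (2 * L)) \<le> M\<^sup>2 * (4 * L\<^sup>2 + 2 * l\<^sup>2 * L\<^sup>2)"
      using mu1 K1 L1 by (intro mult_mono) auto
    moreover have "2 * L * \<mu> ^ (r - 1) \<le> M\<^sup>2 * (2 * L\<^sup>2)"
    proof -
      have "2 * L * \<mu> ^ (r - 1) \<le> 2 * L\<^sup>2 * M" using LL mr' mu1 L1 by (intro mult_mono) auto
      also have "\<dots> \<le> 2 * L\<^sup>2 * M\<^sup>2"
        using M1 LL by (intro mult_left_mono) (auto simp: power2_eq_square mult_le_cancel_left1)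
      finally show ?thesis by (simp add: mult_ac)
    qed
    ultimately have "far_sq \<le> M\<^sup>2 * (L\<^sup>2 * (6 + 2 * l\<^sup>2))"
      unfolding far_sq_def by (simp add: algebra_simps)
    also have "\<dots> \<le> M\<^sup>2 * (L\<^sup>2 * (l * l\<^sup>2))"
    proof -
      have "6 + 2 * l\<^sup>2 \<le> 3 * l\<^sup>2" using l2 by simp
      also have "\<dots> \<le> l * l\<^sup>2" using l by (intro mult_right_mono) auto
      finally show ?thesis by (intro mult_left_mono) auto
    qed
    also have "\<dots> = M\<^sup>2 * l ^ (2 * b + 3)"
    proof -
      have "L\<^sup>2 = l ^ (2 * b)" by (simp only: L_def power_mult[symmetric] mult.commute)
      moreover have "l * l\<^sup>2 = l ^ 3" by (simp add: power2_eq_square power3_eq_cube)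
      ultimately show ?thesis by (simp only: power_add)
    qed
    finally show ?thesis .
  qed
  have c1: "l * far_sq / R \<le> Rm / 4"
  proof -
    have "l * far_sq / R \<le> l * (M\<^sup>2 * l ^ (2 * b + 3)) / R"
      using far_le l0 R0 by (intro divide_right_mono mult_left_mono) auto
    also have "\<dots> = M * l ^ (2 * b + 4) / l ^ g"
    proof -
      have "2 * b + 4 = 1 + (2 * b + 3)" by simp
      then have "l ^ (2 * b + 4) = l * l ^ (2 * b + 3)" by (simp only: power_add power_one_right)
      then show ?thesis using M1 by (simp add: R_def power2_eq_square)
    qed
    also have "\<dots> \<le> M / (64 * l ^ (h + 2))"
    proof -
      have "64 * l ^ (2 * b + 4) * l ^ (h + 2) \<le> l * l ^ (2 * b + 4) * l ^ (h + 2)"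
        using l pos by (intro mult_right_mono) auto
      also have "\<dots> = l ^ g"
      proof -
        have "g = 1 + (2 * b + 4) + (h + 2)" using g by simp
        then show ?thesis by (simp only: power_add power_one_right)
      qed
      finally have "M * (64 * l ^ (2 * b + 4) * l ^ (h + 2)) \<le> M * l ^ g" using M1 by (intro mult_left_mono) auto
      then have "M * l ^ (2 * b + 4) * (64 * l ^ (h + 2)) \<le> M * l ^ g" by (simp only: mult_ac)
      then show ?thesis using pos[of g] pos[of "h + 2"] by (subst frac_le_iff) auto
    qed
    also have "\<dots> \<le> Rm / 4" using Rm_ge by simp
    finally show ?thesis .
  qed
  \<comment> \<open>This fixes \<open>c\<close>: the left side is \<open>M\<^sup>2\<close> up to
    powers of \<open>l\<close>, the right side is at least \<open>n\<close> over
    \<open>l ^ (3 * q + h)\<close>, so \<open>M\<close> must stay below the square root of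
    \<open>n\<close> by enough powers.\<close>
  have c2: "64 * R\<^sup>2 * (rate + rate\<^sup>2 * (l * close_bound)) \<le> \<kappa> ^ 3 * real (card H)"
  proof -
    have cb: "close_bound \<le> 4 * l ^ 3 * M\<^sup>2"
    proof -
      have "close_bound = 4 * real (Suc r) * (M\<^sup>2 * \<mu>)"
        by (simp add: close_bound_def M_def power_mult[symmetric] mult.commute[of r])
      also have "\<dots> \<le> 4 * l\<^sup>2 * (M\<^sup>2 * l)"
        using r_le mu_le mu1 l0 by (intro mult_mono mult_left_mono) auto
      finally show ?thesis by (simp add: power2_eq_square power3_eq_cube mult_ac)
    qed
    have "rate\<^sup>2 * (l * close_bound) \<le> (1 / M)\<^sup>2 * (l * (4 * l ^ 3 * M\<^sup>2))"
    proof (intro mult_mono power_mono rate_le mult_left_mono cb)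
      show "0 \<le> close_bound" using mu1 by (simp add: close_bound_def)
      then show "0 \<le> l * close_bound" using l0 by simp
    qed (use rate_pos l0 in auto)
    also have "\<dots> = 4 * l ^ 4" using M1 by (simp add: power_divide power4_eq_xxxx power3_eq_cube)
    finally have "rate + rate\<^sup>2 * (l * close_bound) \<le> 5 * l ^ 4"
      using rate1 one_le_power[OF l1, of 4] by linarith
    then have "64 * R\<^sup>2 * (rate + rate\<^sup>2 * (l * close_bound)) \<le> 64 * R\<^sup>2 * (5 * l ^ 4)"
      by (intro mult_left_mono) auto
    also have "\<dots> = 320 * (M\<^sup>2 * l ^ (2 * g + 4))"
      by (simp add: R_def power_mult_distrib power_add power_mult[symmetric] mult.commute[of g])
    also have "\<dots> \<le> l\<^sup>2 * (M\<^sup>2 * l ^ (2 * g + 4))"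
      using l2 l0 by (intro mult_right_mono) auto
    also have "\<dots> = (M * l ^ (g + 3))\<^sup>2"
    proof -
      have "2 + (2 * g + 4) = (g + 3) * 2" by simp
      then have "l\<^sup>2 * l ^ (2 * g + 4) = (l ^ (g + 3))\<^sup>2"
        by (simp only: power_mult[symmetric] power_add[symmetric])
      then show ?thesis by (simp only: power_mult_distrib mult.left_commute)
    qed
    also have "\<dots> \<le> (s / l ^ (3 * q + h))\<^sup>2"
    proof (rule power_mono)
      have "M * l ^ ((g + 3) + (3 * q + h)) \<le> s" using c by (intro M_le') simp
      then show "M * l ^ (g + 3) \<le> s / l ^ (3 * q + h)"
        unfolding power_add[of l "g + 3" "3 * q + h"] using pos by (simp add: field_simps)
    qed (use M1 l0 in auto)
    also have "\<dots> = real n / (l ^ (3 * q + h) * l ^ (3 * q + h))" by (simp add: n power2_eq_square)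
    also have "\<dots> \<le> real n / (l ^ (3 * q + h) * 1)"
      using one_le_power[OF l1] np l0 by (intro divide_left_mono mult_left_mono) auto
    also have "\<dots> = (1 / l ^ q) ^ 3 * (real n / l ^ h)"
      by (simp add: power_divide power_mult[symmetric] power_add mult.commute[of q])
    also have "\<dots> \<le> \<kappa> ^ 3 * real (card H)"
      using \<kappa>_ge H_ge' l0 \<kappa>_pos by (intro mult_mono power_mono) auto
    finally show ?thesis .
  qed
  define B where "B = real n powr (3/2) / l ^ k"
  have B_eq: "B = s * s * s / l ^ k"
  proof -
    have "real n powr (3/2) = real n * real n powr (1/2)"
      using powr_add[of "real n" 1 "1/2"] by simp
    then show ?thesis using np by (simp add: B_def powr_half_sqrt s_def)
  qed
  have B0: "0 < B" using s0 l0 by (simp add: B_eq)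
  \<comment> \<open>\<open>X\<close> bounds from below the exponent gained from absent edges.
    Counting the labels and the size of the sample cost at most \<open>X / 4\<close> each, so at
    least \<open>X / 2\<close>, hence at least \<open>s\<close>, remains.\<close>
  define X where "X = real n / l ^ (2 * q + 2 * h + 3)"
  have kinv: "1 / \<kappa> \<le> l ^ q" using \<kappa>_ge \<kappa>_pos pos[of q] by (simp add: field_simps)
  have rate_s: "rate \<le> l ^ (c + 1) / s"
  proof -
    have "1 / M \<le> 1 / (s / l ^ (c + 1))" using M_ge s0 M1 l0 by (intro divide_left_mono) auto
    then show ?thesis using rate_le by simp
  qed
  have rk: "rate / \<kappa> \<le> l ^ (c + 1 + q) / s"
  proof -
    have "rate * (1 / \<kappa>) \<le> (l ^ (c + 1) / s) * l ^ q"
      using rate_s kinv rate_pos \<kappa>_pos s0 l0 by (intro mult_mono) auto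
    then show ?thesis by (simp add: power_add)
  qed
  have e1: "8 * rate * B / \<kappa> * ln (2 * real A) \<le> X / 4"
  proof -
    have "8 * rate * B / \<kappa> * ln (2 * real A) = 8 * (rate / \<kappa>) * B * ln (2 * real A)" by simp
    also have "\<dots> \<le> 8 * (l ^ (c + 1 + q) / s) * B * (4 * l)"
      using rk A B0 l0 s0 rate_pos \<kappa>_pos by (intro mult_mono mult_left_mono mult_right_mono) auto
    also have "\<dots> = 32 * l ^ (c + q + 2) * (s * s) / l ^ k"
      using s0 by (simp add: B_eq power_add power2_eq_square field_simps)
    also have "\<dots> \<le> X / 4"
    proof -
      have "128 * (l ^ (c + q + 2) * l ^ (2 * q + 2 * h + 3)) \<le> l\<^sup>2 * (l ^ (c + q + 2) * l ^ (2 * q + 2 * h + 3))"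
        using l2 l0 by (intro mult_right_mono) auto
      also have "\<dots> = l ^ (2 + ((c + q + 2) + (2 * q + 2 * h + 3)))" by (simp only: power_add)
      also have "\<dots> \<le> l ^ k" using k by (intro pw) simp
      finally have "real n * (128 * (l ^ (c + q + 2) * l ^ (2 * q + 2 * h + 3))) \<le> real n * l ^ k"
        using np by (intro mult_left_mono) auto
      then show ?thesis using pos unfolding X_def n by (simp add: field_simps)
    qed
    finally show ?thesis .
  qed
  have e2: "8 * rate * real (card H) / \<kappa> \<le> X / 4"
  proof -
    have "8 * rate * real (card H) / \<kappa> = 8 * (rate / \<kappa>) * real (card H)" by simp
    also have "\<dots> \<le> 8 * (l ^ (c + 1 + q) / s) * (s * s)"
      using rk H_le n s0 l0 rate_pos \<kappa>_pos by (intro mult_mono mult_left_mono) auto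
    also have "\<dots> = 8 * l ^ (c + 1 + q) * s" using s0 by simp
    also have "\<dots> \<le> X / 4"
    proof -
      have "32 * l ^ ((c + 1 + q) + (2 * q + 2 * h + 3)) \<le> s" using k by (intro big') simp
      then have "s * (32 * (l ^ (c + 1 + q) * l ^ (2 * q + 2 * h + 3))) \<le> s * s"
        using s0 unfolding power_add[of l "c + 1 + q" "2 * q + 2 * h + 3"] by (intro mult_left_mono) auto
      then show ?thesis using pos unfolding X_def n by (simp add: field_simps)
    qed
    finally show ?thesis .
  qed
  have e3: "X \<le> \<kappa>\<^sup>2 * (real (card H))\<^sup>2 / (16 * W)"
  proof -
    have "X = real n / (l ^ (2 * q + 2 * h + 1) * l\<^sup>2)"
      by (simp add: X_def power_add[symmetric] numeral_3_eq_3)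
    also have "\<dots> \<le> real n / (l ^ (2 * q + 2 * h + 1) * 16)"
      using l2 np l0 by (intro divide_left_mono mult_left_mono) auto
    also have "\<dots> = (1 / l ^ q)\<^sup>2 * (real n / l ^ h)\<^sup>2 / (16 * (real n * l))"
    proof -
      have "2 * q + 2 * h + 1 = q + q + h + h + 1" by simp
      then have "l ^ (2 * q + 2 * h + 1) = l ^ q * l ^ q * l ^ h * l ^ h * l"
        by (simp only: power_add power_one_right)
      moreover have "real n / (u * u * v * v * l * 16) = (1 / u)\<^sup>2 * (real n / v)\<^sup>2 / (16 * (real n * l))" for u v
        using np by (simp add: power2_eq_square)
      ultimately show ?thesis by (simp only:)
    qed
    also have "\<dots> \<le> \<kappa>\<^sup>2 * (real (card H))\<^sup>2 / (16 * W)"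
      using \<kappa>_ge H_ge' W_le W_pos l0 np \<kappa>_pos by (intro frac_le mult_mono power_mono) auto
    finally show ?thesis .
  qed
  have X_s: "2 * s \<le> X"
  proof -
    have "2 * l ^ (2 * q + 2 * h + 3) \<le> s" using big'[of "2 * q + 2 * h + 3"] pos[of "2 * q + 2 * h + 3"] k by simp
    then have "s * (2 * l ^ (2 * q + 2 * h + 3)) \<le> s * s" using s0 by (intro mult_left_mono) auto
    then show ?thesis using pos by (simp add: X_def n field_simps)
  qed
  have last: "8 / \<kappa> * exp (8 * rate * B / \<kappa> * ln (2 * real A) + 8 * rate * real (card H) / \<kappa>
       - \<kappa>\<^sup>2 * (real (card H))\<^sup>2 / (16 * W)) \<le> 1 / l"
  proof -
    have "exp (8 * rate * B / \<kappa> * ln (2 * real A) + 8 * rate * real (card H) / \<kappa>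
       - \<kappa>\<^sup>2 * (real (card H))\<^sup>2 / (16 * W)) \<le> exp (- s)"
      using e1 e2 e3 X_s by simp
    also have "\<dots> \<le> 1 / s"
    proof -
      have "s \<le> exp s" using exp_ge_add_one_self[of s] by linarith
      then show ?thesis unfolding exp_minus inverse_eq_divide using s0 by (intro frac_le) auto
    qed
    finally have "8 / \<kappa> * exp (8 * rate * B / \<kappa> * ln (2 * real A) + 8 * rate * real (card H) / \<kappa>
       - \<kappa>\<^sup>2 * (real (card H))\<^sup>2 / (16 * W)) \<le> 8 * l ^ q * (1 / s)"
      using kinv \<kappa>_pos l0 by (intro mult_mono) auto
    also have "\<dots> \<le> 1 / l"
    proof -
      have "8 * (l * l ^ q) \<le> s" using big'[of "Suc q"] pos[of "Suc q"] k by simp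
      then show ?thesis using s0 l0 by (simp add: field_simps)
    qed
    finally show ?thesis .
  qed
  have "prob\<^sub>G {e. short_labeling D Lab len B e} \<le> 2 * fail_bound + 2 / l + 1 / l"
    using prob_short_labeling_le[OF l0 R0 c1 rate1 c2 B0 W1 Lab A(1), of D] last by linarith
  also have "\<dots> \<le> 9 / l" using fb by simp
  finally show ?thesis unfolding short_labeling_def B_def .
qed

end

section \<open>Power law weights\<close>

context prob_space
begin

lemma iid_component:
  fixes g :: "'a \<Rightarrow> real" and n :: nat
  assumes [measurable]: "g \<in> borel_measurable M" and g: "integrable M g" and i: "i < n"
  shows "integrable (PiM {0..<n} (\<lambda>_. M)) (\<lambda>\<omega>. g (\<omega> i))"
    "(\<integral>\<omega>. g (\<omega> i) \<partial>PiM {0..<n} (\<lambda>_. M)) = (\<integral>t. g t \<partial>M)"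
proof -
  let ?N = "PiM {0..<n} (\<lambda>_. M)"
  have d: "distr ?N M (\<lambda>\<omega>. \<omega> i) = M"
    using i by (intro distr_PiM_component) (auto intro: prob_space_axioms)
  have m: "(\<lambda>\<omega>. \<omega> i) \<in> measurable ?N M" using i by simp
  show "integrable ?N (\<lambda>\<omega>. g (\<omega> i))"
    using g integrable_distr_eq[OF m, of g] unfolding d by simp
  show "(\<integral>\<omega>. g (\<omega> i) \<partial>?N) = (\<integral>t. g t \<partial>M)"
    using integral_distr[OF m, of g] unfolding d by simp
qed

lemma iid_product:
  fixes c :: "'a \<Rightarrow> real" and n :: nat
  assumes c: "integrable M c" and ij: "i < n" "j < n" "i \<noteq> j"
  shows "integrable (PiM {0..<n} (\<lambda>_. M)) (\<lambda>\<omega>. c (\<omega> i) * c (\<omega> j))"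
    "(\<integral>\<omega>. c (\<omega> i) * c (\<omega> j) \<partial>PiM {0..<n} (\<lambda>_. M)) = (\<integral>t. c t \<partial>M)\<^sup>2"
proof -
  \<comment> \<open>Padding with the constant 1 writes the integrand as a product over all
    coordinates, as Fubini for finite products expects.\<close>
  let ?f = "\<lambda>k t. if k = i \<or> k = j then c t else 1"
  interpret P: product_sigma_finite "\<lambda>_. M" by (rule product_sigma_finite.intro) (rule sigma_finite_measure_axioms)
  have int: "integrable M (?f k)" for k using c by (cases "k = i \<or> k = j") simp_all
  have p: "(\<Prod>k\<in>{0..<n}. h k) = h i * h j" if "\<And>k. k \<noteq> i \<Longrightarrow> k \<noteq> j \<Longrightarrow> h k = 1" for h :: "nat \<Rightarrow> real"
  proof -
    have "(\<Prod>k\<in>{0..<n}. h k) = (\<Prod>k\<in>{i, j}. h k)"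
      using ij that by (intro prod.mono_neutral_right) auto
    then show ?thesis using ij by simp
  qed
  have eq: "(\<Prod>k\<in>{0..<n}. ?f k (\<omega> k)) = c (\<omega> i) * c (\<omega> j)" for \<omega> :: "nat \<Rightarrow> 'a"
    using p[of "\<lambda>k. ?f k (\<omega> k)"] by simp
  show "integrable (PiM {0..<n} (\<lambda>_. M)) (\<lambda>\<omega>. c (\<omega> i) * c (\<omega> j))"
    using P.product_integrable_prod[of "{0..<n}" ?f] int unfolding eq by simp
  have "(\<integral>\<omega>. c (\<omega> i) * c (\<omega> j) \<partial>PiM {0..<n} (\<lambda>_. M)) = (\<Prod>k\<in>{0..<n}. integral\<^sup>L M (?f k))"
    using P.product_integral_prod[of "{0..<n}" ?f] int unfolding eq by simp
  also have "\<dots> = (\<integral>t. c t \<partial>M)\<^sup>2"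
    using p[of "\<lambda>k. integral\<^sup>L M (?f k)"] by (simp add: prob_space power2_eq_square)
  finally show "(\<integral>\<omega>. c (\<omega> i) * c (\<omega> j) \<partial>PiM {0..<n} (\<lambda>_. M)) = (\<integral>t. c t \<partial>M)\<^sup>2" .
qed

text \<open>Centring makes the mixed terms vanish, and the variance is bounded by the second
  moment.\<close>

lemma iid_chebyshev:
  fixes g :: "'a \<Rightarrow> real"
  assumes [measurable]: "g \<in> borel_measurable M" and g2: "integrable M (\<lambda>t. (g t)\<^sup>2)" and s: "0 < s"
  shows "measure (PiM {0..<n} (\<lambda>_. M)) {\<omega> \<in> space (PiM {0..<n} (\<lambda>_. M)).
      s \<le> \<bar>(\<Sum>i<n. g (\<omega> i)) - real n * (\<integral>t. g t \<partial>M)\<bar>} \<le> real n * (\<integral>t. (g t)\<^sup>2 \<partial>M) / s\<^sup>2"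
proof -
  let ?N = "PiM {0..<n} (\<lambda>_. M)"
  define m where "m = (\<integral>t. g t \<partial>M)"
  define c where "c t = g t - m" for t
  have gi: "integrable M g" using square_integrable_imp_integrable[OF _ g2] by simp
  have cm[measurable]: "c \<in> borel_measurable M" unfolding c_def by simp
  have ci: "integrable M c" unfolding c_def using gi by simp
  have c0: "(\<integral>t. c t \<partial>M) = 0" unfolding c_def using gi by (simp add: m_def prob_space)
  have c2eq: "(\<lambda>t. (c t)\<^sup>2) = (\<lambda>t. (g t)\<^sup>2 - 2 * m * g t + m\<^sup>2)"
    unfolding c_def by (auto simp: power2_diff algebra_simps)
  have c2i: "integrable M (\<lambda>t. (c t)\<^sup>2)" unfolding c2eq using g2 gi by simp
  have c2: "(\<integral>t. (c t)\<^sup>2 \<partial>M) \<le> (\<integral>t. (g t)\<^sup>2 \<partial>M)"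
  proof -
    have "(\<integral>t. (c t)\<^sup>2 \<partial>M) = (\<integral>t. (g t)\<^sup>2 \<partial>M) - 2 * m * m + m\<^sup>2"
      unfolding c2eq using g2 gi by (simp add: prob_space m_def)
    then show ?thesis by (simp add: power2_eq_square)
  qed
  have int: "integrable ?N (\<lambda>\<omega>. c (\<omega> i) * c (\<omega> j))"
    and E: "(\<integral>\<omega>. c (\<omega> i) * c (\<omega> j) \<partial>?N) = (if i = j then (\<integral>t. (c t)\<^sup>2 \<partial>M) else 0)"
    if "i \<in> {..<n}" "j \<in> {..<n}" for i j
    using that iid_component[of "\<lambda>t. (c t)\<^sup>2" i n] iid_product[OF ci, of i n j] c2i c0
    by (cases "i = j"; simp add: power2_eq_square)+
  have sq: "(\<Sum>i<n. c (\<omega> i))\<^sup>2 = (\<Sum>i<n. \<Sum>j<n. c (\<omega> i) * c (\<omega> j))" for \<omega>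
    by (simp add: power2_eq_square sum_product)
  have S2i: "integrable ?N (\<lambda>\<omega>. (\<Sum>i<n. c (\<omega> i))\<^sup>2)"
    unfolding sq by (intro Bochner_Integration.integrable_sum int)
  have "(\<integral>\<omega>. (\<Sum>i<n. c (\<omega> i))\<^sup>2 \<partial>?N) = (\<Sum>i<n. \<Sum>j<n. \<integral>\<omega>. c (\<omega> i) * c (\<omega> j) \<partial>?N)"
  proof -
    have "(\<integral>\<omega>. (\<Sum>i<n. c (\<omega> i))\<^sup>2 \<partial>?N) = (\<Sum>i<n. \<integral>\<omega>. (\<Sum>j<n. c (\<omega> i) * c (\<omega> j)) \<partial>?N)"
      unfolding sq by (intro Bochner_Integration.integral_sum Bochner_Integration.integrable_sum int)
    also have "\<dots> = (\<Sum>i<n. \<Sum>j<n. \<integral>\<omega>. c (\<omega> i) * c (\<omega> j) \<partial>?N)"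
      by (intro sum.cong refl Bochner_Integration.integral_sum int)
    finally show ?thesis .
  qed
  also have "\<dots> = (\<Sum>i<n. \<Sum>j<n. if i = j then (\<integral>t. (c t)\<^sup>2 \<partial>M) else 0)"
    by (intro sum.cong refl E)
  also have "\<dots> = real n * (\<integral>t. (c t)\<^sup>2 \<partial>M)" by (simp add: sum.delta')
  also have "\<dots> \<le> real n * (\<integral>t. (g t)\<^sup>2 \<partial>M)" using c2 by (intro mult_left_mono) auto
  finally have ES: "(\<integral>\<omega>. (\<Sum>i<n. c (\<omega> i))\<^sup>2 \<partial>?N) \<le> real n * (\<integral>t. (g t)\<^sup>2 \<partial>M)" .
  have csum: "(\<Sum>i<n. c (\<omega> i)) = (\<Sum>i<n. g (\<omega> i)) - real n * m" for \<omega>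
    by (simp add: c_def sum_subtractf)
  have "{\<omega> \<in> space ?N. s \<le> \<bar>(\<Sum>i<n. g (\<omega> i)) - real n * m\<bar>} = {\<omega> \<in> space ?N. s\<^sup>2 \<le> (\<Sum>i<n. c (\<omega> i))\<^sup>2}"
    unfolding csum using s by (auto simp: abs_le_square_iff[symmetric])
  then have "measure ?N {\<omega> \<in> space ?N. s \<le> \<bar>(\<Sum>i<n. g (\<omega> i)) - real n * m\<bar>} \<le> (\<integral>\<omega>. (\<Sum>i<n. c (\<omega> i))\<^sup>2 \<partial>?N) / s\<^sup>2"
    using integral_Markov_inequality_measure[OF S2i sets.empty_sets, of "s\<^sup>2"] s by simp
  also have "\<dots> \<le> real n * (\<integral>t. (g t)\<^sup>2 \<partial>M) / s\<^sup>2" using ES by (intro divide_right_mono) auto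
  finally show ?thesis unfolding m_def .
qed

lemma iid_markov:
  fixes g :: "'a \<Rightarrow> real"
  assumes [measurable]: "g \<in> borel_measurable M" and gi: "integrable M g" and nn: "\<And>t. 0 \<le> g t" and s: "0 < s"
  shows "measure (PiM {0..<n} (\<lambda>_. M)) {\<omega> \<in> space (PiM {0..<n} (\<lambda>_. M)). s \<le> (\<Sum>i<n. g (\<omega> i))}
     \<le> real n * (\<integral>t. g t \<partial>M) / s"
proof -
  let ?N = "PiM {0..<n} (\<lambda>_. M)"
  have "(\<integral>\<omega>. (\<Sum>i<n. g (\<omega> i)) \<partial>?N) = real n * (\<integral>t. g t \<partial>M)"
    using iid_component[of g _ n] gi by (simp add: Bochner_Integration.integral_sum)
  moreover have "integrable ?N (\<lambda>\<omega>. \<Sum>i<n. g (\<omega> i))"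
    using iid_component(1)[of g _ n] gi by (intro Bochner_Integration.integrable_sum) auto
  ultimately show ?thesis
    using integral_Markov_inequality_measure[of ?N "\<lambda>\<omega>. \<Sum>i<n. g (\<omega> i)" "{}" s] s nn
    by (auto intro!: sum_nonneg)
qed

end

section \<open>Moments and tails of the power law\<close>

lemma pl_density_measurable [measurable]: "pl_density xmin \<beta> \<in> borel_measurable borel"
  unfolding pl_density_def by measurable

lemma sets_pl_weight_dist [measurable_cong, simp]: "sets (pl_weight_dist xmin \<beta>) = sets borel"
  by (simp add: pl_weight_dist_def)

lemma space_pl_weight_dist [simp]: "space (pl_weight_dist xmin \<beta>) = UNIV"
  by (simp add: pl_weight_dist_def)

locale power_law =
  fixes xmin \<beta> :: real
  assumes xmin_pos: "0 < xmin" and \<beta>3: "3 < \<beta>"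
begin

abbreviation "\<D> \<equiv> pl_weight_dist xmin \<beta>"

definition Z where "Z = (\<beta> - 1) * xmin powr (\<beta> - 1)"

lemma Z_pos: "0 < Z" using xmin_pos \<beta>3 by (simp add: Z_def)

lemma pl_density_nonneg: "0 \<le> pl_density xmin \<beta> t"
  using \<beta>3 by (simp add: pl_density_def)

text \<open>The exponent 0 gives tail probabilities, the exponent 2 the truncated second moment;
  convergence of the latter is where \<beta> > 3 enters.\<close>

lemma nn_integral_powr_tail:
  assumes a: "xmin \<le> a" and p: "p + 1 < \<beta>"
  shows "(\<integral>\<^sup>+ t. ennreal (t powr p) * indicator {a..} t \<partial>\<D>) = ennreal (Z * a powr (p + 1 - \<beta>) / (\<beta> - 1 - p))"
proof -
  define F where "F t = - (Z / (\<beta> - 1 - p)) * t powr (p + 1 - \<beta>)" for t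
  have a0: "0 < a" using a xmin_pos by simp
  have "(\<integral>\<^sup>+ t. ennreal (t powr p) * indicator {a..} t \<partial>\<D>) =
    (\<integral>\<^sup>+ t. ennreal (pl_density xmin \<beta> t) * (ennreal (t powr p) * indicator {a..} t) \<partial>lborel)"
    unfolding pl_weight_dist_def by (subst nn_integral_density) auto
  also have "\<dots> = (\<integral>\<^sup>+ t. ennreal (Z * t powr (p - \<beta>)) * indicator {a..} t \<partial>lborel)"
  proof (intro nn_integral_cong)
    fix t :: real
    have "pl_density xmin \<beta> t * t powr p = Z * t powr (p - \<beta>)" if "a \<le> t"
      using that a a0 by (simp add: pl_density_def Z_def powr_diff powr_minus field_simps)
    then show "ennreal (pl_density xmin \<beta> t) * (ennreal (t powr p) * indicator {a..} t) =
        ennreal (Z * t powr (p - \<beta>)) * indicator {a..} t"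
      by (auto simp: indicator_def ennreal_mult'[symmetric] pl_density_nonneg)
  qed
  also have "\<dots> = ennreal (0 - F a)"
  proof (rule nn_integral_FTC_atLeast)
    fix x assume "a \<le> x"
    then have x: "0 < x" using a0 by simp
    have "DERIV F x :> - (Z / (\<beta> - 1 - p)) * ((p + 1 - \<beta>) * x powr (p + 1 - \<beta> - 1))"
      unfolding F_def by (intro DERIV_cmult has_real_derivative_powr x)
    moreover have "- (Z / (\<beta> - 1 - p)) * ((p + 1 - \<beta>) * x powr (p + 1 - \<beta> - 1)) = Z * x powr (p - \<beta>)"
    proof -
      have "p + 1 - \<beta> - 1 = p - \<beta>" by simp
      then show ?thesis using p by (simp add: field_simps)
    qed
    ultimately show "DERIV F x :> Z * x powr (p - \<beta>)" by simp
  next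
    have "((\<lambda>t. t powr (p + 1 - \<beta>)) \<longlongrightarrow> 0) at_top"
      using p by (intro tendsto_neg_powr filterlim_ident) auto
    then have "((\<lambda>t. - (Z / (\<beta> - 1 - p)) * t powr (p + 1 - \<beta>)) \<longlongrightarrow> - (Z / (\<beta> - 1 - p)) * 0) at_top"
      by (rule tendsto_mult_left)
    then show "(F \<longlongrightarrow> 0) at_top" unfolding F_def by simp
  qed (use Z_pos in auto)
  finally show ?thesis by (simp add: F_def)
qed

lemma AE_ge_xmin: "AE t in \<D>. xmin \<le> t"
  unfolding pl_weight_dist_def by (subst AE_density) (auto simp: pl_density_def)

lemma emeasure_tail:
  assumes a: "xmin \<le> a"
  shows "emeasure \<D> {a..} = ennreal (xmin powr (\<beta> - 1) * a powr (1 - \<beta>))"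
proof -
  have "emeasure \<D> {a..} = (\<integral>\<^sup>+ t. ennreal (t powr 0) * indicator {a..} t \<partial>\<D>)"
  proof -
    have "(\<integral>\<^sup>+ t. ennreal (t powr 0) * indicator {a..} t \<partial>\<D>) = (\<integral>\<^sup>+ t. indicator {a..} t \<partial>\<D>)"
      using a xmin_pos by (intro nn_integral_cong) (auto simp: indicator_def)
    then show ?thesis by simp
  qed
  also have "\<dots> = ennreal (xmin powr (\<beta> - 1) * a powr (1 - \<beta>))"
    using nn_integral_powr_tail[OF a, of 0] \<beta>3 by (simp add: Z_def)
  finally show ?thesis .
qed

lemma prob_space_\<D>: "prob_space \<D>"
proof
  have "emeasure \<D> (space \<D>) = emeasure \<D> {xmin..}"
    using AE_ge_xmin by (intro emeasure_eq_AE) auto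
  also have "\<dots> = 1" using emeasure_tail[of xmin] xmin_pos by (simp add: powr_add[symmetric])
  finally show "emeasure \<D> (space \<D>) = 1" .
qed

sublocale \<D>: prob_space \<D> by (rule prob_space_\<D>)

lemma measure_tail: "xmin \<le> a \<Longrightarrow> measure \<D> {a..} = xmin powr (\<beta> - 1) * a powr (1 - \<beta>)"
  by (simp add: measure_def emeasure_tail)

definition C3 where "C3 = Z / (\<beta> - 3)"

lemma square_tail:
  assumes a: "xmin \<le> a"
  shows "integrable \<D> (\<lambda>t. if a \<le> t then t\<^sup>2 else 0)"
    "(\<integral>t. (if a \<le> t then t\<^sup>2 else 0) \<partial>\<D>) = C3 * a powr (3 - \<beta>)"
proof -
  have "(\<integral>\<^sup>+ t. ennreal (if a \<le> t then t\<^sup>2 else 0) \<partial>\<D>) = (\<integral>\<^sup>+ t. ennreal (t powr 2) * indicator {a..} t \<partial>\<D>)"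
    using a xmin_pos by (intro nn_integral_cong) (auto simp: indicator_def powr_numeral)
  also have "\<dots> = ennreal (C3 * a powr (3 - \<beta>))"
    using nn_integral_powr_tail[OF a, of 2] \<beta>3 by (simp add: C3_def)
  finally have nn: "(\<integral>\<^sup>+ t. ennreal (if a \<le> t then t\<^sup>2 else 0) \<partial>\<D>) = ennreal (C3 * a powr (3 - \<beta>))" .
  have c: "0 \<le> C3 * a powr (3 - \<beta>)" using Z_pos \<beta>3 by (simp add: C3_def)
  have m: "(\<lambda>t. if a \<le> t then t\<^sup>2 else 0) \<in> borel_measurable \<D>" by measurable
  show "integrable \<D> (\<lambda>t. if a \<le> t then t\<^sup>2 else 0)"
    by (rule integrableI_nn_integral_finite[OF m _ nn]) auto
  show "(\<integral>t. (if a \<le> t then t\<^sup>2 else 0) \<partial>\<D>) = C3 * a powr (3 - \<beta>)"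
    using integral_eq_nn_integral[OF m] c unfolding nn by simp
qed

lemma square_integrable: "integrable \<D> (\<lambda>t. t\<^sup>2)"
proof (rule integrable_cong_AE_imp[OF square_tail(1)[OF order_refl]])
  show "AE t in \<D>. (if xmin \<le> t then t\<^sup>2 else 0) = t\<^sup>2" using AE_ge_xmin by auto
qed simp

lemma mean_\<D>: "(\<integral>t. t \<partial>\<D>) = pl_mean xmin \<beta>"
  unfolding pl_weight_dist_def pl_mean_def
  by (subst integral_density) (auto simp: pl_density_nonneg mult.commute)

lemma measure_band:
  assumes "xmin \<le> a"
  shows "xmin powr (\<beta> - 1) * (1 - 2 powr (1 - \<beta>)) * a powr (1 - \<beta>) \<le> measure \<D> {a..2 * a}"
proof -
  have a0: "0 < a" using assms xmin_pos by simp
  have "measure \<D> {a..} = measure \<D> ({a..<2 * a} \<union> {2 * a..})"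
    using a0 by (intro arg_cong[of _ _ "measure \<D>"]) auto
  also have "\<dots> \<le> measure \<D> {a..<2 * a} + measure \<D> {2 * a..}"
    by (intro measure_Un_le) auto
  also have "measure \<D> {a..<2 * a} \<le> measure \<D> {a..2 * a}"
    by (intro \<D>.finite_measure_mono) auto
  finally have "measure \<D> {a..} - measure \<D> {2 * a..} \<le> measure \<D> {a..2 * a}" by simp
  moreover have "measure \<D> {a..} - measure \<D> {2 * a..} =
      xmin powr (\<beta> - 1) * (1 - 2 powr (1 - \<beta>)) * a powr (1 - \<beta>)"
    using assms a0 measure_tail[of a] measure_tail[of "2 * a"] by (simp add: powr_mult algebra_simps)
  ultimately show ?thesis by simp
qed

end

text \<open>The probability is a finite sum, over configurations vanishing off the vertex pairs, of
  finite products of explicit functions of the weights.\<close>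

lemma rpl_edges_prob_measurable [measurable]:
  "(\<lambda>w. measure_pmf.prob (rpl_edges n w) {e. A e}) \<in> borel_measurable (pl_weights xmin \<beta> n)"
proof -
  define E where "E = PiE_dflt (vertex_pairs n) False (\<lambda>_. UNIV :: bool set)"
  have finE: "finite E" unfolding E_def by (intro finite_PiE_dflt finite_vertex_pairs) auto
  have eq: "measure_pmf.prob (rpl_edges n w) {e. A e} = (\<Sum>e\<in>{e \<in> E. A e}. \<Prod>p\<in>vertex_pairs n.
      pmf (bernoulli_pmf (min (w (fst p) * w (snd p) / (\<Sum>x<n. w x)) 1)) (e p))" for w
  proof -
    have "measure_pmf.prob (rpl_edges n w) {e. A e} = measure_pmf.prob (rpl_edges n w) {e \<in> E. A e}"
      unfolding rpl_edges_def E_def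
      by (intro measure_prob_cong_0) (auto simp: PiE_dflt_def intro!: pmf_Pi_outside[OF finite_vertex_pairs])
    also have "\<dots> = (\<Sum>e\<in>{e \<in> E. A e}. pmf (rpl_edges n w) e)"
      using finE by (intro measure_measure_pmf_finite) auto
    also have "\<dots> = (\<Sum>e\<in>{e \<in> E. A e}. \<Prod>p\<in>vertex_pairs n.
      pmf (bernoulli_pmf (min (w (fst p) * w (snd p) / (\<Sum>x<n. w x)) 1)) (e p))"
      unfolding rpl_edges_def E_def
      by (intro sum.cong refl, subst pmf_Pi'[OF finite_vertex_pairs]) (auto simp: PiE_dflt_def case_prod_unfold)
    finally show ?thesis .
  qed
  \<comment> \<open>Arbitrary real weights can put the parameter outside [0, 1];
    \<open>bernoulli_pmf\<close> then clamps it.\<close>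
  have b: "pmf (bernoulli_pmf q) c = (if c then max 0 (min 1 q) else 1 - max 0 (min 1 q))" for q c
    by (auto simp: bernoulli_pmf.rep_eq min_def max_def)
  have comp: "(\<lambda>w. w x) \<in> borel_measurable (pl_weights xmin \<beta> n)" if "x < n" for x
    unfolding pl_weights_def using that measurable_component_singleton[of x "{0..<n}" "\<lambda>_. pl_weight_dist xmin \<beta>"]
    by (simp add: measurable_cong_sets[OF refl sets_pl_weight_dist])
  have "(\<lambda>w. pmf (bernoulli_pmf (min (w (fst p) * w (snd p) / (\<Sum>x<n. w x)) 1)) (e p))
      \<in> borel_measurable (pl_weights xmin \<beta> n)" if p: "p \<in> vertex_pairs n" for p e
  proof -
    have [measurable]: "(\<lambda>w. w (fst p)) \<in> borel_measurable (pl_weights xmin \<beta> n)"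
      "(\<lambda>w. w (snd p)) \<in> borel_measurable (pl_weights xmin \<beta> n)"
      "(\<lambda>w. \<Sum>x<n. w x) \<in> borel_measurable (pl_weights xmin \<beta> n)"
      using p comp by (auto simp: vertex_pairs_def intro!: borel_measurable_sum)
    show ?thesis unfolding b by (cases "e p") (simp_all, measurable)
  qed
  then show ?thesis unfolding eq by (intro borel_measurable_sum borel_measurable_prod) auto
qed

section \<open>The lower bound\<close>

text \<open>The conditions on the weights under which
  \<open>prob_short_labeling_good_weights\<close> is applied, collected as one event.\<close>

definition good_weights :: "real \<Rightarrow> nat \<Rightarrow> nat \<Rightarrow> nat \<Rightarrow> nat \<Rightarrow> (nat \<Rightarrow> real) \<Rightarrow> bool" where
  "good_weights \<epsilon> a b h n w \<longleftrightarrow> (\<forall>x<n. 0 < w x) \<and> (1 + \<epsilon>) * real n \<le> (\<Sum>x<n. w x) \<and>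
     (\<Sum>x<n. (w x)\<^sup>2) \<le> real n * ln (real n) \<and>
     (\<Sum>y | y < n \<and> ln (real n) ^ a < w y. (w y)\<^sup>2) \<le> real n / ln (real n) ^ 3 \<and>
     real n / ln (real n) ^ h \<le> real (card {x. x < n \<and> ln (real n) ^ b \<le> w x \<and> w x \<le> 2 * ln (real n) ^ b})"

context power_law
begin

section \<open>Random weights are good with high probability\<close>

lemma prob_space_pl_weights: "prob_space (pl_weights xmin \<beta> n)"
  unfolding pl_weights_def by (intro prob_space_PiM prob_space_\<D>)

lemma pl_weights_component [measurable]: "x < n \<Longrightarrow> (\<lambda>w. w x) \<in> borel_measurable (pl_weights xmin \<beta> n)"
  unfolding pl_weights_def using measurable_component_singleton[of x "{0..<n}" "\<lambda>_. \<D>"]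
  by (simp add: measurable_cong_sets[OF refl sets_pl_weight_dist])

lemma AE_pl_weights_pos: "AE w in pl_weights xmin \<beta> n. \<forall>x<n. 0 < w x"
proof -
  have "AE w in pl_weights xmin \<beta> n. 0 < w x" if "x \<in> {..<n}" for x
    unfolding pl_weights_def
  proof (rule AE_PiM_component)
    show "AE t in \<D>. 0 < t" using AE_ge_xmin xmin_pos by (auto elim: eventually_mono)
  qed (use that prob_space_\<D> in auto)
  then have "AE w in pl_weights xmin \<beta> n. \<forall>x\<in>{..<n}. 0 < w x"
    by (subst AE_ball_countable) auto
  then show ?thesis by (auto elim!: eventually_mono)
qed

definition m2 where "m2 = (\<integral>t. t\<^sup>2 \<partial>\<D>)"

text \<open>Markov's inequality for the second moment and for its tail, Chebyshev's for the total
  weight and for the size of the band. The choice of \<open>a\<close> makes the expected tail at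
  most \<open>C3 / l ^ 4\<close> per vertex, against an allowance of \<open>1 / l ^ 3\<close>. The
  band has probability of order l^(-b(\<beta> - 1)), and the extra 1 in the bound on
  \<open>h\<close> lets one factor \<open>l\<close> absorb the constant.\<close>

lemma good_weights_fail:
  assumes n: "0 < n" and l: "l = ln (real n)" "1 \<le> l" "xmin \<le> l"
    and a: "1 \<le> a" "4 \<le> real a * (\<beta> - 3)" and b: "1 \<le> b" and h: "real b * (\<beta> - 1) + 1 \<le> real h"
    and c0: "2 \<le> xmin powr (\<beta> - 1) * (1 - 2 powr (1 - \<beta>)) * l"
    and \<epsilon>: "0 < \<epsilon>" "pl_mean xmin \<beta> = 1 + 2 * \<epsilon>"
  shows "measure (pl_weights xmin \<beta> n) {w \<in> space (pl_weights xmin \<beta> n). \<not> good_weights \<epsilon> a b h n w}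
    \<le> m2 / l + C3 / l + m2 / (\<epsilon>\<^sup>2 * real n) + 2 * l ^ h / real n"
proof -
  let ?N = "pl_weights xmin \<beta> n"
  interpret N: prob_space ?N by (rule prob_space_pl_weights)
  have np: "0 < real n" using n by simp
  have l0: "0 < l" using l by simp
  have la: "xmin \<le> l ^ a" using power_increasing[of 1 a l] a l by simp
  have lb: "xmin \<le> l ^ b" using power_increasing[of 1 b l] b l by simp
  define g2 where "g2 t = (if l ^ a \<le> t then t\<^sup>2 else 0)" for t :: real
  define g4 where "g4 t = (indicator {l ^ b..2 * l ^ b} t :: real)" for t :: real
  define p where "p = measure \<D> {l ^ b..2 * l ^ b}"
  have [measurable]: "g2 \<in> borel_measurable borel" "g4 \<in> borel_measurable borel"
    unfolding g2_def g4_def by measurable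
  have meas: "g2 \<in> borel_measurable \<D>" "g4 \<in> borel_measurable \<D>" "(\<lambda>t. t) \<in> borel_measurable \<D>"
    by (simp_all add: measurable_cong_sets[OF sets_pl_weight_dist refl])
  define B1 where "B1 = {w \<in> space ?N. real n * l \<le> (\<Sum>i<n. (w i)\<^sup>2)}"
  define B2 where "B2 = {w \<in> space ?N. real n / l ^ 3 \<le> (\<Sum>i<n. g2 (w i))}"
  define B3 where "B3 = {w \<in> space ?N. \<epsilon> * real n \<le> \<bar>(\<Sum>i<n. w i) - real n * pl_mean xmin \<beta>\<bar>}"
  define B4 where "B4 = {w \<in> space ?N. real n * p / 2 \<le> \<bar>(\<Sum>i<n. g4 (w i)) - real n * p\<bar>}"
  have comp: "(\<lambda>w. w i) \<in> borel_measurable ?N" if "i \<in> {..<n}" for i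
    using that by (intro pl_weights_component) simp
  have sets: "B1 \<in> sets ?N" "B2 \<in> sets ?N" "B3 \<in> sets ?N" "B4 \<in> sets ?N"
  proof -
    have [measurable]: "(\<lambda>w. \<Sum>i<n. (w i)\<^sup>2) \<in> borel_measurable ?N"
      "(\<lambda>w. \<Sum>i<n. w i) \<in> borel_measurable ?N"
      "(\<lambda>w. \<Sum>i<n. g2 (w i)) \<in> borel_measurable ?N"
      "(\<lambda>w. \<Sum>i<n. g4 (w i)) \<in> borel_measurable ?N"
      using comp by (auto intro!: borel_measurable_sum borel_measurable_power
          measurable_compose[OF comp, of _ g2] measurable_compose[OF comp, of _ g4])
    show "B1 \<in> sets ?N" "B2 \<in> sets ?N" "B3 \<in> sets ?N" "B4 \<in> sets ?N"
      unfolding B1_def B2_def B3_def B4_def by measurable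
  qed
  have m1: "measure ?N B1 \<le> m2 / l"
  proof -
    have "measure ?N B1 \<le> real n * m2 / (real n * l)" unfolding B1_def m2_def pl_weights_def
      by (rule \<D>.iid_markov) (use square_integrable np l0 in auto)
    then show ?thesis using np by simp
  qed
  have m2: "measure ?N B2 \<le> C3 / l"
  proof -
    have i: "integrable \<D> g2" "integral\<^sup>L \<D> g2 = C3 * (l ^ a) powr (3 - \<beta>)"
      using square_tail[OF la] unfolding g2_def by auto
    have "measure ?N B2 \<le> real n * (C3 * (l ^ a) powr (3 - \<beta>)) / (real n / l ^ 3)"
      unfolding B2_def pl_weights_def i(2)[symmetric]
    proof (rule \<D>.iid_markov[OF meas(1) i(1)])
      show "0 \<le> g2 t" for t by (simp add: g2_def)
    qed (use np l0 in simp)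
    also have "\<dots> = C3 * (l ^ 3 * (l ^ a) powr (3 - \<beta>))" using np l0 by simp
    also have "\<dots> \<le> C3 * (1 / l)"
    proof (rule mult_left_mono)
      have "(l ^ a) powr (3 - \<beta>) = l powr (real a * (3 - \<beta>))"
        using l0 by (simp add: powr_realpow[symmetric] powr_powr)
      also have "\<dots> \<le> l powr (- 4)"
      proof (rule powr_mono)
        have "real a * (3 - \<beta>) = - (real a * (\<beta> - 3))" by (simp add: algebra_simps)
        then show "real a * (3 - \<beta>) \<le> - 4" using a by linarith
      qed (rule l(2))
      also have "\<dots> = 1 / l ^ 4" using l0 by (simp add: powr_minus powr_numeral inverse_eq_divide)
      finally have "l ^ 3 * (l ^ a) powr (3 - \<beta>) \<le> l ^ 3 * (1 / l ^ 4)" using l0 by (intro mult_left_mono) auto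
      also have "\<dots> = 1 / l" using l0 by (simp add: power4_eq_xxxx power3_eq_cube)
      finally show "l ^ 3 * (l ^ a) powr (3 - \<beta>) \<le> 1 / l" .
      show "0 \<le> C3" using Z_pos \<beta>3 by (simp add: C3_def)
    qed
    finally show ?thesis by simp
  qed
  have m3: "measure ?N B3 \<le> m2 / (\<epsilon>\<^sup>2 * real n)"
  proof -
    have "measure ?N B3 \<le> real n * m2 / (\<epsilon> * real n)\<^sup>2"
      unfolding B3_def m2_def pl_weights_def mean_\<D>[symmetric]
      by (rule \<D>.iid_chebyshev[OF meas(3) square_integrable]) (use np \<epsilon> in simp)
    then show ?thesis using np by (simp add: power2_eq_square mult_ac)
  qed
  have p_ge: "2 / l ^ h \<le> p"
  proof -
    let ?c = "xmin powr (\<beta> - 1) * (1 - 2 powr (1 - \<beta>))"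
    have c: "0 \<le> ?c" using \<beta>3 powr_mono[of "1 - \<beta>" 0 "2::real"] by simp
    have "2 / l ^ h \<le> ?c * l / l ^ h" using c0 l0 by (intro divide_right_mono) auto
    also have "\<dots> = ?c * l powr (1 - real h)" using l0 by (simp add: powr_diff powr_realpow)
    also have "\<dots> \<le> ?c * l powr (real b * (1 - \<beta>))"
    proof (intro mult_left_mono powr_mono l(2) c)
      have "real b * (1 - \<beta>) = - (real b * (\<beta> - 1))" by (simp add: algebra_simps)
      then show "1 - real h \<le> real b * (1 - \<beta>)" using h by linarith
    qed
    also have "l powr (real b * (1 - \<beta>)) = (l ^ b) powr (1 - \<beta>)"
      using l0 by (simp add: powr_realpow[symmetric] powr_powr)
    also have "?c * \<dots> \<le> p" unfolding p_def using measure_band[OF lb] by simp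
    finally show ?thesis .
  qed
  have p0: "0 < p" using p_ge l0 by (smt (verit) divide_pos_pos zero_less_power)
  have m4: "measure ?N B4 \<le> 2 * l ^ h / real n"
  proof -
    have sq: "(\<lambda>t. (g4 t)\<^sup>2) = g4" unfolding g4_def by (auto simp: indicator_def)
    have i: "integrable \<D> g4" "integral\<^sup>L \<D> g4 = p"
      unfolding g4_def p_def by (auto simp: \<D>.emeasure_eq_measure)
    have "measure ?N B4 \<le> real n * p / (real n * p / 2)\<^sup>2"
      using \<D>.iid_chebyshev[of g4 "real n * p / 2" n] i np p0 unfolding B4_def pl_weights_def sq by simp
    also have "\<dots> = 4 / (real n * p)" using np p0 by (simp add: power2_eq_square)
    also have "\<dots> \<le> 4 / (real n * (2 / l ^ h))"
      using p_ge np l0 p0 by (intro divide_left_mono mult_left_mono) auto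
    also have "\<dots> = 2 * l ^ h / real n" by simp
    finally show ?thesis .
  qed
  have "measure ?N {w \<in> space ?N. \<not> good_weights \<epsilon> a b h n w} \<le> measure ?N (B1 \<union> (B2 \<union> (B3 \<union> B4)))"
  proof (rule N.finite_measure_mono_AE)
    show "AE w in ?N. w \<in> {w \<in> space ?N. \<not> good_weights \<epsilon> a b h n w} \<longrightarrow> w \<in> B1 \<union> (B2 \<union> (B3 \<union> B4))"
      using AE_pl_weights_pos[of n]
    proof eventually_elim
      case (elim w)
      show ?case
      proof (rule impI, rule ccontr)
        assume bad: "w \<in> {w \<in> space ?N. \<not> good_weights \<epsilon> a b h n w}" and nB: "w \<notin> B1 \<union> (B2 \<union> (B3 \<union> B4))"
        have w: "w \<in> space ?N" using bad by simp
        have 1: "(\<Sum>i<n. (w i)\<^sup>2) \<le> real n * l" using nB w by (auto simp: B1_def)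
        have 2: "(\<Sum>y | y < n \<and> l ^ a < w y. (w y)\<^sup>2) \<le> real n / l ^ 3"
        proof -
          have "(\<Sum>y | y < n \<and> l ^ a < w y. (w y)\<^sup>2) = (\<Sum>y | y < n \<and> l ^ a < w y. g2 (w y))"
            by (intro sum.cong) (auto simp: g2_def)
          also have "\<dots> \<le> (\<Sum>y<n. g2 (w y))" by (intro sum_mono2) (auto simp: g2_def)
          finally show ?thesis using nB w by (auto simp: B2_def)
        qed
        have "\<bar>(\<Sum>i<n. w i) - real n * pl_mean xmin \<beta>\<bar> < \<epsilon> * real n" using nB w by (auto simp: B3_def)
        then have 3: "(1 + \<epsilon>) * real n \<le> (\<Sum>i<n. w i)" unfolding \<epsilon>(2) by (simp add: algebra_simps abs_less_iff)
        have "(\<Sum>i<n. g4 (w i)) = real (card {x. x < n \<and> l ^ b \<le> w x \<and> w x \<le> 2 * l ^ b})"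
        proof -
          have "(\<Sum>i<n. g4 (w i)) = (\<Sum>i\<in>{..<n}. if l ^ b \<le> w i \<and> w i \<le> 2 * l ^ b then 1 else 0)"
            by (intro sum.cong) (auto simp: g4_def indicator_def)
          also have "\<dots> = real (card {x \<in> {..<n}. l ^ b \<le> w x \<and> w x \<le> 2 * l ^ b})"
            by (subst sum.inter_filter[symmetric]) auto
          finally show ?thesis by simp
        qed
        moreover have "\<bar>(\<Sum>i<n. g4 (w i)) - real n * p\<bar> < real n * p / 2" using nB w by (auto simp: B4_def)
        ultimately have "real n * p / 2 \<le> real (card {x. x < n \<and> l ^ b \<le> w x \<and> w x \<le> 2 * l ^ b})"
          by linarith
        moreover have "real n / l ^ h \<le> real n * p / 2"
          using mult_left_mono[OF p_ge, of "real n"] np by simp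
        ultimately have 4: "real n / l ^ h \<le> real (card {x. x < n \<and> l ^ b \<le> w x \<and> w x \<le> 2 * l ^ b})" by linarith
        have "good_weights \<epsilon> a b h n w"
          unfolding good_weights_def l(1)[symmetric] using elim 1 2 3 4 by (intro conjI)
        then show False using bad by simp
      qed
    qed
  qed (use sets in auto)
  also have "\<dots> \<le> measure ?N B1 + (measure ?N B2 + (measure ?N B3 + measure ?N B4))"
    using sets by (intro order_trans[OF measure_Un_le] add_left_mono sets.Un) 
      (auto intro!: order_trans[OF measure_Un_le] add_left_mono)
  finally show ?thesis using m1 m2 m3 m4 by linarith
qed

lemma good_weights_sets: "{w \<in> space (pl_weights xmin \<beta> n). good_weights \<epsilon> a b h n w} \<in> sets (pl_weights xmin \<beta> n)"
proof -
  let ?N = "pl_weights xmin \<beta> n"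
  let ?l = "ln (real n)"
  have comp: "(\<lambda>w. w i) \<in> borel_measurable ?N" if "i \<in> {..<n}" for i
    using that by (intro pl_weights_component) simp
  have tail: "(\<Sum>y | y < n \<and> ?l ^ a < w y. (w y)\<^sup>2) = (\<Sum>y<n. if ?l ^ a < w y then (w y)\<^sup>2 else 0)" for w :: "nat \<Rightarrow> real"
    using sum.inter_filter[of "{..<n}" "\<lambda>y. (w y)\<^sup>2" "\<lambda>y. ?l ^ a < w y"] by simp
  have cnt: "real (card {x. x < n \<and> ?l ^ b \<le> w x \<and> w x \<le> 2 * ?l ^ b}) =
      (\<Sum>x<n. if ?l ^ b \<le> w x \<and> w x \<le> 2 * ?l ^ b then 1 else 0)" for w :: "nat \<Rightarrow> real"
    using sum.inter_filter[of "{..<n}" "\<lambda>_. 1::real" "\<lambda>x. ?l ^ b \<le> w x \<and> w x \<le> 2 * ?l ^ b"] by simp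
  define t where "t x = (if ?l ^ a < x then x\<^sup>2 else 0)" for x :: real
  define u where "u x = (if ?l ^ b \<le> x \<and> x \<le> 2 * ?l ^ b then 1 else (0::real))" for x :: real
  have [measurable]: "t \<in> borel_measurable borel" "u \<in> borel_measurable borel"
    unfolding t_def u_def by measurable
  have [measurable]: "(\<lambda>w. \<Sum>i<n. (w i)\<^sup>2) \<in> borel_measurable ?N"
      "(\<lambda>w. \<Sum>i<n. w i) \<in> borel_measurable ?N"
      "(\<lambda>w. \<Sum>i<n. t (w i)) \<in> borel_measurable ?N"
      "(\<lambda>w. \<Sum>i<n. u (w i)) \<in> borel_measurable ?N"
    using comp by (auto intro!: borel_measurable_sum borel_measurable_power
          measurable_compose[OF comp, of _ t] measurable_compose[OF comp, of _ u])
  have pos: "{w \<in> space ?N. \<forall>x\<in>{..<n}. 0 < w x} \<in> sets ?N"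
  proof (rule sets.sets_Collect_finite_All)
    fix x assume "x \<in> {..<n}"
    note comp[OF this, measurable]
    show "{w \<in> space ?N. 0 < w x} \<in> sets ?N" by measurable
  qed simp
  have "{w \<in> space ?N. good_weights \<epsilon> a b h n w} = {w \<in> space ?N. \<forall>x\<in>{..<n}. 0 < w x} \<inter>
     {w \<in> space ?N. (1 + \<epsilon>) * real n \<le> (\<Sum>x<n. w x) \<and> (\<Sum>x<n. (w x)\<^sup>2) \<le> real n * ?l \<and>
     (\<Sum>y<n. t (w y)) \<le> real n / ?l ^ 3 \<and> real n / ?l ^ h \<le> (\<Sum>x<n. u (w x))}"
    unfolding good_weights_def tail cnt t_def u_def by auto
  also have "\<dots> \<in> sets ?N" by (intro sets.Int pos) measurable
  finally show ?thesis .
qed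

section \<open>From fixed weights to the random graph\<close>

lemma rpl_prob_integrable: "integrable (pl_weights xmin \<beta> n) (\<lambda>w. measure_pmf.prob (rpl_edges n w) {e. A e})"
proof -
  interpret N: prob_space "pl_weights xmin \<beta> n" by (rule prob_space_pl_weights)
  show ?thesis by (rule N.integrable_const_bound[of _ 1]) auto
qed

lemma rpl_prob_mono:
  assumes "\<And>e. A e \<Longrightarrow> B e"
  shows "rpl_prob xmin \<beta> n A \<le> rpl_prob xmin \<beta> n B"
  unfolding rpl_prob_def
  by (intro integral_mono rpl_prob_integrable measure_pmf.finite_measure_mono) (use assms in auto)

lemma rpl_prob_le_1: "rpl_prob xmin \<beta> n A \<le> 1"
proof -
  interpret N: prob_space "pl_weights xmin \<beta> n" by (rule prob_space_pl_weights)
  have "rpl_prob xmin \<beta> n A \<le> (\<integral>w. 1 \<partial>pl_weights xmin \<beta> n)"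
    unfolding rpl_prob_def by (intro integral_mono rpl_prob_integrable) auto
  then show ?thesis by (simp add: N.prob_space)
qed

text \<open>The indicator of good weights minus \<delta> is a pointwise lower bound everywhere:
  outside the good weights it is negative or zero, hence below any probability.\<close>

lemma rpl_prob_ge:
  assumes "\<And>w. good_weights \<epsilon> a b h n w \<Longrightarrow> measure_pmf.prob (rpl_edges n w) {e. \<not> A e} \<le> \<delta>"
    and bad: "measure (pl_weights xmin \<beta> n) {w \<in> space (pl_weights xmin \<beta> n). \<not> good_weights \<epsilon> a b h n w} \<le> \<gamma>"
    and \<delta>: "0 \<le> \<delta>"
  shows "1 - \<delta> - \<gamma> \<le> rpl_prob xmin \<beta> n A"
proof -
  let ?N = "pl_weights xmin \<beta> n"
  let ?G = "{w \<in> space ?N. good_weights \<epsilon> a b h n w}"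
  interpret N: prob_space ?N by (rule prob_space_pl_weights)
  have "{w \<in> space ?N. \<not> good_weights \<epsilon> a b h n w} = space ?N - ?G" by auto
  then have G: "1 - \<gamma> \<le> measure ?N ?G" using bad N.prob_compl[OF good_weights_sets] by simp
  have "measure ?N ?G - \<delta> = (\<integral>w. indicator ?G w - \<delta> \<partial>?N)"
    using good_weights_sets by (simp add: N.prob_space N.emeasure_eq_measure)
  also have "\<dots> \<le> rpl_prob xmin \<beta> n A" unfolding rpl_prob_def
  proof (intro integral_mono rpl_prob_integrable)
    show "integrable ?N (\<lambda>w. indicator ?G w - \<delta>)"
      using good_weights_sets by (intro Bochner_Integration.integrable_diff) (auto simp: N.emeasure_eq_measure)
    fix w assume "w \<in> space ?N"
    show "indicator ?G w - \<delta> \<le> measure_pmf.prob (rpl_edges n w) {e. A e}"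
    proof (cases "w \<in> ?G")
      case True
      then show ?thesis using assms(1)[of w] prob_compl_pmf[of "rpl_edges n w" A] by simp
    next
      case False
      have "- \<delta> \<le> measure_pmf.prob (rpl_edges n w) {e. A e}"
        using \<delta> measure_nonneg[of "measure_pmf (rpl_edges n w)" "{e. A e}"] by linarith
      then show ?thesis using False by simp
    qed
  qed
  finally show ?thesis using G by linarith
qed

text \<open>Measures label size in units, each worth polynomially many choices. A unit is one bit
  (base 2) or one landmark with its distance (base about n^2).\<close>

definition few_labels :: "(nat \<Rightarrow> 'l set) \<Rightarrow> ('l \<Rightarrow> nat) \<Rightarrow> bool" where
  "few_labels Lab len \<longleftrightarrow> (\<exists>A :: nat \<Rightarrow> nat.
     (\<forall>n j. finite {x \<in> Lab n. len x = j} \<and> card {x \<in> Lab n. len x = j} \<le> A n ^ j) \<and>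
     (\<forall>n. 1 \<le> A n) \<and> eventually (\<lambda>n. ln (2 * real (A n)) \<le> 4 * ln (real n)) at_top)"

definition long_labels ::
  "(nat \<Rightarrow> 'l set) \<Rightarrow> ('l \<Rightarrow> nat) \<Rightarrow> (nat \<Rightarrow> 'l \<Rightarrow> 'l \<Rightarrow> enat) \<Rightarrow> nat \<Rightarrow> nat \<Rightarrow> edge_config \<Rightarrow> bool" where
  "long_labels Lab len D k n e \<longleftrightarrow> (\<forall>f. (\<forall>x<n. f x \<in> Lab n) \<and>
     (\<forall>x<n. \<forall>y<n. D n (f x) (f y) = gdist (adj n e) x y) \<longrightarrow>
     real n powr (3/2) / ln (real n) ^ k \<le> real (\<Sum>x<n. len (f x)))"

text \<open>The exponent is fixed before the label family and the decoder, both of which may vary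
  with \<open>n\<close>. For bit strings this makes the bound uniform over all decoders.\<close>

theorem long_labels_whp:
  assumes mean: "1 < pl_mean xmin \<beta>"
  shows "\<exists>k. \<forall>(Lab :: nat \<Rightarrow> 'l set) len D. few_labels Lab len \<longrightarrow>
     (\<lambda>n. rpl_prob xmin \<beta> n (long_labels Lab len D k n)) \<longlonglongrightarrow> 1"
proof -
  define \<epsilon> where "\<epsilon> = (pl_mean xmin \<beta> - 1) / 2"
  have \<epsilon>: "0 < \<epsilon>" "pl_mean xmin \<beta> = 1 + 2 * \<epsilon>" using mean by (simp_all add: \<epsilon>_def field_simps)
  obtain a0 :: nat where "4 / (\<beta> - 3) < real a0" using reals_Archimedean2 by blast
  define a where "a = a0 + 1"
  have a: "1 \<le> a" "4 \<le> real a * (\<beta> - 3)"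
  proof -
    have "4 / (\<beta> - 3) \<le> real a" using \<open>4 / (\<beta> - 3) < real a0\<close> by (simp add: a_def)
    then show "4 \<le> real a * (\<beta> - 3)" using \<beta>3 by (simp add: field_simps)
  qed (simp add: a_def)
  define b where "b = a + 9"
  obtain h :: nat where h: "real b * (\<beta> - 1) + 1 < real h" using reals_Archimedean2 by blast
  define g where "g = 2 * b + h + 7"
  define q where "q = h + 7"
  define c where "c = g + 3 + 3 * q + h + b + 4"
  define k where "k = c + 3 * q + 2 * h + 9"
  define c0 where "c0 = xmin powr (\<beta> - 1) * (1 - 2 powr (1 - \<beta>))"
  have c0: "0 < c0"
  proof -
    have "2 powr (1 - \<beta>) < 2 powr (0::real)" using \<beta>3 by (intro powr_less_mono) auto
    then show ?thesis using xmin_pos by (simp add: c0_def)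
  qed
  define \<gamma> where "\<gamma> n = m2 / ln (real n) + C3 / ln (real n) + m2 / (\<epsilon>\<^sup>2 * real n) + 2 * ln (real n) ^ h / real n" for n :: nat
  have lim: "(\<lambda>n. 1 - 9 / ln (real n) - \<gamma> n) \<longlonglongrightarrow> 1"
  proof -
    have "(\<lambda>n. ln (real n) ^ h / real n) \<longlonglongrightarrow> 0" by real_asymp
    then have h0: "(\<lambda>n. 2 * (ln (real n) ^ h / real n)) \<longlonglongrightarrow> 0" by (rule tendsto_mult_right_zero)
    have i: "(\<lambda>n. x / ln (real n)) \<longlonglongrightarrow> 0" for x :: real by real_asymp
    have j: "(\<lambda>n. x / real n) \<longlonglongrightarrow> 0" for x :: real by real_asymp
    have "(\<lambda>n. 1 - 9 / ln (real n) - (m2 / ln (real n) + C3 / ln (real n) + m2 / \<epsilon>\<^sup>2 / real n + 2 * (ln (real n) ^ h / real n)))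
       \<longlonglongrightarrow> 1 - 0 - (0 + 0 + 0 + 0)"
      by (intro tendsto_intros i j h0)
    then show ?thesis by (simp add: \<gamma>_def)
  qed
  have ev: "eventually (\<lambda>n. 64 \<le> ln (real n) \<and> ln (real n) / ln (1 + \<epsilon>) + 1 \<le> (ln (real n))\<^sup>2 \<and>
      32 * ln (real n) ^ k \<le> sqrt (real n) \<and> xmin \<le> ln (real n) \<and> 2 \<le> c0 * ln (real n)) at_top"
  proof (intro eventually_conj)
    show "eventually (\<lambda>n. 64 \<le> ln (real n)) at_top" by real_asymp
    have "0 < ln (1 + \<epsilon>)" using \<epsilon> by simp
    then show "eventually (\<lambda>n. ln (real n) / ln (1 + \<epsilon>) + 1 \<le> (ln (real n))\<^sup>2) at_top" by real_asymp
    show "eventually (\<lambda>n. 32 * ln (real n) ^ k \<le> sqrt (real n)) at_top" by real_asymp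
    show "eventually (\<lambda>n. xmin \<le> ln (real n)) at_top" by real_asymp
    show "eventually (\<lambda>n. 2 \<le> c0 * ln (real n)) at_top" using c0 by real_asymp
  qed
  show ?thesis
  proof (intro exI[of _ k] allI impI)
    fix Lab :: "nat \<Rightarrow> 'l set" and len D
    assume "few_labels Lab len"
    then obtain A :: "nat \<Rightarrow> nat"
      where Lab: "\<forall>n j. finite {x \<in> Lab n. len x = j} \<and> card {x \<in> Lab n. len x = j} \<le> A n ^ j"
        and A: "\<forall>n. 1 \<le> A n" and lnA: "eventually (\<lambda>n. ln (2 * real (A n)) \<le> 4 * ln (real n)) at_top"
      unfolding few_labels_def by blast
    let ?E = "long_labels Lab len D k"
    have lower: "eventually (\<lambda>n. 1 - 9 / ln (real n) - \<gamma> n \<le> rpl_prob xmin \<beta> n (?E n)) at_top"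
      using ev lnA
    proof eventually_elim
      case (elim n)
      define l where "l = ln (real n)"
      have l: "64 \<le> l" "l / ln (1 + \<epsilon>) + 1 \<le> l\<^sup>2" "32 * l ^ k \<le> sqrt (real n)" "xmin \<le> l" "2 \<le> c0 * l"
        using elim by (auto simp: l_def)
      \<comment> \<open>As \<open>ln 0\<close> is 0, a logarithm of at least 64 excludes
        \<open>n = 0\<close>.\<close>
      have n0: "0 < n" using l(1) by (cases n) (auto simp: l_def)
      show ?case
      proof (rule rpl_prob_ge)
        show "measure (pl_weights xmin \<beta> n) {w \<in> space (pl_weights xmin \<beta> n). \<not> good_weights \<epsilon> a b h n w} \<le> \<gamma> n"
          unfolding \<gamma>_def
          by (rule good_weights_fail) (use n0 l a h \<epsilon> in \<open>auto simp: l_def b_def c0_def\<close>)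
        show "0 \<le> 9 / ln (real n)" using l by (simp add: l_def)
        fix w assume w: "good_weights \<epsilon> a b h n w"
        interpret weighted_vertices n w
          by unfold_locales (use n0 w in \<open>auto simp: good_weights_def\<close>)
        have "measure_pmf.prob (rpl_edges n w) {e. \<not> ?E n e} = prob\<^sub>G {e. \<exists>f. (\<forall>x<n. f x \<in> Lab n) \<and>
          (\<forall>x<n. \<forall>y<n. D n (f x) (f y) = gdist (adj n e) x y) \<and>
          real (\<Sum>x<n. len (f x)) < real n powr (3/2) / l ^ k}"
          by (simp add: long_labels_def not_le l_def conj_assoc)
        also have "\<dots> \<le> 9 / l"
          by (rule prob_short_labeling_good_weights[where \<epsilon> = \<epsilon> and a = a and b = b and g = g and q = q and c = c and h = h and A = "A n"])
             (use w l \<epsilon> Lab A elim in \<open>auto simp: good_weights_def W_def Q_def l_def b_def g_def q_def c_def k_def\<close>)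
        finally show "measure_pmf.prob (rpl_edges n w) {e. \<not> ?E n e} \<le> 9 / ln (real n)" by (simp add: l_def)
      qed
    qed
    show "(\<lambda>n. rpl_prob xmin \<beta> n (?E n)) \<longlonglongrightarrow> 1"
      by (rule tendsto_sandwich[OF lower _ lim tendsto_const]) (simp add: rpl_prob_le_1)
  qed
qed

end

definition landmark_label :: "(nat \<Rightarrow> nat \<Rightarrow> bool) \<Rightarrow> nat set \<Rightarrow> nat \<Rightarrow> (nat \<times> enat) set" where
  "landmark_label G S x = (\<lambda>z. (z, gdist G x z)) ` S"

text \<open>The infimum over the empty set is \<infinity>, the right answer when labels without a
  common landmark belong to different components.\<close>

definition landmark_decode :: "(nat \<times> enat) set \<Rightarrow> (nat \<times> enat) set \<Rightarrow> enat" where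
  "landmark_decode X Y = (INF p \<in> {(d, d') | d d'. \<exists>z. (z, d) \<in> X \<and> (z, d') \<in> Y}. fst p + snd p)"

definition landmark_labels :: "nat \<Rightarrow> (nat \<times> enat) set set" where
  "landmark_labels n = Pow ({..<n} \<times> (enat ` {..<n} \<union> {\<infinity>}))"

lemma card_landmark_label: "card (landmark_label G S x) = card S"
  unfolding landmark_label_def by (intro card_image) (auto simp: inj_on_def)

lemma landmark_label_in:
  assumes "x < n" "S \<subseteq> {0..<n}"
  shows "landmark_label (adj n e) S x \<in> landmark_labels n"
proof -
  have "gdist (adj n e) x z \<in> enat ` {..<n} \<union> {\<infinity>}" for z
    using gdist_less[OF assms(1), of e z] by (cases "gdist (adj n e) x z") auto
  then show ?thesis using assms by (auto simp: landmark_label_def landmark_labels_def)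
qed

text \<open>The cover condition speaks of pairs at finite distance only. For the others the triangle
  inequality forces every common landmark to give \<infinity>, so the decoder is exact on all
  pairs.\<close>

lemma landmark_decode_correct:
  assumes cover: "two_hop_cover n (adj n e) L" and xy: "x < n" "y < n"
  shows "landmark_decode (landmark_label (adj n e) (L x) x) (landmark_label (adj n e) (L y) y) = gdist (adj n e) x y"
proof -
  let ?d = "gdist (adj n e)"
  have eq: "landmark_decode (landmark_label (adj n e) (L x) x) (landmark_label (adj n e) (L y) y) =
      (INF z \<in> L x \<inter> L y. ?d x z + ?d z y)"
  proof -
    have "{(d, d') | d d'. \<exists>z. (z, d) \<in> landmark_label (adj n e) (L x) x \<and> (z, d') \<in> landmark_label (adj n e) (L y) y}
      = (\<lambda>z. (?d x z, ?d y z)) ` (L x \<inter> L y)"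
      by (auto simp: landmark_label_def)
    then show ?thesis unfolding landmark_decode_def by (simp add: image_image gdist_sym[of n e y])
  qed
  have "?d x y \<le> (INF z \<in> L x \<inter> L y. ?d x z + ?d z y)"
    by (intro INF_greatest gdist_triangle)
  moreover have "(INF z \<in> L x \<inter> L y. ?d x z + ?d z y) \<le> ?d x y"
  proof (cases "?d x y = \<infinity>")
    case False
    have "L x \<subseteq> {0..<n}" using cover xy by (auto simp: two_hop_cover_def)
    then have fin: "finite (L x \<inter> L y)" by (intro finite_Int disjI1) (rule finite_subset, auto)
    have ne: "L x \<inter> L y \<noteq> {}" and m: "Min ((\<lambda>z. ?d x z + ?d z y) ` (L x \<inter> L y)) = ?d x y"
      using cover xy False by (auto simp: two_hop_cover_def)
    have "Min ((\<lambda>z. ?d x z + ?d z y) ` (L x \<inter> L y)) \<in> (\<lambda>z. ?d x z + ?d z y) ` (L x \<inter> L y)"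
      using fin ne by (intro Min_in) auto
    then obtain z where "z \<in> L x \<inter> L y" "?d x z + ?d z y = ?d x y" using m by auto
    then show ?thesis using INF_lower[of z "L x \<inter> L y" "\<lambda>z. ?d x z + ?d z y"] by simp
  qed simp
  ultimately show ?thesis unfolding eq by simp
qed

lemma card_landmark_labels:
  "finite {X \<in> landmark_labels n. card X = j} \<and> card {X \<in> landmark_labels n. card X = j} \<le> (n * (n + 1) + 1) ^ j"
proof -
  let ?U = "{..<n} \<times> (enat ` {..<n} \<union> {\<infinity>})"
  have finU: "finite ?U" by simp
  have "card (enat ` {..<n} \<union> {\<infinity>}) = n + 1"
    by (subst card_Un_disjoint) (auto simp: card_image inj_on_def)
  then have cU: "card ?U = n * (n + 1)" by (simp add: card_cartesian_product)
  have eq: "{X \<in> landmark_labels n. card X = j} = {X. X \<subseteq> ?U \<and> card X = j}"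
    by (auto simp: landmark_labels_def)
  have "card {X. X \<subseteq> ?U \<and> card X = j} = (n * (n + 1)) choose j"
    using n_subsets[OF finU, of j] by (simp only: cU)
  also have "\<dots> \<le> (n * (n + 1)) ^ j"
    by (cases "j \<le> n * (n + 1)") (auto intro: binomial_le_pow simp: not_le binomial_eq_0)
  \<comment> \<open>The added 1 keeps the base positive for \<open>n = 0\<close>, as
    \<open>few_labels\<close> asks for every \<open>n\<close>.\<close>
  also have "\<dots> \<le> (n * (n + 1) + 1) ^ j" by (intro power_mono) auto
  finally show ?thesis unfolding eq using finU by simp
qed

theorem theorem6p3:
  fixes xmin \<beta> :: real
  assumes "xmin > 0" and "\<beta> > 3" and "pl_mean xmin \<beta> > 1"
  shows "(\<exists>c>0. \<exists>k::nat. \<forall>D :: nat \<Rightarrow> bool list \<Rightarrow> bool list \<Rightarrow> enat.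
            (\<lambda>n. rpl_prob xmin \<beta> n (\<lambda>e.
                \<forall>L. valid_distance_labeling n (adj n e) (D n) L \<longrightarrow>
                    real (labeling_length n L) \<ge> c * real n powr (3/2) / ln (real n) ^ k))
            \<longlonglongrightarrow> 1)
       \<and> (\<exists>c>0. \<exists>k::nat.
            (\<lambda>n. rpl_prob xmin \<beta> n (\<lambda>e.
                \<forall>L. two_hop_cover n (adj n e) L \<longrightarrow>
                    real (num_landmarks n L) \<ge> c * real n powr (3/2) / ln (real n) ^ k))
            \<longlonglongrightarrow> 1)"
proof
  interpret power_law xmin \<beta> by unfold_locales (use assms in auto)
  show "\<exists>c>0. \<exists>k::nat. \<forall>D :: nat \<Rightarrow> bool list \<Rightarrow> bool list \<Rightarrow> enat.
            (\<lambda>n. rpl_prob xmin \<beta> n (\<lambda>e.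
                \<forall>L. valid_distance_labeling n (adj n e) (D n) L \<longrightarrow>
                    real (labeling_length n L) \<ge> c * real n powr (3/2) / ln (real n) ^ k))
            \<longlonglongrightarrow> 1"
  proof -
    let ?Lab = "\<lambda>_::nat. UNIV :: bool list set"
    obtain k where k: "\<And>D. few_labels ?Lab length \<Longrightarrow>
        (\<lambda>n. rpl_prob xmin \<beta> n (long_labels ?Lab length D k n)) \<longlonglongrightarrow> 1"
      using long_labels_whp[OF assms(3)] by blast
    have "finite {x \<in> ?Lab n. length x = j} \<and> card {x \<in> ?Lab n. length x = j} \<le> 2 ^ j" for n j
      using finite_lists_length_eq[of "UNIV :: bool set" j] card_lists_length_eq[of "UNIV :: bool set" j] by simp
    moreover have "eventually (\<lambda>n::nat. ln (2 * real 2) \<le> 4 * ln (real n)) at_top" by real_asymp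
    ultimately have "few_labels ?Lab length"
      unfolding few_labels_def by (intro exI[of _ "\<lambda>_. 2"]) auto
    \<comment> \<open>Constant factors are already absorbed in the power of \<open>ln n\<close>, so
      \<open>c = 1\<close> serves.\<close>
    from k[OF this, unfolded long_labels_def] show ?thesis
      by (intro exI[of _ "1::real"] exI[of _ k] conjI allI)
        (simp_all add: valid_distance_labeling_def labeling_length_def)
  qed
  show "\<exists>c>0. \<exists>k::nat. (\<lambda>n. rpl_prob xmin \<beta> n (\<lambda>e.
                \<forall>L. two_hop_cover n (adj n e) L \<longrightarrow>
                    real (num_landmarks n L) \<ge> c * real n powr (3/2) / ln (real n) ^ k))
            \<longlonglongrightarrow> 1"
  proof -
    obtain k where k: "few_labels landmark_labels card \<Longrightarrow>
        (\<lambda>n. rpl_prob xmin \<beta> n (long_labels landmark_labels card (\<lambda>_. landmark_decode) k n)) \<longlonglongrightarrow> 1"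
      using long_labels_whp[OF assms(3)] by blast
    have "eventually (\<lambda>n::nat. ln (2 * real (n * (n + 1) + 1)) \<le> 4 * ln (real n)) at_top"
      unfolding of_nat_add of_nat_mult of_nat_1 by real_asymp
    then have "few_labels landmark_labels card" unfolding few_labels_def using card_landmark_labels
      by (intro exI[of _ "\<lambda>n. n * (n + 1) + 1"] conjI allI) auto
    note lim = k[OF this]
    let ?T = "\<lambda>n e. \<forall>L. two_hop_cover n (adj n e) L \<longrightarrow>
        real (num_landmarks n L) \<ge> 1 * real n powr (3/2) / ln (real n) ^ k"
    have imp: "?T n e" if E: "long_labels landmark_labels card (\<lambda>_. landmark_decode) k n e" for n e
    proof (intro allI impI)
      fix L assume cover: "two_hop_cover n (adj n e) L"
      \<comment> \<open>Attaching the distances makes a cover a labeling whose length, measured by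
        \<open>card\<close>, is exactly its number of landmarks.\<close>
      let ?f = "\<lambda>x. landmark_label (adj n e) (L x) x"
      have "\<forall>x<n. ?f x \<in> landmark_labels n"
        using cover by (auto simp: two_hop_cover_def intro!: landmark_label_in)
      moreover have "\<forall>x<n. \<forall>y<n. landmark_decode (?f x) (?f y) = gdist (adj n e) x y"
        using landmark_decode_correct[OF cover] by blast
      ultimately have "real n powr (3/2) / ln (real n) ^ k \<le> real (\<Sum>x<n. card (?f x))"
        by (rule mp[OF spec[OF E[unfolded long_labels_def], of ?f] conjI])
      then show "real (num_landmarks n L) \<ge> 1 * real n powr (3/2) / ln (real n) ^ k"
        by (simp add: num_landmarks_def card_landmark_label)
    qed
    have "(\<lambda>n. rpl_prob xmin \<beta> n (?T n)) \<longlonglongrightarrow> 1"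
    proof (rule tendsto_sandwich[OF _ _ lim tendsto_const])
      show "eventually (\<lambda>n. rpl_prob xmin \<beta> n (long_labels landmark_labels card (\<lambda>_. landmark_decode) k n)
          \<le> rpl_prob xmin \<beta> n (?T n)) at_top"
        using imp by (intro always_eventually allI rpl_prob_mono) blast
    qed (simp add: rpl_prob_le_1)
    then show ?thesis by (intro exI[of _ "1::real"] conjI exI[of _ k] zero_less_one)
  qed
qed

end
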